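(* Let $V$ be a non-degenerate rank-1 word, let $(X,\sigma)$ be the non-degenerate rank-1 system associated to $V$, and let $(v_n : n\in\mathbb{N})$ be its canonical generating sequence. Then $(X,\sigma)$ is topologically isomorphic to its inverse $(X,\sigma^{-1})$ if and only if for all but finitely many $n\in\mathbb{N}$, $v_{n+1}$ is built symmetrically from $v_n$.
   Context: $\mathbb{N}$ includes $0$. $\mathcal{F}$ is the set of nonempty finite words over $\{0,1\}$ that begin and end with $0$. Juxtaposition denotes concatenation and $1^a$ is the word consisting of $a$ ones. An infinite word $V\in\{0,1\}^{\mathbb{N}}$ is built from $v\in\mathcal{F}$ if there is a sequence $(a_i)_{i\ge 1}$ of natural numbers with $V=v1^{a_1}v1^{a_2}v\cdots$; $A_V=\{v\in\mathcal{F}: V \text{ is built from } v\}$. $V$ is rank-1 if $A_V$ is infinite. A rank-1 word $V$ is degenerate if $V=vvv\cdots$ for some finite word $v$, and non-degenerate otherwise. The rank-1 system associated to $V$ is $(X,\sigma)$, where $X=\{x\in\{0,1\}^{\mathbb{Z}} : \text{every finite subword of } x \text{ is a subword of } V\}$ (with the subspace topology of the product topology) and $\sigma(x)(i)=x(i+1)$. For $v,w\in\mathcal{F}$: $v\preceq w$ ($w$ is built from $v$) if there are $r\ge1$ and $a_1,\dots,a_{r-1}\in\mathbb{N}$ with $w=v1^{a_1}v1^{a_2}v\cdots v1^{a_{r-1}}v$; if moreover $a_1=\dots=a_{r-1}$, then $w$ is built simply from $v$, written $v\preceq_s w$; $v\prec w$ means $v\preceq w$ and $v\ne w$. If $w=v1^{a_1}v1^{a_2}\cdots1^{a_{r-1}}v$,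 then $w$ is built symmetrically from $v$ if $a_i=a_{r-i}$ for all $0<i<r$. $V$ is fundamentally built from $v$ if $v\in A_V$ and for all $u,u'\in A_V$ with $u\prec v\prec u'$ we have $u\not\preceq_s u'$; $B_V$ is the set of $v\in\mathcal{F}$ from which $V$ is fundamentally built. For $V$ a non-degenerate rank-1 word, $B_V$ is infinite and totally ordered by $\preceq$; the canonical generating sequence of $V$ (also called that of $X$) is the enumeration $(v_n:n\in\mathbb{N})$ of $B_V$ with $n\le m$ iff $v_n\preceq v_m$. $(X,\sigma)$ is topologically isomorphic to $(X,\sigma^{-1})$ if there is a homeomorphism $\phi:X\to X$ with $\phi\circ\sigma=\sigma^{-1}\circ\phi$. *)

theory Defs
  imports "HOL-Analysis.Analysis" "HOL-Library.Stream"
begin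

text \<open>
  The alphabet \<open>{0,1}\<close> is \<^typ>\<open>bool\<close>, with \<^term>\<open>False\<close> for \<open>0\<close> and \<^term>\<open>True\<close> for \<open>1\<close>. Finite words
  are lists, infinite words are streams, bi-infinite words are functions on \<^typ>\<open>int\<close>.
  As \<^typ>\<open>bool\<close> carries the discrete topology, the type class topology of \<^typ>\<open>int \<Rightarrow> bool\<close> is the
  product topology of \<open>{0,1}\<^sup>\<int>\<close>.
\<close>

type_synonym fword = "bool list"
type_synonym iword = "bool stream"
type_synonym zword = "int \<Rightarrow> bool"

definition words_F :: "fword set" where
  "words_F = {w. w \<noteq> [] \<and> hd w = False \<and> last w = False}"

definition ones :: "nat \<Rightarrow> fword" where
  "ones a = replicate a True"

text \<open>Spacer sequences are indexed from \<open>1\<close>; the value at \<open>0\<close> is never used.\<close>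

definition spaced_word :: "fword \<Rightarrow> nat \<Rightarrow> (nat \<Rightarrow> nat) \<Rightarrow> fword" where
  \<comment> \<open>\<open>v 1\<^bsup>a 1\<^esup> v 1\<^bsup>a 2\<^esup> v \<dots> v 1\<^bsup>a (r - 1)\<^esup> v\<close>, with \<open>r \<ge> 1\<close> occurrences of \<open>v\<close>\<close>
  "spaced_word v r a = concat (map (\<lambda>i. v @ ones (a i)) [1..<r]) @ v"

definition spaced_stream :: "fword \<Rightarrow> (nat \<Rightarrow> nat) \<Rightarrow> iword" where
  \<comment> \<open>\<open>v 1\<^bsup>a 1\<^esup> v 1\<^bsup>a 2\<^esup> v \<dots>\<close>, for \<open>v \<noteq> []\<close> (\<open>flat\<close> needs nonempty blocks)\<close>
  "spaced_stream v a = flat (smap (\<lambda>i. v @ ones (a i)) (fromN 1))"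

definition built_from :: "fword \<Rightarrow> fword \<Rightarrow> bool" (infix \<open>\<preceq>\<close> 50) where
  "v \<preceq> w \<longleftrightarrow> (\<exists>r\<ge>1. \<exists>a. w = spaced_word v r a)"

definition strictly_built_from :: "fword \<Rightarrow> fword \<Rightarrow> bool" (infix \<open>\<prec>\<close> 50) where
  "v \<prec> w \<longleftrightarrow> v \<preceq> w \<and> v \<noteq> w"

definition simply_built_from :: "fword \<Rightarrow> fword \<Rightarrow> bool" (infix \<open>\<preceq>\<^sub>s\<close> 50) where
  "v \<preceq>\<^sub>s w \<longleftrightarrow> (\<exists>r\<ge>1. \<exists>a. w = spaced_word v r a \<and>
     (\<forall>i j. 0 < i \<and> i < r \<and> 0 < j \<and> j < r \<longrightarrow> a i = a j))"

definition symmetrically_built_from :: "fword \<Rightarrow> fword \<Rightarrow> bool" where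
  \<comment> \<open>the second argument is built from the first\<close>
  "symmetrically_built_from v w \<longleftrightarrow> (\<exists>r\<ge>1. \<exists>a. w = spaced_word v r a \<and>
     (\<forall>i. 0 < i \<and> i < r \<longrightarrow> a i = a (r - i)))"

definition words_A :: "iword \<Rightarrow> fword set" where
  "words_A V = {v \<in> words_F. \<exists>a. V = spaced_stream v a}"

definition rank_one :: "iword \<Rightarrow> bool" where
  "rank_one V \<longleftrightarrow> infinite (words_A V)"

definition degenerate :: "iword \<Rightarrow> bool" where
  "degenerate V \<longleftrightarrow> (\<exists>v. v \<noteq> [] \<and> V = cycle v)"

definition words_B :: "iword \<Rightarrow> fword set" where
  "words_B V = {v \<in> words_A V.
     \<forall>u\<in>words_A V. \<forall>u'\<in>words_A V. u \<prec> v \<and> v \<prec> u' \<longrightarrow> \<not> u \<preceq>\<^sub>s u'}"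

definition canonical_generating_sequence :: "iword \<Rightarrow> (nat \<Rightarrow> fword) \<Rightarrow> bool" where
  "canonical_generating_sequence V v \<longleftrightarrow>
     bij_betw v UNIV (words_B V) \<and> (\<forall>n m. n \<le> m \<longleftrightarrow> v n \<preceq> v m)"

definition subword :: "fword \<Rightarrow> iword \<Rightarrow> bool" where
  "subword w V \<longleftrightarrow> (\<exists>k. stake (length w) (sdrop k V) = w)"

definition system_space :: "iword \<Rightarrow> zword set" where
  "system_space V = {x. \<forall>i n. subword (map (\<lambda>k. x (i + int k)) [0..<n]) V}"

definition zshift :: "zword \<Rightarrow> zword" where
  "zshift x = (\<lambda>i. x (i + 1))"

lemma bij_zshift: "bij zshift"
  by (rule o_bij[where g = "\<lambda>x i. x (i - 1)"]) (auto simp: zshift_def)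

lemma inv_zshift: "inv zshift x = (\<lambda>i. x (i - 1))"
  by (rule inv_f_eq[OF bij_is_inj[OF bij_zshift]]) (simp add: zshift_def)

definition topologically_isomorphic ::
  "'a::topological_space set \<Rightarrow> ('a \<Rightarrow> 'a) \<Rightarrow> 'b::topological_space set \<Rightarrow> ('b \<Rightarrow> 'b) \<Rightarrow> bool" where
  "topologically_isomorphic X S Y T \<longleftrightarrow>
     (\<exists>\<phi> \<psi>. homeomorphism X Y \<phi> \<psi> \<and> (\<forall>x\<in>X. \<phi> (S x) = T (\<phi> x)))"

lemma zshift_system_space: "zshift ` system_space V = system_space V"
proof
  show "zshift ` system_space V \<subseteq> system_space V"
  proof
    fix y assume "y \<in> zshift ` system_space V"
    then obtain x where x: "x \<in> system_space V" and y: "y = zshift x" by blast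
    have "subword (map (\<lambda>k. y (i + int k)) [0..<n]) V" for i n
    proof -
      have "subword (map (\<lambda>k. x ((i + 1) + int k)) [0..<n]) V"
        using x unfolding system_space_def by blast
      then show ?thesis by (simp add: y zshift_def algebra_simps)
    qed
    then show "y \<in> system_space V" by (simp add: system_space_def)
  qed
next
  show "system_space V \<subseteq> zshift ` system_space V"
  proof
    fix x assume x: "x \<in> system_space V"
    have "subword (map (\<lambda>k. x (i + int k - 1)) [0..<n]) V" for i n
    proof -
      have "subword (map (\<lambda>k. x ((i - 1) + int k)) [0..<n]) V"
        using x unfolding system_space_def by blast
      then show ?thesis by (simp add: algebra_simps)
    qed
    then have "inv zshift x \<in> system_space V" by (simp add: system_space_def inv_zshift)
    moreover have "x = zshift (inv zshift x)"
      using bij_zshift by (simp add: bij_is_surj surj_f_inv_f)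
    ultimately show "x \<in> zshift ` system_space V" by blast
  qed
qed

end

theory Submission
  imports Defs
begin

text \<open>Write \<open>V\<close> as the word with gap sequence \<open>g\<close>, that is \<open>0\<close>, then \<open>g 1\<close> ones, then \<open>0\<close>, then \<open>g 2\<close> ones, and so
  on. Then \<open>V\<close> is built from its prefix with \<open>P\<close> zeros iff \<open>g\<close> is constant on every residue class modulo \<open>P\<close>
  other than \<open>0\<close>; call such \<open>P\<close> a level. Levels are closed under gcd and lcm, and the relation of being built from
  becomes divisibility. Non-degeneracy makes residues modulo a level readable from long windows of \<open>g\<close>.

  An isomorphism to the inverse is a sliding block code which maps \<open>V\<close> to a word \<open>y\<close> all of whose prefixes occur
  reversed in \<open>V\<close>. The image of each block of \<open>V\<close> agrees with a prefix of \<open>y\<close> up to bounded end pieces, and counting zeros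
  modulo a fixed level shows that, up to moving the boundaries, the blocks \<open>v\<^sub>n\<close> become blocks of \<open>y\<close> with the same gaps
  up to a constant. Reversing them gives blocks of \<open>V\<close> in which the gaps occur in reversed order, and uniqueness of
  the canonical generating sequence identifies them with \<open>v\<^sub>n\<close>. Conversely, if all \<open>v\<^sub>n\<close> are symmetric over \<open>v\<^sub>N\<close>, then
  reversing a point and replacing each reversed copy of \<open>v\<^sub>N\<close> by \<open>v\<^sub>N\<close> is an involution of \<open>X\<close>.\<close>

section \<open>Levels of a gap sequence\<close>

text \<open>An isomorphism is only a local rule, so it determines the image of a block of
  \<open>V\<close> except near its end, where the rule also reads the following spacer. The obstacle
  is that this undetermined piece could contain a varying number of zeros. That number is bounded by
  a \<open>K\<close> independent of the level, hence one fixed level \<open>q > K + 1\<close> makes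
  the count rigid for all sufficiently long blocks at once. What stays unknown is the place
  \<open>h\<close> in the image block that takes over the role of the spacer, and the lengths around
  it: cutting at \<open>h\<close> turns \<open>P\<close> zeros per block into some \<open>Q\<close>
  and adds an unknown constant \<open>c\<close> to the spacers. Neither loss matters at first,
  because being a level and being simple are statements about equality of gaps at multiples inside
  one block: they are insensitive to adding \<open>c\<close> and to reading backwards. The two
  unknowns are removed only at the end, by comparing infinitely many levels with one and the same
  \<open>c\<close>.\<close>

definition level :: "(nat \<Rightarrow> nat) \<Rightarrow> nat \<Rightarrow> bool" where
  "level g P \<longleftrightarrow> 0 < P \<and>
     (\<forall>i j. 0 < i \<and> 0 < j \<and> i mod P = j mod P \<and> \<not> P dvd i \<longrightarrow> g i = g j)"

lemma levelD: "level g P \<Longrightarrow> 0 < i \<Longrightarrow> 0 < j \<Longrightarrow> i mod P = j mod P \<Longrightarrow> \<not> P dvd i \<Longrightarrow> g i = g j"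
  by (auto simp: level_def)

lemma level_pos: "level g P \<Longrightarrow> 0 < P"
  by (simp add: level_def)

lemma dvd_diff_if_mod_eq: "i mod d = j mod d \<Longrightarrow> i \<le> j \<Longrightarrow> (d::nat) dvd j - i"
  by (metis mod_eq_dvd_iff_nat)

lemma levelI_add:
  assumes "0 < P" and "\<And>i. 0 < i \<Longrightarrow> \<not> P dvd i \<Longrightarrow> g (i + P) = g i"
  shows "level g P"
proof -
  have step: "g (i + k * P) = g i" if "0 < i" "\<not> P dvd i" for i k
  proof (induction k)
    case (Suc k)
    have "g ((i + k * P) + P) = g (i + k * P)"
      using that by (intro assms(2)) auto
    then show ?case using Suc by (simp add: algebra_simps)
  qed simp
  have le: "g i = g j" if "0 < i" "i mod P = j mod P" "\<not> P dvd i" "i \<le> j" for i j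
  proof -
    have "P dvd j - i" using that dvd_diff_if_mod_eq by blast
    then obtain k where "j - i = P * k" by blast
    then have "j = i + k * P" using that by (simp add: mult.commute)
    then show ?thesis using step that by simp
  qed
  show ?thesis
    unfolding level_def
  proof (intro conjI allI impI)
    fix i j assume "0 < i \<and> 0 < j \<and> i mod P = j mod P \<and> \<not> P dvd i"
    then show "g i = g j"
      using le[of i j] le[of j i] by (metis dvd_eq_mod_eq_0 nle_le)
  qed (rule assms(1))
qed

text \<open>Chinese remainder theorem for moduli that need not be coprime. Bezout is applied in the
  natural numbers, \<open>P * x = Q * y + gcd P Q\<close>, so the witness
  \<open>i + Q * (y * m)\<close> only moves upwards and stays positive, as the value
  \<open>g 0\<close> carries no meaning.\<close>

lemma common_residue:
  fixes P Q :: nat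
  assumes "0 < P" "0 < Q" "0 < i" "0 < j" "i mod gcd P Q = j mod gcd P Q"
  obtains k where "0 < k" "k mod P = i mod P" "k mod Q = j mod Q"
proof -
  have le: "\<exists>k>0. k mod Q = i mod Q \<and> k mod P = j mod P"
    if "j \<le> i" "i mod gcd P Q = j mod gcd P Q" "0 < P" "0 < i" for i j P Q :: nat
  proof -
    have "gcd P Q dvd i - j" using that dvd_diff_if_mod_eq by metis
    then obtain m where m: "i - j = gcd P Q * m" by blast
    have "P \<noteq> 0" using that by simp
    then obtain x y where xy: "P * x = Q * y + gcd P Q"
      using bezout_nat[of P Q] by blast
    have "i + Q * (y * m) = j + P * (x * m)"
    proof -
      have "i = j + gcd P Q * m" using m that by simp
      moreover have "P * x * m = Q * y * m + gcd P Q * m" using xy by (simp add: algebra_simps)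
      ultimately show ?thesis by (simp add: algebra_simps)
    qed
    then have "(i + Q * (y * m)) mod P = j mod P" by simp
    then show ?thesis using that by (intro exI[of _ "i + Q * (y * m)"]) auto
  qed
  show thesis
  proof (cases "j \<le> i")
    case True
    from le[of j i Q P] True assms that show ?thesis by (auto simp: gcd.commute)
  next
    case False
    from le[of i j P Q] False assms that show ?thesis by auto
  qed
qed

text \<open>An index \<open>k\<close> that agrees with \<open>i\<close> modulo \<open>P\<close> and
  with \<open>j\<close> modulo \<open>Q\<close> links the two: \<open>g i = g k\<close> at level
  \<open>P\<close> and \<open>g k = g j\<close> at level \<open>Q\<close>. Neither residue is
  exceptional, since \<open>gcd P Q\<close> divides both moduli but neither \<open>i\<close> nor
  \<open>j\<close>.\<close>

lemma level_gcd:
  assumes P: "level g P" and Q: "level g Q"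
  shows "level g (gcd P Q)"
  unfolding level_def
proof (intro conjI allI impI)
  show "0 < gcd P Q" using level_pos[OF P] by simp
  fix i j assume ij: "0 < i \<and> 0 < j \<and> i mod gcd P Q = j mod gcd P Q \<and> \<not> gcd P Q dvd i"
  then obtain k where k: "0 < k" "k mod P = i mod P" "k mod Q = j mod Q"
    using common_residue[of P Q i j] level_pos[OF P] level_pos[OF Q] by blast
  have "\<not> P dvd i" "\<not> Q dvd j"
    using ij by (metis dvd_trans gcd_dvd1, metis dvd_trans gcd_dvd2 dvd_eq_mod_eq_0)
  then show "g i = g j"
    using levelD[OF P, of i k] levelD[OF Q, of j k] ij k by simp
qed

lemma level_lcm:
  assumes P: "level g P" and Q: "level g Q"
  shows "level g (lcm P Q)"
  unfolding level_def
proof (intro conjI allI impI)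
  show "0 < lcm P Q" using level_pos[OF P] level_pos[OF Q] by (simp add: lcm_pos_nat)
  fix i j assume ij: "0 < i \<and> 0 < j \<and> i mod lcm P Q = j mod lcm P Q \<and> \<not> lcm P Q dvd i"
  then have "\<not> P dvd i \<or> \<not> Q dvd i" by (auto intro: lcm_least)
  moreover have "i mod P = j mod P" "i mod Q = j mod Q"
    using ij by (metis dvd_lcm1 mod_mod_cancel, metis dvd_lcm2 mod_mod_cancel)
  ultimately show "g i = g j" using levelD[OF P] levelD[OF Q] ij by blast
qed

text \<open>For levels with \<open>p dvd q\<close> this is \<open>\<preceq>\<^sub>s\<close> between
  the prefixes with \<open>p\<close> and \<open>q\<close> zeros: all spacers between the
  \<open>p\<close>-blocks inside a \<open>q\<close>-block are equal.\<close>

definition simple :: "(nat \<Rightarrow> nat) \<Rightarrow> nat \<Rightarrow> nat \<Rightarrow> bool" where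
  "simple g p q \<longleftrightarrow> (\<forall>i j. 0 < i \<and> 0 < j \<and> p dvd i \<and> p dvd j \<and> \<not> q dvd i \<and> \<not> q dvd j \<longrightarrow> g i = g j)"

lemma simpleD: "simple g p q \<Longrightarrow> 0 < i \<Longrightarrow> 0 < j \<Longrightarrow> p dvd i \<Longrightarrow> p dvd j \<Longrightarrow> \<not> q dvd i \<Longrightarrow> \<not> q dvd j
   \<Longrightarrow> g i = g j"
  unfolding simple_def by blast

lemma simple_mono: "simple g p q \<Longrightarrow> p dvd p' \<Longrightarrow> q' dvd q \<Longrightarrow> simple g p' q'"
  unfolding simple_def by (meson dvd_trans)

text \<open>The index \<open>gcd P Q\<close> serves as a hub, being exceptional for neither level.
  An index \<open>i\<close> not divisible by \<open>P\<close> is joined to it by some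
  \<open>k\<close> with the residue of \<open>i\<close> modulo \<open>P\<close> and that of
  \<open>gcd P Q\<close> modulo \<open>Q\<close>; the other case is dual. Consequently a fundamental
  level is comparable with every level.\<close>

lemma simple_gcd_lcm:
  assumes P: "level g P" and Q: "level g Q" and nPQ: "\<not> P dvd Q" "\<not> Q dvd P"
  shows "simple g (gcd P Q) (lcm P Q)"
proof -
  have d0: "0 < gcd P Q" using level_pos[OF P] by simp
  have nd: "\<not> P dvd gcd P Q" "\<not> Q dvd gcd P Q" using nPQ by auto
  have hub: "g i = g (gcd P Q)" if i: "0 < i" "gcd P Q dvd i" "\<not> lcm P Q dvd i" for i
  proof -
    consider "\<not> P dvd i" | "\<not> Q dvd i" using i(3) by (auto intro: lcm_least)
    then show ?thesis
    proof cases
      case 1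
      obtain k where k: "0 < k" "k mod P = i mod P" "k mod Q = gcd P Q mod Q"
        using common_residue[of P Q i "gcd P Q"] level_pos[OF P] level_pos[OF Q] i d0 by auto
      then show ?thesis
        using levelD[OF P, of i k] levelD[OF Q, of "gcd P Q" k] 1 i nd d0 by simp
    next
      case 2
      obtain k where k: "0 < k" "k mod P = gcd P Q mod P" "k mod Q = i mod Q"
        using common_residue[of P Q "gcd P Q" i] level_pos[OF P] level_pos[OF Q] i d0 by auto
      then show ?thesis
        using levelD[OF Q, of i k] levelD[OF P, of "gcd P Q" k] 2 i nd d0 by simp
    qed
  qed
  then show ?thesis unfolding simple_def by metis
qed

section \<open>Fundamental levels and their locality\<close>

definition fundamental :: "(nat \<Rightarrow> nat) \<Rightarrow> nat \<Rightarrow> bool" where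
  "fundamental g P \<longleftrightarrow> level g P \<and>
     (\<forall>p p'. level g p \<and> level g p' \<and> p dvd P \<and> p \<noteq> P \<and> P dvd p' \<and> P \<noteq> p' \<longrightarrow> \<not> simple g p p')"

text \<open>Raising the lower end from \<open>p\<close> to \<open>lcm p A\<close> keeps the pair
  simple; this is of no use only if the lcm is \<open>P\<close> itself. Then \<open>p\<close> and
  \<open>A\<close> are incomparable, so by \<open>simple_gcd_lcm\<close> the gaps at multiples of
  \<open>A\<close> outside \<open>P\<close> equal \<open>g p\<close>, as do those at multiples of
  \<open>P\<close> outside \<open>p'\<close>, and \<open>A\<close> works. The dual
  \<open>simple_upper\<close> lowers the upper end to a gcd.\<close>

lemma simple_lower:
  assumes l: "level g A" "level g P" "level g p" "level g p'"
    and d: "A dvd P" "A \<noteq> P" "p dvd P" "p \<noteq> P" "P dvd p'" "P \<noteq> p'" and s: "simple g p p'"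
  shows "\<exists>q. level g q \<and> A dvd q \<and> q dvd P \<and> q \<noteq> P \<and> simple g q p'"
proof (cases "lcm p A = P")
  case False
  have "simple g (lcm p A) p'" using simple_mono[OF s, of "lcm p A" p'] by simp
  moreover have "level g (lcm p A)" using level_lcm l by blast
  ultimately show ?thesis using False d by (intro exI[of _ "lcm p A"]) (auto intro: lcm_least)
next
  case True
  have n: "\<not> A dvd p" "\<not> p dvd A" using True d by (metis lcm_proj1_if_dvd_nat, metis lcm_proj2_if_dvd_nat)
  have s2: "simple g (gcd p A) P" using simple_gcd_lcm[OF l(3) l(1)] n True by simp
  have P0: "0 < P" "0 < p" "0 < A" using l level_pos by auto
  have nPp: "\<not> P dvd p" using d by auto
  have "simple g A p'"
    unfolding simple_def
  proof -
    have npp: "\<not> p' dvd P" using d dvd_antisym by blast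
    then have npp': "\<not> p' dvd p" using d dvd_trans by blast
    have "g i = g p" if i: "0 < i" "A dvd i" "\<not> p' dvd i" for i
    proof (cases "P dvd i")
      case True
      then have "p dvd i" using d dvd_trans by blast
      then show ?thesis using simpleD[OF s, of i p] i P0 npp' by simp
    next
      case False
      moreover have "gcd p A dvd i" using i(2) gcd_dvd2 dvd_trans by blast
      ultimately show ?thesis using simpleD[OF s2, of i p] i P0 nPp by simp
    qed
    then show "\<forall>i j. 0 < i \<and> 0 < j \<and> A dvd i \<and> A dvd j \<and> \<not> p' dvd i \<and> \<not> p' dvd j \<longrightarrow> g i = g j"
      by metis
  qed
  then show ?thesis using l(1) d(1,2) by (intro exI[of _ A]) simp
qed

lemma simple_upper:
  assumes l: "level g B" "level g P" "level g p" "level g p'"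
    and d: "P dvd B" "P \<noteq> B" "p dvd P" "p \<noteq> P" "P dvd p'" "P \<noteq> p'" and s: "simple g p p'"
  shows "\<exists>q. level g q \<and> P dvd q \<and> P \<noteq> q \<and> q dvd B \<and> simple g p q"
proof (cases "gcd p' B = P")
  case False
  have "simple g p (gcd p' B)" using simple_mono[OF s, of p "gcd p' B"] by simp
  moreover have "level g (gcd p' B)" using level_gcd l by blast
  ultimately show ?thesis using False d by (intro exI[of _ "gcd p' B"]) auto
next
  case True
  have n: "\<not> p' dvd B" "\<not> B dvd p'" using True d by (metis gcd_proj1_if_dvd_nat, metis gcd_proj2_if_dvd_nat)
  have s2: "simple g P (lcm p' B)" using simple_gcd_lcm[OF l(4) l(1)] n True by simp
  have P0: "0 < P" "0 < p" using l level_pos by auto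
  have npp: "\<not> p' dvd P" "\<not> B dvd P" using d dvd_antisym by blast+
  then have npp': "\<not> p' dvd p" using d dvd_trans by blast
  have "\<not> lcm p' B dvd P" using npp by (meson dvd_lcm1 dvd_trans)
  have "simple g p B"
    unfolding simple_def
  proof -
    have gP: "g P = g p" using simpleD[OF s, of P p] P0 d npp npp' by simp
    have "g i = g p" if i: "0 < i" "p dvd i" "\<not> B dvd i" for i
    proof (cases "p' dvd i")
      case False
      then show ?thesis using simpleD[OF s, of i p] i P0 npp' by simp
    next
      case True
      then have "P dvd i" using d dvd_trans by blast
      moreover have "\<not> lcm p' B dvd i" using i by (meson dvd_lcm2 dvd_trans)
      ultimately have "g i = g P" using simpleD[OF s2, of i P] i P0 \<open>\<not> lcm p' B dvd P\<close> by auto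
      then show ?thesis using gP by simp
    qed
    then show "\<forall>i j. 0 < i \<and> 0 < j \<and> p dvd i \<and> p dvd j \<and> \<not> B dvd i \<and> \<not> B dvd j \<longrightarrow> g i = g j"
      by metis
  qed
  then show ?thesis using l(1) d(1,2) by (intro exI[of _ B]) simp
qed

text \<open>Any simple pair around \<open>P\<close> can be squeezed first above \<open>A\<close> and
  then below \<open>B\<close>. This makes fundamentality transferable: a reflected block gives
  information only about the levels between its two ends.\<close>

lemma fundamental_local:
  assumes l: "level g A" "level g P" "level g B" and d: "A dvd P" "A \<noteq> P" "P dvd B" "P \<noteq> B"
    and no: "\<And>p p'. level g p \<Longrightarrow> level g p' \<Longrightarrow> A dvd p \<Longrightarrow> p dvd P \<Longrightarrow> p \<noteq> P \<Longrightarrow> P dvd p' \<Longrightarrow> P \<noteq> p' \<Longrightarrow>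
        p' dvd B \<Longrightarrow> \<not> simple g p p'"
  shows "fundamental g P"
  unfolding fundamental_def
proof (intro conjI allI impI notI l(2))
  fix p p' assume pp: "level g p \<and> level g p' \<and> p dvd P \<and> p \<noteq> P \<and> P dvd p' \<and> P \<noteq> p'" and s: "simple g p p'"
  then obtain q where q: "level g q" "A dvd q" "q dvd P" "q \<noteq> P" "simple g q p'"
    using simple_lower[OF l(1,2), of p p'] d by blast
  then obtain q' where "level g q'" "P dvd q'" "P \<noteq> q'" "q' dvd B" "simple g q q'"
    using simple_upper[OF l(3,2), of q p'] d pp by blast
  then show False using no q by blast
qed

section \<open>Levels and simple pairs inside one block, and their reflection\<close>

lemma scaled_level_iff:
  assumes P: "level g P" and rP: "level g (r * P)" and d: "d dvd r"
  shows "level g (d * P) \<longleftrightarrow>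
    (\<forall>i j. 0 < i \<and> i < r \<and> 0 < j \<and> j < r \<and> i mod d = j mod d \<and> \<not> d dvd i \<longrightarrow> g (i * P) = g (j * P))"
    (is "?L \<longleftrightarrow> ?R")
proof
  have P0: "0 < P" using level_pos[OF P] .
  have r0: "0 < r" using level_pos[OF rP] by simp
  show ?L if ?R
    unfolding level_def
  proof (intro conjI allI impI)
    show "0 < d * P" using P0 r0 d by (auto intro!: Nat.gr0I)
    fix i j assume ij: "0 < i \<and> 0 < j \<and> i mod (d * P) = j mod (d * P) \<and> \<not> d * P dvd i"
    have mP: "i mod P = j mod P" using ij by (metis dvd_triv_right mod_mod_cancel)
    show "g i = g j"
    proof (cases "P dvd i")
      case False
      then show ?thesis using levelD[OF P] ij mP by blast
    next
      case True
      then have "P dvd j" using mP by (simp add: dvd_eq_mod_eq_0)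
      with True obtain a b where a: "i = a * P" and b: "j = b * P" by (metis dvdE mult.commute)
      have ab: "0 < a" "0 < b" "a mod d = b mod d" "\<not> d dvd a"
        using ij P0 by (auto simp: a b simp flip: mult_mod_left)
      have nb: "\<not> d dvd b" using ab by (simp add: dvd_eq_mod_eq_0)
      have n: "\<not> r dvd a" "\<not> r dvd b" using ab nb d dvd_trans by blast+
      \<comment> \<open>Every multiple of \<open>P\<close> outside \<open>r * P\<close> is reduced
        into the first \<open>r\<close> blocks, whose spacers are the only data on the right-hand
        side.\<close>
      have red: "g (x * P) = g ((x mod r) * P)" if "0 < x" "\<not> r dvd x" for x
        using levelD[OF rP, of "x * P" "(x mod r) * P"] that P0
        by (auto simp: mod_greater_zero_iff_not_dvd simp flip: mult_mod_left)
      have "g ((a mod r) * P) = g ((b mod r) * P)"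
        using that[rule_format, of "a mod r" "b mod r"] ab n r0 d
        by (simp add: mod_greater_zero_iff_not_dvd mod_mod_cancel dvd_mod_iff)
      then show ?thesis using red ab n a b by simp
    qed
  qed
  show ?R if ?L
  proof (intro allI impI)
    fix i j assume ij: "0 < i \<and> i < r \<and> 0 < j \<and> j < r \<and> i mod d = j mod d \<and> \<not> d dvd i"
    then show "g (i * P) = g (j * P)"
      using levelD[OF that, of "i * P" "j * P"] P0 by (simp flip: mult_mod_left)
  qed
qed

lemma scaled_simple_iff:
  assumes P: "level g P" and rP: "level g (r * P)" and d: "d dvd r" "e dvd r"
  shows "simple g (d * P) (e * P) \<longleftrightarrow>
    (\<forall>i j. 0 < i \<and> i < r \<and> 0 < j \<and> j < r \<and> d dvd i \<and> d dvd j \<and> \<not> e dvd i \<and> \<not> e dvd j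
       \<longrightarrow> g (i * P) = g (j * P))"
    (is "?L \<longleftrightarrow> ?R")
proof
  have P0: "0 < P" using level_pos[OF P] .
  have r0: "0 < r" using level_pos[OF rP] by simp
  show ?L if ?R
    unfolding simple_def
  proof (intro allI impI)
    fix i j assume ij: "0 < i \<and> 0 < j \<and> d * P dvd i \<and> d * P dvd j \<and> \<not> e * P dvd i \<and> \<not> e * P dvd j"
    then obtain a b where a: "i = a * P" and b: "j = b * P" by (metis dvdE mult.commute mult.left_commute)
    have ab: "0 < a" "0 < b" "d dvd a" "d dvd b" "\<not> e dvd a" "\<not> e dvd b"
      using ij P0 by (auto simp: a b)
    have n: "\<not> r dvd a" "\<not> r dvd b" using ab d dvd_trans by blast+
    have red: "g (x * P) = g ((x mod r) * P)" if "0 < x" "\<not> r dvd x" for x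
      using levelD[OF rP, of "x * P" "(x mod r) * P"] that P0
      by (auto simp: mod_greater_zero_iff_not_dvd simp flip: mult_mod_left)
    have "g ((a mod r) * P) = g ((b mod r) * P)"
      using that[rule_format, of "a mod r" "b mod r"] ab n r0 d
      by (simp add: mod_greater_zero_iff_not_dvd dvd_mod_iff)
    then show "g i = g j" using red ab n a b by simp
  qed
  show ?R if ?L
    using simpleD[OF that] P0 by simp
qed

lemma mod_reflect:
  fixes d r i j :: nat
  assumes "i \<le> r" "j \<le> r" "i mod d = j mod d"
  shows "(r - i) mod d = (r - j) mod d"
proof -
  have "(r - i) mod d = (r - j) mod d" if "i \<le> j" "i mod d = j mod d" "j \<le> r" for i j
  proof -
    have "(r - i) - (r - j) = j - i" using that by simp
    then have "d dvd (r - i) - (r - j)" using that dvd_diff_if_mod_eq by metis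
    then show ?thesis using that by (subst mod_eq_dvd_iff_nat) auto
  qed
  then show ?thesis using assms by (metis nle_le)
qed

lemma dvd_reflect: "d dvd r \<Longrightarrow> i < r \<Longrightarrow> d dvd r - i \<longleftrightarrow> d dvd (i::nat)"
  by (meson dvd_diff_nat dvd_diffD1 less_imp_le)

text \<open>By \<open>scaled_level_iff\<close> both sides say that certain gaps at multiples inside
  one block coincide. The constant \<open>c\<close> cancels in such equalities, and sending
  \<open>i\<close> to \<open>r - i\<close> respects residues modulo a divisor \<open>d\<close> of
  \<open>r\<close>, including the exceptional class.\<close>

lemma reflected_level:
  assumes P: "level g P" "level g (r * P)" and Q: "level g Q" "level g (r * Q)" and d: "d dvd r"
    and refl: "\<And>i. 0 < i \<Longrightarrow> i < r \<Longrightarrow> int (g (i * Q)) = int (g ((r - i) * P)) + c"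
  shows "level g (d * Q) \<longleftrightarrow> level g (d * P)"
proof -
  have eq: "g (i * Q) = g (j * Q) \<longleftrightarrow> g ((r - i) * P) = g ((r - j) * P)"
    if "0 < i" "i < r" "0 < j" "j < r" for i j
    using refl[of i] refl[of j] that by auto
  show ?thesis
    unfolding scaled_level_iff[OF P d] scaled_level_iff[OF Q d]
  proof (intro iffI allI impI)
    fix i j assume *: "\<forall>i j. 0 < i \<and> i < r \<and> 0 < j \<and> j < r \<and> i mod d = j mod d \<and> \<not> d dvd i \<longrightarrow> g (i * Q) = g (j * Q)"
     and ij: "0 < i \<and> i < r \<and> 0 < j \<and> j < r \<and> i mod d = j mod d \<and> \<not> d dvd i"
    have "g ((r - i) * Q) = g ((r - j) * Q)"
      using *[rule_format, of "r - i" "r - j"] ij mod_reflect[of i r j d] dvd_reflect[OF d, of i] by auto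
    then show "g (i * P) = g (j * P)" using eq[of "r - i" "r - j"] ij by simp
  next
    fix i j assume *: "\<forall>i j. 0 < i \<and> i < r \<and> 0 < j \<and> j < r \<and> i mod d = j mod d \<and> \<not> d dvd i \<longrightarrow> g (i * P) = g (j * P)"
     and ij: "0 < i \<and> i < r \<and> 0 < j \<and> j < r \<and> i mod d = j mod d \<and> \<not> d dvd i"
    have "g ((r - i) * P) = g ((r - j) * P)"
      using *[rule_format, of "r - i" "r - j"] ij mod_reflect[of i r j d] dvd_reflect[OF d, of i] by auto
    then show "g (i * Q) = g (j * Q)" using eq[of i j] ij by simp
  qed
qed

lemma reflected_simple:
  assumes P: "level g P" "level g (r * P)" and Q: "level g Q" "level g (r * Q)" and d: "d dvd r" "e dvd r"
    and refl: "\<And>i. 0 < i \<Longrightarrow> i < r \<Longrightarrow> int (g (i * Q)) = int (g ((r - i) * P)) + c"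
  shows "simple g (d * Q) (e * Q) \<longleftrightarrow> simple g (d * P) (e * P)"
proof -
  have eq: "g (i * Q) = g (j * Q) \<longleftrightarrow> g ((r - i) * P) = g ((r - j) * P)"
    if "0 < i" "i < r" "0 < j" "j < r" for i j
    using refl[of i] refl[of j] that by auto
  show ?thesis
    unfolding scaled_simple_iff[OF P d] scaled_simple_iff[OF Q d]
  proof (intro iffI allI impI)
    fix i j assume *: "\<forall>i j. 0 < i \<and> i < r \<and> 0 < j \<and> j < r \<and> d dvd i \<and> d dvd j \<and> \<not> e dvd i \<and> \<not> e dvd j
       \<longrightarrow> g (i * Q) = g (j * Q)"
     and ij: "0 < i \<and> i < r \<and> 0 < j \<and> j < r \<and> d dvd i \<and> d dvd j \<and> \<not> e dvd i \<and> \<not> e dvd j"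
    have "g ((r - i) * Q) = g ((r - j) * Q)"
      using *[rule_format, of "r - i" "r - j"] ij dvd_reflect d by auto
    then show "g (i * P) = g (j * P)" using eq[of "r - i" "r - j"] ij by simp
  next
    fix i j assume *: "\<forall>i j. 0 < i \<and> i < r \<and> 0 < j \<and> j < r \<and> d dvd i \<and> d dvd j \<and> \<not> e dvd i \<and> \<not> e dvd j
       \<longrightarrow> g (i * P) = g (j * P)"
     and ij: "0 < i \<and> i < r \<and> 0 < j \<and> j < r \<and> d dvd i \<and> d dvd j \<and> \<not> e dvd i \<and> \<not> e dvd j"
    have "g ((r - i) * P) = g ((r - j) * P)"
      using *[rule_format, of "r - i" "r - j"] ij dvd_reflect d by auto
    then show "g (i * Q) = g (j * Q)" using eq[of i j] ij by simp
  qed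
qed

section \<open>Non-periodic gap sequences with infinitely many levels: recognizability\<close>

locale rank_one_gaps =
  fixes g :: "nat \<Rightarrow> nat"
  assumes infinite_levels: "infinite {P. level g P}"
    and not_periodic: "\<And>P. 0 < P \<Longrightarrow> \<exists>t>0. g (t + P) \<noteq> g t"
begin

lemma large_level: obtains P where "level g P" "n < P"
proof -
  have "\<exists>P. level g P \<and> n < P"
    using infinite_levels finite_nat_set_iff_bounded_le[of "{P. level g P}"] by (auto simp: not_le)
  then show ?thesis using that by blast
qed

text \<open>If two windows at inequivalent positions agree, then each shows that the other has no exceptional values
  at the multiples of \<^term>\<open>P\<close>, so that \<^term>\<open>g\<close> is \<^term>\<open>P\<close>-periodic along the window; a long such
  window contains a complete block of a higher level, which then makes \<^term>\<open>g\<close> periodic near its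
  origin.\<close>

lemma recognizability:
  assumes P: "level g P"
  obtains T where "\<And>i i'. 0 < i \<Longrightarrow> 0 < i' \<Longrightarrow> (\<And>s. s < T \<Longrightarrow> g (i + s) = g (i' + s)) \<Longrightarrow> i mod P = i' mod P"
proof -
  obtain t where t: "0 < t" "g (t + P) \<noteq> g t" using not_periodic level_pos[OF P] by blast
  obtain Q where Q: "level g Q" "t + P < Q" using large_level by blast
  show thesis
  proof (rule that[of "Q + P"], rule ccontr)
    fix i i' :: nat
    assume i: "0 < i" "0 < i'" and w: "\<And>s. s < Q + P \<Longrightarrow> g (i + s) = g (i' + s)" and ne: "i mod P \<noteq> i' mod P"
    have per: "g (i + s + P) = g (i + s)" if "s < Q" for s
    proof (cases "P dvd i + s")
      case False
      then show ?thesis using levelD[OF P, of "i + s" "i + s + P"] i by simp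
    next
      case True
      have "\<not> P dvd i' + s"
      proof
        assume "P dvd i' + s"
        then have "(i + s) mod P = (i' + s) mod P" using True by (simp add: dvd_eq_mod_eq_0)
        then have "i mod P = i' mod P" by (simp add: nat_mod_eq_iff)
        with ne show False by simp
      qed
      then have "g (i' + s + P) = g (i' + s)" using levelD[OF P, of "i' + s" "i' + s + P"] i by simp
      moreover have "g (i + s) = g (i' + s)" using w that by simp
      moreover have "g (i + (s + P)) = g (i' + (s + P))" using w[of "s + P"] that by simp
      ultimately show ?thesis by (simp add: add.assoc)
    qed
    \<comment> \<open>The offset makes \<open>i + s\<close> congruent to \<open>t\<close> modulo
      \<open>Q\<close>; since \<open>t + P < Q\<close>, neither \<open>t\<close> nor
      \<open>t + P\<close> is exceptional, so the window must show
      \<open>g (t + P) \<noteq> g t\<close>.\<close>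
    define s where "s = (t + (Q - i mod Q)) mod Q"
    have "0 < Q" using Q by simp
    have s: "s < Q" by (simp add: s_def \<open>0 < Q\<close>)
    have "(i + s) mod Q = (i mod Q + (t + (Q - i mod Q))) mod Q"
      unfolding s_def by (simp add: mod_simps)
    also have "i mod Q + (t + (Q - i mod Q)) = t + Q"
      using \<open>0 < Q\<close> mod_less_divisor[of Q i] by linarith
    finally have m: "(i + s) mod Q = t mod Q" by simp
    have "g (i + s) = g t" using levelD[OF Q(1), of t "i + s"] t m Q i nat_dvd_not_less[of t Q] by simp
    moreover have "(t + P) mod Q = (i + s + P) mod Q" using m by (metis mod_add_left_eq)
    then have "g (i + s + P) = g (t + P)"
      using levelD[OF Q(1), of "t + P" "i + s + P"] t Q i nat_dvd_not_less[of "t + P" Q] by simp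
    ultimately show False using per[OF s] t by simp
  qed
qed

text \<open>Hence \<^term>\<open>g\<close> is determined by its finite windows: a block of \<open>g'\<close> has to start at a block of \<^term>\<open>g\<close>,
  because otherwise the exceptional gaps of \<open>g'\<close> fall into a class on which \<^term>\<open>g\<close> is constant.\<close>

lemma determined_by_windows:
  assumes win: "\<And>n. \<exists>b. \<forall>i. 0 < i \<and> i \<le> n \<longrightarrow> g' i = g (b + i)"
    and lev: "\<And>n. \<exists>Q>n. level g' Q \<and> (\<exists>t>0. g' (t + Q) \<noteq> g' t)"
    and i: "0 < i"
  shows "g' i = g i"
proof -
  obtain P where P: "level g P" "i < P" using large_level by blast
  obtain T where T: "\<And>i i'. 0 < i \<Longrightarrow> 0 < i' \<Longrightarrow> (\<And>s. s < T \<Longrightarrow> g (i + s) = g (i' + s)) \<Longrightarrow> i mod P = i' mod P"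
    using recognizability[OF P(1)] by blast
  obtain Q t where Q: "Q > T + P" "level g' Q" and t: "t > 0" "g' (t + Q) \<noteq> g' t" using lev by blast
  have Qt: "Q dvd t" using t levelD[OF Q(2), of t "t + Q"] by auto
  obtain b where b: "\<And>i. 0 < i \<Longrightarrow> i \<le> t + 2 * Q + T \<Longrightarrow> g' i = g (b + i)" using win by blast
  \<comment> \<open>The first two \<open>Q\<close>-blocks of \<open>g'\<close> begin with the same
    \<open>T\<close> gaps, and the window carries this over to \<open>g\<close>; recognizability
    then turns the distance \<open>Q\<close> into a multiple of \<open>P\<close>.\<close>
  have "(b + 1) mod P = (b + 1 + Q) mod P"
  proof (rule T)
    fix s assume s: "s < T"
    have "g' (1 + s) = g' (1 + s + Q)"
      using levelD[OF Q(2), of "1 + s" "1 + s + Q", OF _ _ mod_add_self2[symmetric]]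
        s Q nat_dvd_not_less[of "1 + s" Q] by simp
    then show "g (b + 1 + s) = g (b + 1 + Q + s)"
      using b[of "1 + s"] b[of "1 + s + Q"] s by (simp add: algebra_simps)
  qed auto
  then have PQ: "P dvd Q" using dvd_diff_if_mod_eq[of "b + 1" P "b + 1 + Q"] by simp
  have "P dvd b"
  proof (rule ccontr)
    assume "\<not> P dvd b"
    moreover have "P dvd t" using PQ Qt dvd_trans by blast
    ultimately have n: "\<not> P dvd b + t" by (simp add: dvd_add_left_iff)
    have "(b + (t + Q)) mod P = (b + t) mod P" using PQ by (auto simp flip: add.assoc)
    then have "g (b + t) = g (b + (t + Q))" using levelD[OF P(1), of "b + t" "b + (t + Q)"] n t by simp
    then show False using b[of t] b[of "t + Q"] t by simp
  qed
  then have "g (b + i) = g i"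
    using levelD[OF P(1), of i "b + i"] i P nat_dvd_not_less[of i P] by auto
  then show ?thesis using b[of i] i Q P by simp
qed

end

text \<open>Position of zero number \<open>n\<close>, counted from \<open>0\<close>. Hence
  \<open>zero_pos g (p - 1) + 1\<close> is the length of the prefix with \<open>p\<close> zeros, and
  at a level \<open>p\<close> the blocks start at the positions
  \<open>zero_pos g (i * p)\<close>.\<close>

definition zero_pos :: "(nat \<Rightarrow> nat) \<Rightarrow> nat \<Rightarrow> nat" where
  "zero_pos g n = (\<Sum>i=1..n. Suc (g i))"

lemma zero_pos_0 [simp]: "zero_pos g 0 = 0"
  by (simp add: zero_pos_def)

lemma zero_pos_Suc [simp]: "zero_pos g (Suc n) = zero_pos g n + Suc (g (Suc n))"
  by (simp add: zero_pos_def)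

lemma zero_pos_add_le: "zero_pos g n + k \<le> zero_pos g (n + k)"
  by (induction k) auto

lemma strict_mono_zero_pos: "strict_mono (zero_pos g)"
  by (simp add: strict_mono_Suc_iff)

text \<open>By \<open>fundamental_local\<close> the reflection carries fundamental levels to fundamental levels without
  gaps, so \<open>Q\<close> is a shift of \<open>P\<close>; since the lengths of the corresponding prefixes differ by the constant
  \<open>c\<close>, the shift is \<open>0\<close> and then \<open>c = 0\<close>.\<close>

lemma symmetric_of_reflected_chain:
  assumes bij: "bij_betw P UNIV {p. fundamental g p}" and ord: "\<And>n m. n \<le> m \<longleftrightarrow> P n dvd P m"
    and Q: "\<And>m. M \<le> m \<Longrightarrow> level g (Q m)"
    and ratio: "\<And>m n. M \<le> m \<Longrightarrow> m \<le> n \<Longrightarrow> Q n * P m = Q m * P n"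
    and refl: "\<And>m n i. M \<le> m \<Longrightarrow> m \<le> n \<Longrightarrow> 0 < i \<Longrightarrow> i * P m < P n \<Longrightarrow>
        int (g (i * Q m)) = int (g (P n - i * P m)) + c"
    and c: "\<And>m. M \<le> m \<Longrightarrow> c = int (zero_pos g (P m - 1)) - int (zero_pos g (Q m - 1))"
  shows "\<exists>N. \<forall>n\<ge>N. \<forall>i. 0 < i \<and> i * P n < P (Suc n) \<longrightarrow> g (i * P n) = g (P (Suc n) - i * P n)"
proof -
  have fP: "fundamental g (P m)" for m using bij by (auto simp: bij_betw_def)
  have fP_ex: "\<exists>k. p = P k" if "fundamental g p" for p using bij that by (auto simp: bij_betw_def)
  have lP: "level g (P m)" for m using fP by (simp add: fundamental_def)
  have P0: "0 < P m" for m using level_pos[OF lP] .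
  have injP: "P m = P n \<longleftrightarrow> m = n" for m n using ord[of m n] ord[of n m] by auto
  have rat: "\<exists>r. P n = r * P m \<and> Q n = r * Q m \<and> 0 < r" if mn: "M \<le> m" "m \<le> n" for m n
  proof -
    obtain r where r: "P n = r * P m" using ord[of m n] mn by (auto simp: dvd_def mult.commute)
    then have "Q n * P m = (r * Q m) * P m" using ratio[OF mn] by (simp add: algebra_simps)
    then have "Q n = r * Q m" using P0[of m] by simp
    then show ?thesis using r P0[of n] by (intro exI[of _ r]) (auto intro: Nat.gr0I)
  qed
  have P_less: "m + P 0 \<le> P m" for m
  proof (induction m)
    case (Suc m)
    have "P m dvd P (Suc m)" "P m \<noteq> P (Suc m)" using ord[of m "Suc m"] injP by auto
    then have "P m < P (Suc m)" using dvd_imp_le[of "P m" "P (Suc m)"] P0[of "Suc m"] by simp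
    then show ?case using Suc by simp
  qed simp
  have Q0: "0 < Q m" if "M \<le> m" for m using level_pos[OF Q[OF that]] .
  have refl': "int (g (i * Q m)) = int (g ((r - i) * P m)) + c"
    if "M \<le> m" "m \<le> n" "P n = r * P m" "0 < i" "i < r" for m n r i
    using refl[of m n i] that P0[of m] by (simp add: diff_mult_distrib)
  have lev_iff: "level g (d * Q m) \<longleftrightarrow> level g (d * P m)"
    if "M \<le> m" "m \<le> n" "P n = r * P m" "Q n = r * Q m" "d dvd r" for m n r d
    using reflected_level[OF lP[of m] _ Q, of r m d c] lP[of n] Q[of n] that refl'[OF that(1-3)] by auto
  have simp_iff: "simple g (d * Q m) (e * Q m) \<longleftrightarrow> simple g (d * P m) (e * P m)"
    if "M \<le> m" "m \<le> n" "P n = r * P m" "Q n = r * Q m" "d dvd r" "e dvd r" for m n r d e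
    using reflected_simple[OF lP[of m] _ Q, of r m d e c] lP[of n] Q[of n] that refl'[OF that(1-3)] by auto
  \<comment> \<open>Fundamentality is tested between the neighbours \<open>Q m\<close> and
    \<open>Q (Suc (Suc m))\<close>. The need for a lower neighbour costs the first index
    \<open>M\<close>.\<close>
  have fQ: "fundamental g (Q (Suc m))" if m: "M \<le> m" for m
  proof -
    obtain s where s: "P (Suc m) = s * P m" "Q (Suc m) = s * Q m" "0 < s" using rat[of m "Suc m"] m by auto
    obtain r where r: "P (Suc (Suc m)) = r * P m" "Q (Suc (Suc m)) = r * Q m" "0 < r"
      using rat[of m "Suc (Suc m)"] m by auto
    have ne: "P (Suc m) \<noteq> P m" "P (Suc (Suc m)) \<noteq> P (Suc m)" using injP by auto
    then have sr: "s \<noteq> 1" "s \<noteq> r" using s r by auto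
    have "P (Suc m) dvd P (Suc (Suc m))" using ord[of "Suc m" "Suc (Suc m)"] by simp
    then have "s dvd r" using s r P0[of m] by simp
    show ?thesis
    proof (rule fundamental_local[of g "Q m" "Q (Suc m)" "Q (Suc (Suc m))"])
      show "level g (Q m)" "level g (Q (Suc m))" "level g (Q (Suc (Suc m)))" using Q m by auto
      show "Q m dvd Q (Suc m)" "Q m \<noteq> Q (Suc m)" "Q (Suc m) dvd Q (Suc (Suc m))" "Q (Suc m) \<noteq> Q (Suc (Suc m))"
        using s r sr Q0[OF m] \<open>s dvd r\<close> by auto
      fix p p' assume p: "level g p" "level g p'" "Q m dvd p" "p dvd Q (Suc m)" "p \<noteq> Q (Suc m)"
        "Q (Suc m) dvd p'" "Q (Suc m) \<noteq> p'" "p' dvd Q (Suc (Suc m))"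
      have "Q m dvd p'" using p(6) s by (auto intro: dvd_mult_right)
      obtain d where d: "p = d * Q m" using p(3) by (auto simp: dvd_def mult.commute)
      obtain e where e: "p' = e * Q m" using \<open>Q m dvd p'\<close> by (auto simp: dvd_def mult.commute)
      have de: "d dvd s" "d \<noteq> s" "s dvd e" "s \<noteq> e" "e dvd r"
        using p d e s r Q0[OF m] by auto
      have "d dvd r" using de \<open>s dvd r\<close> dvd_trans by blast
      have "level g (d * P m)" "level g (e * P m)"
        using lev_iff[OF m _ r(1,2)] p d e de \<open>d dvd r\<close> by auto
      moreover have "d * P m dvd P (Suc m)" "d * P m \<noteq> P (Suc m)" "P (Suc m) dvd e * P m" "P (Suc m) \<noteq> e * P m"
        using de s P0[of m] by auto
      ultimately have "\<not> simple g (d * P m) (e * P m)"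
        using fP[of "Suc m"] unfolding fundamental_def by blast
      then show "\<not> simple g p p'"
        using simp_iff[OF m _ r(1,2) \<open>d dvd r\<close> de(5)] d e by simp
    qed
  qed
  define h where "h m = (SOME k. Q m = P k)" for m
  have h: "Q (Suc m) = P (h (Suc m))" if "M \<le> m" for m
    unfolding h_def using someI_ex[OF fP_ex[OF fQ[OF that]]] .
  \<comment> \<open>A skipped fundamental level \<open>P (Suc (h n)) = d * Q n\<close> would be
    reflected to a fundamental level \<open>d * P n\<close> strictly between the consecutive
    \<open>P n\<close> and \<open>P (Suc n)\<close>.\<close>
  have step: "h (Suc (Suc m)) = Suc (h (Suc m))" if m0: "M \<le> m" for m
  proof (rule ccontr)
    assume ne: "h (Suc (Suc m)) \<noteq> Suc (h (Suc m))"
    define n where "n = Suc m"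
    have n: "M \<le> n" using m0 n_def by simp
    have hn: "Q n = P (h n)" "Q (Suc n) = P (h (Suc n))" using h[of m] h[of n] m0 n n_def by auto
    obtain r where r: "P (Suc n) = r * P n" "Q (Suc n) = r * Q n" "0 < r" using rat[of n "Suc n"] n by auto
    have "r \<noteq> 1" using r injP[of "Suc n" n] by auto
    have "Q n dvd Q (Suc n)" "Q n \<noteq> Q (Suc n)"
      using r \<open>r \<noteq> 1\<close> Q0[OF n] by auto
    then have "h n < h (Suc n)" using ord[of "h n" "h (Suc n)"] hn by (metis le_neq_implies_less)
    then have k: "Suc (h n) < h (Suc n)" using ne n_def by simp
    have "P (h n) dvd P (Suc (h n))" using ord[of "h n" "Suc (h n)"] by simp
    then obtain d where d: "P (Suc (h n)) = d * Q n" using hn by (auto simp: dvd_def mult.commute)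
    have "P (Suc (h n)) dvd P (h (Suc n))" using ord[of "Suc (h n)" "h (Suc n)"] k by simp
    then have "d * Q n dvd r * Q n" unfolding d hn(2)[symmetric] r(2) .
    then have dr: "d dvd r" using Q0[OF n] by simp
    have d1: "d \<noteq> 1" using d hn(1) injP[of "Suc (h n)" "h n"] by auto
    have dner: "d \<noteq> r" using d hn(2) r(2) injP[of "Suc (h n)" "h (Suc n)"] k by auto
    have "fundamental g (d * P n)"
    proof (rule fundamental_local[of g "P n" "d * P n" "P (Suc n)"])
      have "level g (d * Q n)" using lP[of "Suc (h n)"] d by simp
      then show "level g (d * P n)" using lev_iff[OF n _ r(1,2) dr] by simp
      show "level g (P n)" "level g (P (Suc n))" by (rule lP)+
      show "P n dvd d * P n" "P n \<noteq> d * P n" "d * P n dvd P (Suc n)" "d * P n \<noteq> P (Suc n)"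
        using r d1 dner dr P0[of n] by auto
      fix p p' assume p: "level g p" "level g p'" "P n dvd p" "p dvd d * P n" "p \<noteq> d * P n"
        "d * P n dvd p'" "d * P n \<noteq> p'" "p' dvd P (Suc n)"
      have "P n dvd p'" using p(6) by (auto intro: dvd_mult_right)
      obtain a where a: "p = a * P n" using p(3) by (auto simp: dvd_def mult.commute)
      obtain e where e: "p' = e * P n" using \<open>P n dvd p'\<close> by (auto simp: dvd_def mult.commute)
      have ae: "a dvd d" "a \<noteq> d" "d dvd e" "d \<noteq> e" "e dvd r"
        using p a e r P0[of n] by auto
      have "a dvd r" using ae dr dvd_trans by blast
      have "level g (a * Q n)" "level g (e * Q n)"
        using lev_iff[OF n _ r(1,2)] p a e ae \<open>a dvd r\<close> by auto
      moreover have "a * Q n dvd d * Q n" "a * Q n \<noteq> d * Q n" "d * Q n dvd e * Q n" "d * Q n \<noteq> e * Q n"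
        using ae Q0[OF n] by auto
      ultimately have "\<not> simple g (a * Q n) (e * Q n)"
        using fP[of "Suc (h n)"] d unfolding fundamental_def by metis
      then show "\<not> simple g p p'"
        using simp_iff[OF n _ r(1,2) \<open>a dvd r\<close> ae(5)] a e by simp
    qed
    then obtain l where l: "d * P n = P l" using fP_ex by blast
    have "P n dvd P l" "P l dvd P (Suc n)" using l[symmetric] r dr by auto
    then have "n \<le> l" "l \<le> Suc n" using ord by auto
    then have "l = n \<or> l = Suc n" by auto
    then show False using l r d1 dner P0[of n] by auto
  qed
  define k0 where "k0 = Suc M"
  have hk: "h (k0 + j) = h k0 + j" for j
    by (induction j) (use step in \<open>simp_all add: k0_def\<close>)
  have Qk: "Q (k0 + j) = P (h k0 + j)" for j
    using h[of "M + j"] hk[of j] by (simp add: k0_def)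
  \<comment> \<open>Proper divisibility gives \<open>P n \<ge> 2 * P m\<close>, so the longer prefix
    has at least \<open>P m\<close> further zeros, each costing at least one letter.\<close>
  have lam: "int (zero_pos g (P n - 1)) - int (zero_pos g (P m - 1)) \<ge> int (P m)" if "m < n" for m n
  proof -
    have "P m dvd P n" "P m \<noteq> P n" using that ord[of m n] injP[of m n] by auto
    then obtain r where r: "P n = P m * r" by (auto simp: dvd_def)
    with \<open>P m \<noteq> P n\<close> P0[of n] have "2 \<le> r" by (cases r; cases "r - 1") auto
    then have "P m * 2 \<le> P n" unfolding r by (rule mult_le_mono2)
    then have "P m - 1 + P m \<le> P n - 1" using P0[of m] by linarith
    then have "zero_pos g (P m - 1) + P m \<le> zero_pos g (P n - 1)"
      using zero_pos_add_le[of g "P m - 1" "P m"] strict_mono_less_eq[OF strict_mono_zero_pos[of g], of "P m - 1 + P m" "P n - 1"]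
      by simp
    then show ?thesis by simp
  qed
  have "h k0 = k0"
  proof (rule ccontr)
    assume "h k0 \<noteq> k0"
    \<comment> \<open>Beyond the index \<open>\<bar>c\<bar>\<close>, a nonzero shift makes the two
      prefix lengths differ by more than \<open>\<bar>c\<bar>\<close>, although their difference is
      always \<open>c\<close>.\<close>
    define j where "j = nat \<bar>c\<bar> + k0 + 1"
    have cj: "c = int (zero_pos g (P (k0 + j) - 1)) - int (zero_pos g (P (h k0 + j) - 1))"
      using c[of "k0 + j"] Qk[of j] by (simp add: k0_def)
    have j: "\<bar>c\<bar> < int j" by (simp add: j_def)
    consider "k0 < h k0" | "h k0 < k0" using \<open>h k0 \<noteq> k0\<close> by linarith
    then show False
    proof cases
      case 1
      then have "int (P (k0 + j)) \<le> - c" using lam[of "k0 + j" "h k0 + j"] cj by linarith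
      then show False using j P_less[of "k0 + j"] by linarith
    next
      case 2
      then have "int (P (h k0 + j)) \<le> c" using lam[of "h k0 + j" "k0 + j"] cj by linarith
      then show False using j P_less[of "h k0 + j"] by linarith
    qed
  qed
  then have QP: "Q n = P n" if "k0 \<le> n" for n using Qk[of "n - k0"] that by simp
  have c0: "c = 0" using c[of k0] QP[of k0] by (simp add: k0_def)
  show ?thesis
  proof (intro exI[of _ k0] allI impI)
    fix n i assume "k0 \<le> n" "0 < i \<and> i * P n < P (Suc n)"
    then show "g (i * P n) = g (P (Suc n) - i * P n)"
      using refl[of n "Suc n" i] QP[of n] c0 by (simp add: k0_def)
  qed
qed

section \<open>Sliding block images occurring reversed\<close>

definition gap_word :: "(nat \<Rightarrow> nat) \<Rightarrow> nat \<Rightarrow> bool" where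
  "gap_word g n \<longleftrightarrow> n \<notin> range (zero_pos g)"

lemma zero_pos_less_iff [simp]: "zero_pos g m < zero_pos g n \<longleftrightarrow> m < n"
  by (rule strict_mono_less[OF strict_mono_zero_pos])

lemma zero_pos_le_iff [simp]: "zero_pos g m \<le> zero_pos g n \<longleftrightarrow> m \<le> n"
  by (rule strict_mono_less_eq[OF strict_mono_zero_pos])

lemma zero_pos_ge: "n \<le> zero_pos g n"
  using strict_mono_imp_increasing[OF strict_mono_zero_pos] .

lemma gap_word_zero_pos [simp]: "\<not> gap_word g (zero_pos g n)"
  by (simp add: gap_word_def)

lemma gap_word_between: "zero_pos g n < x \<Longrightarrow> x < zero_pos g (Suc n) \<Longrightarrow> gap_word g x"
  unfolding gap_word_def by (metis imageE less_Suc_eq_le not_le zero_pos_less_iff)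

lemma zero_pos_level_add:
  assumes "level g p" "t < p"
  shows "zero_pos g (i * p + t) = zero_pos g (i * p) + zero_pos g t"
  using assms(2)
proof (induction t)
  case (Suc t)
  have "g (Suc (i * p + t)) = g (Suc t)"
    using levelD[OF assms(1), of "Suc t" "Suc (i * p + t)"] Suc.prems nat_dvd_not_less[of "Suc t" p]
    by (simp flip: add_Suc_right)
  then show ?case using Suc by simp
qed simp

lemma zero_pos_next_block:
  "0 < p \<Longrightarrow> level g p \<Longrightarrow> zero_pos g (Suc i * p) = zero_pos g (i * p) + zero_pos g (p - 1) + 1 + g (Suc i * p)"
  using zero_pos_level_add[of g p "p - 1" i] zero_pos_Suc[of g "i * p + (p - 1)"]
  by (simp add: add.commute)

lemma gap_word_block:
  assumes p: "level g p" and j: "j \<le> zero_pos g (p - 1)"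
  shows "gap_word g (zero_pos g (i * p) + j) = gap_word g j"
proof -
  have p0: "0 < p" using level_pos[OF p] .
  have "(\<exists>w. zero_pos g (i * p) + j = zero_pos g w) \<longleftrightarrow> (\<exists>t. j = zero_pos g t)"
  proof
    assume "\<exists>t. j = zero_pos g t"
    then obtain t where t: "j = zero_pos g t" by blast
    then have "t < p" using j p0 by (auto simp: less_eq_Suc_le)
    then show "\<exists>w. zero_pos g (i * p) + j = zero_pos g w"
      using zero_pos_level_add[OF p] t by metis
  next
    assume "\<exists>w. zero_pos g (i * p) + j = zero_pos g w"
    then obtain w where w: "zero_pos g (i * p) + j = zero_pos g w" by blast
    have "zero_pos g (i * p) \<le> zero_pos g w" using w by linarith
    then have "i * p \<le> w" by simp
    moreover have "zero_pos g w \<le> zero_pos g (i * p + (p - 1))"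
      using zero_pos_level_add[OF p, of "p - 1" i] w j p0 by simp
    then have "w \<le> i * p + (p - 1)" by simp
    ultimately obtain t where "w = i * p + t" "t < p" using p0
      by (metis le_add_diff_inverse Suc_pred' add_le_cancel_left less_Suc_eq_le)
    then have "j = zero_pos g t" using w zero_pos_level_add[OF p] by simp
    then show "\<exists>t. j = zero_pos g t" by blast
  qed
  then show ?thesis by (auto simp: gap_word_def image_iff)
qed

lemma (in rank_one_gaps) not_constant_on_multiples:
  assumes "level g p"
  shows "\<exists>i. g (Suc (Suc i) * p) \<noteq> g (Suc i * p)"
proof -
  obtain t where t: "0 < t" "g (t + p) \<noteq> g t" using not_periodic level_pos[OF assms] by blast
  then have "p dvd t" using levelD[OF assms, of t "t + p"] by auto
  then obtain k where "t = k * p" by (auto simp: dvd_def mult.commute)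
  then have "t = Suc (k - 1) * p" using t by (cases k) auto
  then show ?thesis using t by (intro exI[of _ "k - 1"]) (simp add: add.commute)
qed

text \<open>The window of \<open>y n\<close> starts at \<open>n\<close> instead of being centred, so
  that no negative index occurs; the image of position \<open>n + R\<close> of \<open>V\<close> is
  therefore stored at \<open>n\<close>.\<close>

locale reversed_factor = rank_one_gaps +
  fixes y :: "nat \<Rightarrow> bool" and R :: nat
  assumes local_rule: "\<And>n n'. (\<And>j. j \<le> 2 * R \<Longrightarrow> gap_word g (n + j) = gap_word g (n' + j)) \<Longrightarrow> y n = y n'"
    and reversed_prefix: "\<And>m. \<exists>k. \<forall>j\<le>m. y j = gap_word g (k + m - j)"
    and infinite_zeros: "infinite {n. \<not> y n}"
begin

section \<open>Zeros and gaps of the image word\<close>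

definition zero :: "nat \<Rightarrow> nat" where
  "zero = Infinite_Set.enumerate {n. \<not> y n}"

text \<open>The gap after zero number \<open>t\<close> has index \<open>t\<close> here, but index
  \<open>Suc t\<close> in \<open>g\<close>. Ones of \<open>y\<close> before \<open>zero 0\<close>
  belong to no gap.\<close>

definition gap :: "nat \<Rightarrow> nat" where
  "gap t = zero (Suc t) - Suc (zero t)"

definition count_zeros :: "nat \<Rightarrow> nat" where
  "count_zeros n = card {m. m < n \<and> \<not> y m}"

lemma strict_mono_zero: "strict_mono zero"
  unfolding zero_def by (rule strict_mono_enumerate[OF infinite_zeros])

lemma range_zero: "range zero = {n. \<not> y n}"
  unfolding zero_def by (rule range_enumerate[OF infinite_zeros])

lemma y_zero [simp]: "\<not> y (zero t)"
  using range_zero by auto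

lemma Suc_gap: "zero (Suc t) = zero t + Suc (gap t)"
  using strict_monoD[OF strict_mono_zero, of t "Suc t"] by (simp add: gap_def)

lemma y_between: "zero t < n \<Longrightarrow> n < zero (Suc t) \<Longrightarrow> y n"
proof (rule ccontr)
  assume n: "zero t < n" "n < zero (Suc t)" "\<not> y n"
  then have "n \<in> range zero" by (simp add: range_zero)
  then obtain s where "n = zero s" by blast
  then show False using n strict_mono_less[OF strict_mono_zero] by auto
qed

lemma count_zeros_0 [simp]: "count_zeros 0 = 0"
  by (simp add: count_zeros_def)

lemma count_zeros_Suc: "count_zeros (Suc n) = count_zeros n + (if y n then 0 else 1)"
proof -
  have "{m. m < Suc n \<and> \<not> y m} = {m. m < n \<and> \<not> y m} \<union> (if y n then {} else {n})"
    by (auto simp: less_Suc_eq)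
  then show ?thesis by (auto simp: count_zeros_def)
qed

lemma count_zeros_mono: "m \<le> n \<Longrightarrow> count_zeros m \<le> count_zeros n"
  unfolding count_zeros_def by (intro card_mono) auto

lemma count_zeros_add_le: "count_zeros (n + k) \<le> count_zeros n + k"
  by (induction k) (auto simp: count_zeros_Suc)

lemma count_zeros_zero [simp]: "count_zeros (zero t) = t"
proof -
  have "{m. m < zero t \<and> \<not> y m} = zero ` {..<t}"
  proof (intro set_eqI iffI)
    fix m assume m: "m \<in> {m. m < zero t \<and> \<not> y m}"
    then have "m \<in> range zero" by (simp add: range_zero)
    then obtain s where "m = zero s" by blast
    then show "m \<in> zero ` {..<t}" using m strict_mono_less[OF strict_mono_zero, of s t] by simp
  next
    fix m assume "m \<in> zero ` {..<t}"
    then show "m \<in> {m. m < zero t \<and> \<not> y m}" using strict_mono_less[OF strict_mono_zero] by auto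
  qed
  moreover have "inj_on zero {..<t}" using strict_mono_imp_inj_on[OF strict_mono_zero] .
  ultimately show ?thesis by (simp add: count_zeros_def card_image)
qed

lemma zero_count_zeros: "\<not> y n \<Longrightarrow> zero (count_zeros n) = n"
proof -
  assume "\<not> y n"
  then have "n \<in> range zero" by (simp add: range_zero)
  then show "zero (count_zeros n) = n" by auto
qed

lemma count_zeros_shift:
  assumes "\<And>j. j < l \<Longrightarrow> y (s + j) = y j" and "n \<le> l"
  shows "count_zeros (s + n) = count_zeros s + count_zeros n"
  using assms(2) by (induction n) (auto simp: count_zeros_Suc assms(1))

lemma count_zeros_all_ones:
  assumes "\<And>j. j < l \<Longrightarrow> y (s + j)"
  shows "count_zeros (s + l) = count_zeros s"
  using assms by (induction l) (auto simp: count_zeros_Suc)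

text \<open>In a reversed occurrence of \<open>y\<close> up to \<open>zero n\<close>, that zero sits
  at some \<open>zero_pos g b\<close>, and walking right in \<open>V\<close> means walking left in
  \<open>y\<close>: \<open>zero (n - u)\<close> corresponds to \<open>zero_pos g (b + u)\<close>.
  Facts about windows of \<open>g\<close> thereby pass to \<open>gap\<close>, with indices running
  backwards.\<close>

lemma gap_reflection: "\<exists>b. \<forall>t u. t + u = n \<and> 0 < u \<longrightarrow> gap t = g (b + u)"
proof -
  obtain k where k: "\<And>j. j \<le> zero n \<Longrightarrow> y j = gap_word g (k + zero n - j)"
    using reversed_prefix[of "zero n"] by blast
  have "\<not> gap_word g k" using k[of "zero n"] by simp
  then obtain b where b: "k = zero_pos g b" by (auto simp: gap_word_def)
  have mono: "zero i \<le> zero j \<longleftrightarrow> i \<le> j" for i j using strict_mono_less_eq[OF strict_mono_zero] .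
  have pos: "zero_pos g (b + u) + zero (n - u) = k + zero n" if "u \<le> n" for u
    using that
  proof (induction u)
    case (Suc u)
    define t where "t = n - Suc u"
    have t: "n - u = Suc t" using Suc.prems by (simp add: t_def)
    have IH: "zero_pos g (b + u) + zero (Suc t) = k + zero n" using Suc t by simp
    have tn: "zero t < zero (Suc t)" "zero (Suc t) \<le> zero n"
      using strict_mono_less[OF strict_mono_zero] mono[of "Suc t" n] t by auto
    define q where "q = k + zero n - zero t"
    have "\<not> gap_word g q" using k[of "zero t"] tn by (simp add: q_def)
    then obtain w where w: "q = zero_pos g w" by (auto simp: gap_word_def)
    have "zero_pos g (b + u) < q" using IH tn by (simp add: q_def)
    then have "b + u < w" by (simp add: w)
    then have le: "zero_pos g (Suc (b + u)) \<le> q" unfolding w zero_pos_le_iff by simp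
    have "zero_pos g (Suc (b + u)) = q"
    proof (rule ccontr)
      assume "zero_pos g (Suc (b + u)) \<noteq> q"
      with le have less: "zero_pos g (Suc (b + u)) < q" by simp
      define j where "j = k + zero n - zero_pos g (Suc (b + u))"
      have gr: "zero_pos g (b + u) < zero_pos g (Suc (b + u))" by (subst zero_pos_less_iff) simp
      have "zero t < j" "j < zero (Suc t)" "zero_pos g (Suc (b + u)) = k + zero n - j"
        using less IH tn gr unfolding j_def q_def by linarith+
      then show False using y_between[of t j] k[of j] tn gap_word_zero_pos[of g "Suc (b + u)"] by auto
    qed
    then show ?case using tn by (simp add: q_def t_def)
  qed (simp add: b)
  show ?thesis
  proof (intro exI[of _ b] allI impI)
    fix t u assume tu: "t + u = n \<and> 0 < u"
    then obtain v where v: "u = Suc v" by (cases u) auto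
    have "zero_pos g (b + v) + zero (Suc t) = k + zero n" "zero_pos g (Suc (b + v)) + zero t = k + zero n"
      using pos[of v] pos[of u] tu v by (auto simp: Suc_diff_le)
    then show "gap t = g (b + u)" using Suc_gap[of t] v by simp
  qed
qed

lemma gap_recognizability:
  assumes p: "level g p"
  obtains T where "\<And>N N'. (\<And>s. s < T \<Longrightarrow> gap (N + s) = gap (N' + s)) \<Longrightarrow> N mod p = N' mod p"
proof -
  obtain T where T: "\<And>i i'. 0 < i \<Longrightarrow> 0 < i' \<Longrightarrow> (\<And>s. s < T \<Longrightarrow> g (i + s) = g (i' + s)) \<Longrightarrow> i mod p = i' mod p"
    using recognizability[OF p] by blast
  show thesis
  proof (rule that[of T])
    fix N N' assume w: "\<And>s. s < T \<Longrightarrow> gap (N + s) = gap (N' + s)"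
    obtain b where b: "\<And>t u. t + u = N + N' + T \<Longrightarrow> 0 < u \<Longrightarrow> gap t = g (b + u)"
      using gap_reflection[of "N + N' + T"] by blast
    have "(b + N + 1) mod p = (b + N' + 1) mod p"
    proof (rule T)
      fix s assume s: "s < T"
      \<comment> \<open>One reflection covers both windows: it exchanges the roles of
        \<open>N\<close> and \<open>N'\<close> and turns the offset \<open>s\<close> into
        \<open>T - 1 - s\<close>.\<close>
      have "gap (N + (T - 1 - s)) = g (b + (N' + 1 + s))" "gap (N' + (T - 1 - s)) = g (b + (N + 1 + s))"
        using s by (intro b; simp)+
      then show "g (b + N + 1 + s) = g (b + N' + 1 + s)"
        using w[of "T - 1 - s"] s by (simp add: algebra_simps)
    qed auto
    then show "N mod p = N' mod p" by (auto simp: nat_mod_eq_iff)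
  qed
qed

text \<open>Each reflected window has one exceptional class, but the class might depend on the
  window. If every \<open>e\<close> were refuted by a pair of indices, one window could contain the
  refuting pairs for all \<open>e < p\<close>, and its own class \<open>(b + n) mod p\<close> would
  give a contradiction.\<close>

lemma gap_hole:
  assumes p: "level g p"
  shows "\<exists>e. \<forall>i j. i mod p = j mod p \<and> i mod p \<noteq> e \<longrightarrow> gap i = gap j"
proof (rule ccontr)
  have p0: "0 < p" using level_pos[OF p] .
  assume "\<not> ?thesis"
  then have "\<forall>e. \<exists>i j. i mod p = j mod p \<and> i mod p \<noteq> e \<and> gap i \<noteq> gap j" by blast
  then obtain f1 f2 where f: "\<And>e. f1 e mod p = f2 e mod p" "\<And>e. f1 e mod p \<noteq> e" "\<And>e. gap (f1 e) \<noteq> gap (f2 e)"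
    by metis
  define n where "n = Suc (\<Sum>e<p. f1 e + f2 e)"
  obtain b where b: "\<And>t u. t + u = n \<Longrightarrow> 0 < u \<Longrightarrow> gap t = g (b + u)"
    using gap_reflection[of n] by blast
  define e where "e = (b + n) mod p"
  have "f1 e + f2 e \<le> (\<Sum>e<p. f1 e + f2 e)"
    using p0 by (intro member_le_sum) (auto simp: e_def)
  then have less: "f1 e < n" "f2 e < n" by (auto simp: n_def)
  have "g (b + (n - f1 e)) = g (b + (n - f2 e))"
  proof (rule levelD[OF p])
    show "(b + (n - f1 e)) mod p = (b + (n - f2 e)) mod p"
      using mod_reflect[of "f1 e" "b + n" "f2 e" p] f(1)[of e] less by simp
    show "\<not> p dvd b + (n - f1 e)"
    proof
      assume "p dvd b + (n - f1 e)"
      then have "(b + (n - f1 e) + f1 e) mod p = f1 e mod p" by (metis dvd_eq_mod_eq_0 mod_add_left_eq add_0)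
      then show False using f(2)[of e] less by (simp add: e_def)
    qed
  qed (use less in auto)
  then show False using b[of "f1 e" "n - f1 e"] b[of "f2 e" "n - f2 e"] f(3)[of e] less by simp
qed

text \<open>A long run of zeros is a run of gaps \<open>0\<close>, on which the windows at
  \<open>N\<close> and \<open>N + 1\<close> agree; recognizability modulo a level
  \<open>p > 1\<close> forbids this.\<close>

lemma bounded_zero_runs: "\<exists>A. \<forall>n. \<exists>j\<le>A. y (n + j)"
proof -
  obtain p where p: "level g p" "1 < p" using large_level by blast
  obtain T where T: "\<And>N N'. (\<And>s. s < T \<Longrightarrow> gap (N + s) = gap (N' + s)) \<Longrightarrow> N mod p = N' mod p"
    using gap_recognizability[OF p(1)] by blast
  show ?thesis
  proof (rule exI[of _ "T + 1"], rule allI, rule ccontr)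
    fix n assume "\<not> (\<exists>j\<le>T + 1. y (n + j))"
    then have run: "\<not> y (n + j)" if "j \<le> T + 1" for j using that by blast
    have cnt: "count_zeros (n + j) = count_zeros n + j" if "j \<le> T + 1" for j
      using that by (induction j) (auto simp: count_zeros_Suc run)
    have z: "zero (count_zeros n + j) = n + j" if "j \<le> T + 1" for j
      using zero_count_zeros[OF run[OF that]] cnt[OF that] by simp
    have gap0: "gap (count_zeros n + j) = 0" if "j \<le> T" for j
      using z[of j] z[of "Suc j"] that by (simp add: gap_def)
    have "count_zeros n mod p = (count_zeros n + 1) mod p"
    proof (rule T)
      fix s assume "s < T"
      then show "gap (count_zeros n + s) = gap (count_zeros n + 1 + s)"
        using gap0[of s] gap0[of "Suc s"] by simp
    qed
    then show False using p dvd_diff_if_mod_eq[of "count_zeros n" p "count_zeros n + 1"] by simp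
  qed
qed

text \<open>The bound is uniform in \<open>p\<close>. After the determined part of an image block
  come \<open>2 * R\<close> letters and as many letters as the spacer has. If the spacer is long,
  the middle of this piece is seen only through windows of ones, so \<open>y\<close> is constant
  there, and it is one because runs of zeros are bounded; only \<open>2 * R\<close> letters at
  either end can contribute.\<close>

lemma few_zeros_between_blocks:
  "\<exists>K. \<forall>p i. level g p \<and> 2 * R \<le> zero_pos g (p - 1) + 1 \<longrightarrow>
    count_zeros (zero_pos g (Suc i * p)) \<le>
      count_zeros (zero_pos g (i * p) + (zero_pos g (p - 1) + 1 - 2 * R)) + K"
proof -
  obtain A where A: "\<And>n. \<exists>j\<le>A. y (n + j)" using bounded_zero_runs by blast
  show ?thesis
  proof (rule exI[of _ "4 * R + A"], intro allI impI, elim conjE)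
    fix p i assume p: "level g p" and B: "2 * R \<le> zero_pos g (p - 1) + 1"
    define s where "s = zero_pos g (i * p) + (zero_pos g (p - 1) + 1 - 2 * R)"
    define a where "a = g (Suc i * p)"
    have next_pos: "zero_pos g (Suc i * p) = s + 2 * R + a"
      using zero_pos_next_block[of p g i] p level_pos[OF p] B by (simp add: s_def a_def)
    show "count_zeros (zero_pos g (Suc i * p)) \<le> count_zeros s + (4 * R + A)"
    proof (cases "a \<le> 2 * R + A")
      case True
      then show ?thesis using count_zeros_add_le[of s "2 * R + a"] next_pos by (simp add: add.assoc)
    next
      case False
      have pos: "zero_pos g (i * p + (p - 1)) = s + 2 * R - 1"
        using zero_pos_level_add[OF p, of "p - 1" i] B level_pos[OF p] by (simp add: s_def)
      have idx: "Suc (i * p + (p - 1)) = Suc i * p" using level_pos[OF p] by simp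
      have ones: "gap_word g (s + 2 * R + j)" if "j < a" for j
      proof (rule gap_word_between[of _ "i * p + (p - 1)"])
        have "1 \<le> s + 2 * R" using B by (simp add: s_def)
        then show "zero_pos g (i * p + (p - 1)) < s + 2 * R + j" using pos by simp
        show "s + 2 * R + j < zero_pos g (Suc (i * p + (p - 1)))" unfolding idx next_pos using that by simp
      qed
      have same: "y (s + 2 * R + j) = y (s + 2 * R + j')" if "j < a - 2 * R" "j' < a - 2 * R" for j j'
      proof (rule local_rule)
        fix l assume "l \<le> 2 * R"
        then show "gap_word g (s + 2 * R + j + l) = gap_word g (s + 2 * R + j' + l)"
          using ones[of "j + l"] ones[of "j' + l"] that by (simp add: add.assoc)
      qed
      obtain j where "j \<le> A" "y (s + 2 * R + j)" using A by blast
      then have all: "y (s + 2 * R + j')" if "j' < a - 2 * R" for j' using same[of j j'] that False by simp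
      have "count_zeros (s + 2 * R + (a - 2 * R)) = count_zeros (s + 2 * R)"
        by (rule count_zeros_all_ones) (rule all)
      moreover have "count_zeros (s + 2 * R) \<le> count_zeros s + 2 * R" by (rule count_zeros_add_le)
      moreover have "count_zeros (zero_pos g (Suc i * p)) \<le> count_zeros (s + 2 * R + (a - 2 * R)) + 2 * R"
      proof -
        have "s + 2 * R + (a - 2 * R) + 2 * R = s + 2 * R + a" using False by simp
        then show ?thesis using count_zeros_add_le[of "s + 2 * R + (a - 2 * R)" "2 * R"] next_pos by metis
      qed
      ultimately show ?thesis by simp
    qed
  qed
qed

end

section \<open>Alignment of image blocks with blocks of \<open>V\<close>, and reversal of the chain
  of levels\<close>

context reversed_factor
begin

lemma zero_add: "zero (N + n) = zero N + (\<Sum>t<n. Suc (gap (N + t)))"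
  by (induction n) (auto simp: Suc_gap)

text \<open>\<open>Q\<close> counts the zeros of \<open>y\<close> per block, and \<open>h\<close> is
  the hole, the only gap that may vary from block to block, located among the last
  \<open>K + 1\<close>. The last clause equates the lengths of corresponding blocks with their
  spacers, one letter being cancelled on both sides: the hole is the spacer of \<open>V\<close> plus
  a constant.\<close>

definition aligned :: "nat \<Rightarrow> nat \<Rightarrow> nat \<Rightarrow> nat \<Rightarrow> bool" where
  "aligned K p Q h \<longleftrightarrow> K + 1 < Q \<and> h < Q \<and> Q \<le> h + 1 + K \<and>
     (\<forall>i. count_zeros (zero_pos g (i * p)) = i * Q) \<and>
     (\<forall>i t. t < Q \<and> t \<noteq> h \<longrightarrow> gap (i * Q + t) = gap t) \<and>
     (\<forall>i. gap (i * Q + h) + (\<Sum>t\<in>{..<Q} - {h}. Suc (gap t)) = zero_pos g (p - 1) + g (Suc i * p))"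

lemma y_block:
  assumes p: "level g p" and j: "j + 2 * R \<le> zero_pos g (p - 1)"
  shows "y (zero_pos g (i * p) + j) = y j"
proof (rule local_rule)
  fix n assume "n \<le> 2 * R"
  then show "gap_word g (zero_pos g (i * p) + j + n) = gap_word g (j + n)"
    using gap_word_block[OF p, of "j + n" i] j by (simp add: add.assoc)
qed

lemma zero_block:
  assumes p: "level g p" and u: "t < count_zeros (zero_pos g (p - 1) + 1 - 2 * R)"
  shows "zero (count_zeros (zero_pos g (i * p)) + t) = zero_pos g (i * p) + zero t"
proof -
  define l where "l = zero_pos g (p - 1) + 1 - 2 * R"
  have tl: "zero t < l"
  proof (rule ccontr)
    assume "\<not> zero t < l"
    then have "count_zeros l \<le> t" using count_zeros_mono[of l "zero t"] by simp
    then show False using u by (simp add: l_def)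
  qed
  have y: "y (zero_pos g (i * p) + j) = y j" if "j < l" for j
    using y_block[OF p, of j i] that by (simp add: l_def)
  have "count_zeros (zero_pos g (i * p) + zero t) = count_zeros (zero_pos g (i * p)) + t"
    using count_zeros_shift[of l "zero_pos g (i * p)" "zero t"] y tl by simp
  moreover have "\<not> y (zero_pos g (i * p) + zero t)" using y[OF tl] by simp
  ultimately show ?thesis using zero_count_zeros by metis
qed

text \<open>The number of zeros of \<open>y\<close> before each block is divisible by a level \<open>q > K + 1\<close> by recognizability,
  while the number of zeros between two blocks varies by at most \<open>K\<close>; hence it is constant, and at most
  one of the gaps between two blocks lies in the exceptional class modulo \<open>q\<close>.\<close>

lemma ex_aligned:
  "\<exists>K L. \<forall>p. level g p \<and> L \<le> p \<longrightarrow> (\<exists>Q h. aligned K p Q h)"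
proof -
  obtain K where K: "\<And>p i. level g p \<Longrightarrow> 2 * R \<le> zero_pos g (p - 1) + 1 \<Longrightarrow>
    count_zeros (zero_pos g (Suc i * p)) \<le>
      count_zeros (zero_pos g (i * p) + (zero_pos g (p - 1) + 1 - 2 * R)) + K"
    using few_zeros_between_blocks by blast
  obtain q where q: "level g q" "K + 1 < q" using large_level by blast
  obtain T where T: "\<And>N N'. (\<And>s. s < T \<Longrightarrow> gap (N + s) = gap (N' + s)) \<Longrightarrow> N mod q = N' mod q"
    using gap_recognizability[OF q(1)] by blast
  obtain e where e: "\<And>i j. i mod q = j mod q \<Longrightarrow> i mod q \<noteq> e \<Longrightarrow> gap i = gap j"
    using gap_hole[OF q(1)] by blast
  \<comment> \<open>With at least \<open>L\<close> zeros in a block, the determined part of its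
    image contains \<open>T + 1\<close> zeros, enough for a recognizability window of
    \<open>T\<close> gaps.\<close>
  define L where "L = zero (T + 1) + 2 * R + 1"
  show ?thesis
  proof (rule exI[of _ K], rule exI[of _ L], intro allI impI, elim conjE)
    fix p assume p: "level g p" and L: "L \<le> p"
    define l where "l = zero_pos g (p - 1) + 1 - 2 * R"
    define u where "u = count_zeros l"
    define N where "N i = count_zeros (zero_pos g (i * p))" for i
    have p0: "0 < p" using level_pos[OF p] .
    have pl: "zero (T + 1) + 2 * R + 1 \<le> zero_pos g (p - 1) + 1"
      using L zero_pos_ge[of "p - 1" g] p0 by (simp add: L_def)
    then have B: "2 * R \<le> zero_pos g (p - 1) + 1" by simp
    have "zero (T + 1) \<le> l" using pl by (simp add: l_def)
    then have u: "T + 1 \<le> u" using count_zeros_mono[of "zero (T + 1)" l] by (simp add: u_def)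
    have zN: "zero (N i + t) = zero_pos g (i * p) + zero t" if "t < u" for i t
      using zero_block[OF p, of t i] that by (simp add: N_def u_def l_def)
    have gN: "gap (N i + t) = gap t" if "Suc t < u" for i t
      using zN[of t i] zN[of "Suc t" i] that by (simp add: gap_def)
    have qN: "N i mod q = 0" for i
    proof -
      have "N i mod q = 0 mod q" by (rule T) (use gN u in simp)
      then show ?thesis by simp
    qed
    have l_shift: "count_zeros (zero_pos g (i * p) + l) = N i + u" for i
      unfolding N_def u_def
    proof (rule count_zeros_shift[of l])
      show "y (zero_pos g (i * p) + j) = y j" if "j < l" for j
        using y_block[OF p, of j i] that by (simp add: l_def)
    qed simp
    have N_up: "N (Suc i) \<le> N i + u + K" for i
      using K[OF p B, of i] l_shift[of i] by (simp add: N_def l_def)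
    have N_lo: "N i + u \<le> N (Suc i)" for i
    proof -
      have "zero_pos g (i * p) + l \<le> zero_pos g (Suc i * p)"
        using zero_pos_next_block[of p g i] p p0 by (simp add: l_def)
      then show ?thesis using l_shift[of i] count_zeros_mono by (metis N_def)
    qed
    have N0: "N 0 = 0" by (simp add: N_def)
    define Q where "Q = N 1"
    have Q: "u \<le> Q" "Q \<le> u + K" using N_lo[of 0] N_up[of 0] N0 by (auto simp: Q_def)
    have qQ: "q dvd Q" using qN[of 1] by (auto simp: Q_def)
    have "q \<le> Q" using qQ Q u dvd_imp_le[of q Q] by simp
    have N_step: "N (Suc i) = N i + Q" for i
    proof -
      define D where "D = N (Suc i) - N i"
      have D: "N (Suc i) = N i + D" "u \<le> D" "D \<le> u + K" using N_lo[of i] N_up[of i] by (auto simp: D_def)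
      have "q dvd D" using qN[of i] qN[of "Suc i"] by (simp add: D_def dvd_eq_mod_eq_0[symmetric])
      have "D = Q"
      proof (rule ccontr)
        assume "D \<noteq> Q"
        then consider "D < Q" | "Q < D" by linarith
        then show False
        proof cases
          case 1
          then have "q \<le> Q - D" using \<open>q dvd D\<close> qQ by (intro dvd_imp_le) auto
          then show False using Q D q by simp
        next
          case 2
          then have "q \<le> D - Q" using \<open>q dvd D\<close> qQ by (intro dvd_imp_le) auto
          then show False using Q D q by simp
        qed
      qed
      then show ?thesis using D by simp
    qed
    have N: "N i = i * Q" for i by (induction i) (simp_all add: N0 N_step)
    have sum: "(\<Sum>t<Q. Suc (gap (i * Q + t))) = zero_pos g (p - 1) + 1 + g (Suc i * p)" for i
    proof -
      have "zero (i * Q + Q) = zero (i * Q) + (\<Sum>t<Q. Suc (gap (i * Q + t)))" by (rule zero_add)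
      moreover have "zero (i * Q) = zero_pos g (i * p) + zero 0" using zN[of 0 i] u N by simp
      moreover have "zero (i * Q + Q) = zero_pos g (Suc i * p) + zero 0"
        using zN[of 0 "Suc i"] u N by (simp add: add.commute)
      ultimately show ?thesis using zero_pos_next_block[OF p0 p, of i] by simp
    qed
    have non_hole: "gap (i * Q + t) = gap t" if "t mod q \<noteq> e \<or> Suc t < u" for i t
    proof (cases "Suc t < u")
      case True
      then show ?thesis using gN N by simp
    next
      case False
      then have "t mod q \<noteq> e" using that by simp
      moreover have "(i * Q + t) mod q = t mod q"
        using qQ mod_add_left_eq[of "i * Q" q t] by (simp add: dvd_imp_mod_0)
      ultimately show ?thesis using e[of t "i * Q + t"] by simp
    qed
    \<comment> \<open>Some gap of the undetermined end must be exceptional: otherwise all image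
      blocks would have the same length and the spacers \<open>g (Suc i * p)\<close> would be
      constant.\<close>
    have "\<exists>h. h < Q \<and> u \<le> Suc h \<and> h mod q = e"
    proof (rule ccontr)
      assume no: "\<not> ?thesis"
      have "gap (i * Q + t) = gap t" if "t < Q" for i t
        using no that non_hole[of t i] by (meson not_le)
      then have "(\<Sum>t<Q. Suc (gap (i * Q + t))) = (\<Sum>t<Q. Suc (gap t))" for i
        by (intro sum.cong) auto
      then have "g (Suc i * p) = g p" for i
        using sum[of i] sum[of 0] by simp
      then show False using not_constant_on_multiples[OF p] by metis
    qed
    then obtain h where h: "h < Q" "u \<le> Suc h" "h mod q = e" by blast
    have only: "gap (i * Q + t) = gap t" if t: "t < Q" "t \<noteq> h" for i t
    proof (rule non_hole, rule ccontr)
      assume "\<not> (t mod q \<noteq> e \<or> Suc t < u)"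
      then have te: "t mod q = h mod q" "u \<le> Suc t" using h by auto
      consider "t < h" | "h < t" using t by linarith
      then show False
      proof cases
        case 1
        then have "q \<le> h - t" using dvd_diff_if_mod_eq[OF te(1)] by (intro dvd_imp_le) auto
        then show False using q h te Q by simp
      next
        case 2
        then have "q \<le> t - h" using dvd_diff_if_mod_eq[OF te(1)[symmetric]] by (intro dvd_imp_le) auto
        then show False using q h te Q t by simp
      qed
    qed
    have val: "gap (i * Q + h) + (\<Sum>t\<in>{..<Q} - {h}. Suc (gap t)) = zero_pos g (p - 1) + g (Suc i * p)" for i
    proof -
      have "(\<Sum>t<Q. Suc (gap (i * Q + t))) =
        Suc (gap (i * Q + h)) + (\<Sum>t\<in>{..<Q} - {h}. Suc (gap (i * Q + t)))"
        using h by (intro sum.remove) auto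
      moreover have "(\<Sum>t\<in>{..<Q} - {h}. Suc (gap (i * Q + t))) = (\<Sum>t\<in>{..<Q} - {h}. Suc (gap t))"
        using only by (intro sum.cong) auto
      ultimately show ?thesis using sum[of i] by simp
    qed
    have "aligned K p Q h"
      unfolding aligned_def using \<open>q \<le> Q\<close> q h Q only val N[unfolded N_def] by simp
    then show "\<exists>Q h. aligned K p Q h" by blast
  qed
qed

lemma aligned_less: "aligned K p Q h \<Longrightarrow> 0 < Q \<and> h < Q"
  by (auto simp: aligned_def)

lemma aligned_gap_mod:
  assumes "aligned K p Q h" "x mod Q \<noteq> h"
  shows "gap x = gap (x mod Q)"
proof -
  have "gap (x div Q * Q + x mod Q) = gap (x mod Q)"
    using assms(1) assms(2) aligned_less[OF assms(1)] unfolding aligned_def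
    by (metis mod_less_divisor)
  then show ?thesis by simp
qed

text \<open>If \<open>h'\<close> were not congruent to \<open>h\<close>, the gaps at the larger
  holes would be constant, hence also the spacers of level \<open>r * p\<close>. As
  \<open>h'\<close> is among the last \<open>K + 1 < Q\<close> places, it is the hole of the last of
  the \<open>r\<close> small blocks; there both length equations involve the same gap and the same
  spacer \<open>g (r * p)\<close>, so their constants agree.\<close>

lemma aligned_chain:
  assumes a: "aligned K p Q h" and a': "aligned K (r * p) Q' h'" and p: "level g p" "level g (r * p)"
  shows "Q' = r * Q" and "h' = (r - 1) * Q + h"
    and "int (zero_pos g (r * p - 1)) - int (\<Sum>t\<in>{..<Q'} - {h'}. Suc (gap t)) =
      int (zero_pos g (p - 1)) - int (\<Sum>t\<in>{..<Q} - {h}. Suc (gap t))"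
proof -
  have "count_zeros (zero_pos g (1 * (r * p))) = 1 * Q'" using a' unfolding aligned_def by blast
  moreover have "count_zeros (zero_pos g (r * p)) = r * Q" using a unfolding aligned_def by blast
  ultimately show Q': "Q' = r * Q" by simp
  have r0: "0 < r" using level_pos[OF p(2)] by simp
  have h'h: "h' mod Q = h"
  proof (rule ccontr)
    assume n: "h' mod Q \<noteq> h"
    have "(i * Q' + h') mod Q = h' mod Q" for i by (simp add: Q' mult.assoc[symmetric])
    then have "gap (i * Q' + h') = gap (h' mod Q)" for i
      using aligned_gap_mod[OF a, of "i * Q' + h'"] n by simp
    moreover have "gap (i * Q' + h') + (\<Sum>t\<in>{..<Q'} - {h'}. Suc (gap t)) = zero_pos g (r * p - 1) + g (Suc i * (r * p))" for i
      using a' unfolding aligned_def by blast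
    ultimately have "gap (h' mod Q) + (\<Sum>t\<in>{..<Q'} - {h'}. Suc (gap t)) = zero_pos g (r * p - 1) + g (Suc i * (r * p))" for i
      by metis
    then have "g (Suc i * (r * p)) = g (Suc 0 * (r * p))" for i by (metis add_left_cancel)
    then show False using not_constant_on_multiples[OF p(2)] by metis
  qed
  define k where "k = h' div Q"
  have hk: "h' = k * Q + h" using h'h div_mult_mod_eq[of h' Q] by (simp add: k_def)
  have "h' < r * Q" "r * Q \<le> h' + 1 + K" "K + 1 < Q" "h < Q"
    using a a' Q' by (auto simp: aligned_def)
  moreover have "(k + 2) * Q = k * Q + 2 * Q" by (rule add_mult_distrib)
  ultimately have "k * Q < r * Q" "r * Q < (k + 2) * Q" using hk by linarith+
  then have "k < r" "r < k + 2" by (metis mult_less_cancel2)+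
  then have k: "k = r - 1" by simp
  then show h': "h' = (r - 1) * Q + h" using hk by simp
  have "gap (0 * Q' + h') + (\<Sum>t\<in>{..<Q'} - {h'}. Suc (gap t)) = zero_pos g (r * p - 1) + g (Suc 0 * (r * p))"
    using a' unfolding aligned_def by blast
  moreover have "gap ((r - 1) * Q + h) + (\<Sum>t\<in>{..<Q} - {h}. Suc (gap t)) = zero_pos g (p - 1) + g (Suc (r - 1) * p)"
    using a unfolding aligned_def by blast
  moreover have "0 * Q' + h' = (r - 1) * Q + h" "Suc 0 * (r * p) = r * p" "Suc (r - 1) * p = r * p"
    using h' r0 by simp_all
  ultimately have "gap h' + (\<Sum>t\<in>{..<Q'} - {h'}. Suc (gap t)) = zero_pos g (r * p - 1) + g (r * p)"
    "gap h' + (\<Sum>t\<in>{..<Q} - {h}. Suc (gap t)) = zero_pos g (p - 1) + g (r * p)"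
    using h' by metis+
  then show "int (zero_pos g (r * p - 1)) - int (\<Sum>t\<in>{..<Q'} - {h'}. Suc (gap t)) =
      int (zero_pos g (p - 1)) - int (\<Sum>t\<in>{..<Q} - {h}. Suc (gap t))"
    by linarith
qed


text \<open>The boundaries are moved from the block starts of \<open>y\<close> to the holes, and
  \<open>y\<close> is read backwards from a hole. This gives a gap sequence \<open>g'\<close> with
  levels \<open>Q m\<close> and the holes at the multiples of \<open>Q m\<close>. Its windows occur
  in \<open>g\<close>, so \<open>determined_by_windows\<close> identifies it with \<open>g\<close>.
  The constant \<open>c\<close> is the length of a block of \<open>V\<close> minus that of the image
  block cut at its hole.\<close>

lemma reversed_chain:
  fixes P :: "nat \<Rightarrow> nat"
  assumes P: "\<And>m. level g (P m)" "\<And>m n. m \<le> n \<Longrightarrow> P m dvd P n" "strict_mono P"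
  shows "\<exists>M Q c. \<forall>m\<ge>M. level g (Q m) \<and>
    c = int (zero_pos g (P m - 1)) - int (zero_pos g (Q m - 1)) \<and>
    (\<forall>n\<ge>m. Q n * P m = Q m * P n \<and>
      (\<forall>i. 0 < i \<and> i * P m < P n \<longrightarrow> int (g (i * Q m)) = int (g (P n - i * P m)) + c))"
proof -
  obtain K M where KM: "\<And>p. level g p \<Longrightarrow> M \<le> p \<Longrightarrow> \<exists>Q h. aligned K p Q h"
    using ex_aligned by blast
  have P_ge: "m \<le> P m" for m using strict_mono_imp_increasing[OF P(3)] .
  have "\<forall>m. \<exists>Q h. M \<le> m \<longrightarrow> aligned K (P m) Q h"
    using KM P(1) P_ge le_trans by meson
  then obtain Q h where al: "\<And>m. M \<le> m \<Longrightarrow> aligned K (P m) (Q m) (h m)" by metis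
  define S where "S m = (\<Sum>t\<in>{..<Q m} - {h m}. Suc (gap t))" for m
  define c where "c m = int (zero_pos g (P m - 1)) - int (S m)" for m
  have chain: "\<exists>r. 0 < r \<and> P n = r * P m \<and> Q n = r * Q m \<and> h n = (r - 1) * Q m + h m \<and> c n = c m"
    if mn: "M \<le> m" "m \<le> n" for m n
  proof -
    obtain r where r: "P n = r * P m" using P(2)[OF mn(2)] by (auto simp: dvd_def mult.commute)
    have a: "aligned K (r * P m) (Q n) (h n)" "level g (r * P m)" using al[of n] mn P(1)[of n] r by auto
    have "0 < r" using level_pos[OF a(2)] by simp
    then show ?thesis
      using aligned_chain[OF al[OF mn(1)] a(1) P(1) a(2)] r by (auto simp: c_def S_def)
  qed
  have Qh: "0 < Q m" "h m < Q m" if "M \<le> m" for m using aligned_less[OF al[OF that]] by auto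
  have Q_ge: "j < Q (M + j)" for j
  proof (induction j)
    case (Suc j)
    obtain r where r: "P (M + Suc j) = r * P (M + j)" "Q (M + Suc j) = r * Q (M + j)" "0 < r"
      using chain[of "M + j" "M + Suc j"] by auto
    have "r \<noteq> 1" using r strict_monoD[OF P(3), of "M + j" "M + Suc j"] by auto
    then have "2 * Q (M + j) \<le> r * Q (M + j)" using r by (intro mult_le_mono1) auto
    then show ?case using Suc r by linarith
  qed (use Qh in simp)
  \<comment> \<open>Index \<open>M + i\<close> merely provides some \<open>Q n > i\<close>
    (\<open>Q_ge\<close>); the value is the same for all larger \<open>n\<close>. Reading starts at
    the hole of the second block, so that \<open>h n + Q n - i\<close> does not underflow.\<close>
  define g' where "g' i = gap (h (M + i) + Q (M + i) - i)" for i
  have non_hole: "(h m + a * Q m - i) mod Q m \<noteq> h m"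
    if "M \<le> m" "i \<le> h m + a * Q m" "\<not> Q m dvd i" for m a i
  proof
    assume "(h m + a * Q m - i) mod Q m = h m"
    then have "(h m + a * Q m - i) mod Q m = (h m + a * Q m) mod Q m" using Qh[OF that(1)] by simp
    then have "Q m dvd (h m + a * Q m) - (h m + a * Q m - i)" by (rule dvd_diff_if_mod_eq) simp
    then show False using that by simp
  qed
  have hQ: "\<exists>a. h n + Q n = h m + a * Q m" if mn: "M \<le> m" "m \<le> n" for m n
  proof -
    obtain r where "Q n = r * Q m" "h n = (r - 1) * Q m + h m" using chain[OF mn] by blast
    then have "h n + Q n = h m + (r - 1 + r) * Q m" by (simp add: add_mult_distrib)
    then show ?thesis by blast
  qed
  have gap_eq: "gap (h n + Q n - i) = gap (h m + Q m - i)"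
    if mn: "M \<le> m" "m \<le> n" and i0: "0 < i" "i < Q m" for m n i
  proof -
    obtain a where a: "h n + Q n = h m + a * Q m" using hQ[OF mn] by blast
    have nd: "\<not> Q m dvd i" using i0 nat_dvd_not_less by blast
    obtain r where "Q n = r * Q m" "0 < r" using chain[OF mn] by blast
    then have "Q m \<le> Q n" by simp
    then have i: "i \<le> h m + a * Q m" using a i0 by simp
    have "a \<noteq> 0"
    proof
      assume "a = 0"
      then have "h n + Q n = h m" using a by simp
      then show False using \<open>Q m \<le> Q n\<close> Qh(2)[OF mn(1)] by linarith
    qed
    then have "h m + a * Q m - i = (h m + Q m - i) + (a - 1) * Q m"
      using i0 by (cases a) auto
    then have "(h m + a * Q m - i) mod Q m = (h m + Q m - i) mod Q m" by simp
    moreover have "gap (h m + a * Q m - i) = gap ((h m + a * Q m - i) mod Q m)"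
      by (rule aligned_gap_mod[OF al[OF mn(1)] non_hole[OF mn(1) i nd]])
    moreover have "(h m + 1 * Q m - i) mod Q m \<noteq> h m"
      by (rule non_hole[OF mn(1) _ nd]) (use i0 in simp)
    then have "gap (h m + Q m - i) = gap ((h m + Q m - i) mod Q m)"
      by (intro aligned_gap_mod[OF al[OF mn(1)]]) simp
    ultimately show ?thesis unfolding a by simp
  qed
  have g'_eq: "g' i = gap (h n + Q n - i)" if "M \<le> n" "0 < i" "i < Q n" for n i
  proof -
    define l where "l = max n (M + i)"
    have "g' i = gap (h l + Q l - i)"
      using gap_eq[of "M + i" l i] that Q_ge[of i] by (simp add: g'_def l_def)
    then show ?thesis using gap_eq[of n l i] that by (simp add: l_def)
  qed
  have lev': "level g' (Q m)" if m: "M \<le> m" for m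
  proof (rule levelI_add)
    show "0 < Q m" using Qh m by simp
    fix i assume i: "0 < i" "\<not> Q m dvd i"
    define n where "n = max m (M + (i + Q m))"
    obtain r where "Q n = r * Q (M + (i + Q m))" "0 < r" using chain[of "M + (i + Q m)" n] by (auto simp: n_def)
    then have "Q (M + (i + Q m)) \<le> Q n" by simp
    then have big: "i + Q m < Q n" using Q_ge[of "i + Q m"] by linarith
    have mn: "m \<le> n" "M \<le> n" using m by (auto simp: n_def)
    obtain a where a: "h n + Q n = h m + a * Q m" using hQ[OF m mn(1)] by blast
    have e: "g' (i + Q m) = gap (h m + a * Q m - (i + Q m))" "g' i = gap (h m + a * Q m - i)"
      using g'_eq[OF mn(2), of "i + Q m"] g'_eq[OF mn(2), of i] i big a by simp_all
    have le: "i + Q m \<le> h m + a * Q m" using a big by simp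
    have "h m + a * Q m - i = h m + a * Q m - (i + Q m) + Q m" using le by simp
    then have "(h m + a * Q m - i) mod Q m = (h m + a * Q m - (i + Q m)) mod Q m" by simp
    moreover have "gap (h m + a * Q m - i) = gap ((h m + a * Q m - i) mod Q m)"
      by (rule aligned_gap_mod[OF al[OF m] non_hole[OF m _ i(2)]]) (use le in simp)
    moreover have "gap (h m + a * Q m - (i + Q m)) = gap ((h m + a * Q m - (i + Q m)) mod Q m)"
      by (rule aligned_gap_mod[OF al[OF m] non_hole[OF m le]]) (use i in simp)
    ultimately show "g' (i + Q m) = g' i" using e by metis
  qed
  have refl: "int (g' (i * Q m)) = int (g (P n - i * P m)) + c m"
    if m: "M \<le> m" "m \<le> n" and i: "0 < i" "i * P m < P n" for m n i
  proof -
    obtain r where r: "0 < r" "P n = r * P m" "Q n = r * Q m" "h n = (r - 1) * Q m + h m"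
      using chain[OF m] by blast
    have ir: "i < r" using i r by simp
    \<comment> \<open>The place reached is the hole of block \<open>j\<close>, whose spacer is
      \<open>g (Suc j * P m)\<close> with \<open>Suc j = r + (r - i)\<close>; the summand
      \<open>r\<close> disappears modulo the level \<open>P n = r * P m\<close>.\<close>
    define j where "j = (r - 1) + (r - i)"
    have "r = i + (r - i)" using ir by simp
    then have "Q n = i * Q m + (r - i) * Q m" unfolding r(3) by (metis add_mult_distrib)
    moreover have "j * Q m = (r - 1) * Q m + (r - i) * Q m" unfolding j_def by (rule add_mult_distrib)
    ultimately have "h n + Q n - i * Q m = j * Q m + h m"
      using r(4) by simp
    moreover have "g' (i * Q m) = gap (h n + Q n - i * Q m)"
      using g'_eq[of n "i * Q m"] m i ir r Qh[OF m(1)] by simp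
    moreover have "gap (j * Q m + h m) + S m = zero_pos g (P m - 1) + g (Suc j * P m)"
      using al[OF m(1)] unfolding aligned_def S_def by blast
    moreover have "g (Suc j * P m) = g (P n - i * P m)"
    proof -
      have "Suc j = r + (r - i)" using r(1) by (simp add: j_def)
      then have "Suc j * P m = (P n - i * P m) + P n"
        using r by (simp add: add_mult_distrib diff_mult_distrib)
      moreover have "\<not> P n dvd P n - i * P m"
        using i level_pos[OF P(1)[of m]] by (intro nat_dvd_not_less) auto
      moreover have "(P n - i * P m) mod P n = (P n - i * P m + P n) mod P n" by (rule mod_add_self2[symmetric])
      ultimately show ?thesis
        using levelD[OF P(1)[of n], of "P n - i * P m" "Suc j * P m"] i by (metis add_gr_0 zero_less_diff)
    qed
    ultimately show ?thesis by (simp add: c_def)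
  qed
  have non_per: "\<exists>t>0. g' (t + Q m) \<noteq> g' t" if m: "M \<le> m" for m
  proof -
    obtain i where i: "g (Suc (Suc i) * P m) \<noteq> g (Suc i * P m)"
      using not_constant_on_multiples[OF P(1)] by blast
    \<comment> \<open>This forces \<open>i + 3 \<le> r\<close>, so that both spacers lie strictly
      inside one block of level \<open>P n\<close>, where \<open>refl\<close> applies.\<close>
    define n where "n = m + (i + 3) * P m"
    have mn: "m \<le> n" by (simp add: n_def)
    obtain r where r: "P n = r * P m" using chain[OF m mn] by blast
    have "(i + 3) * P m \<le> n" by (simp add: n_def)
    then have "(i + 3) * P m \<le> r * P m" using P_ge[of n] r by linarith
    then have ir: "i + 3 \<le> r" using level_pos[OF P(1)[of m]] mult_le_cancel2 by blast
    define k where "k = r - Suc (Suc i)"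
    have k: "0 < k" "r = k + Suc (Suc i)" "Suc k = r - Suc i" using ir by (auto simp: k_def)
    have Pm: "0 < P m" by (rule level_pos[OF P(1)])
    have Pn: "P n = k * P m + Suc (Suc i) * P m" "P n = Suc k * P m + Suc i * P m"
      unfolding r k(2) by (simp_all add: add_mult_distrib)
    have "k * P m < P n" unfolding Pn(1) using Pm by simp
    then have "int (g' (k * Q m)) = int (g (P n - k * P m)) + c m" by (rule refl[OF m mn k(1)])
    moreover have "P n - k * P m = Suc (Suc i) * P m" unfolding Pn(1) by simp
    moreover have "Suc k * P m < P n" unfolding Pn(2) using Pm by simp
    then have "int (g' (Suc k * Q m)) = int (g (P n - Suc k * P m)) + c m" by (intro refl[OF m mn]) simp
    moreover have "P n - Suc k * P m = Suc i * P m" unfolding Pn(2) by simp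
    ultimately have "g' (k * Q m + Q m) \<noteq> g' (k * Q m)" using i by (simp add: add.commute)
    then show ?thesis using k Qh[OF m] by (intro exI[of _ "k * Q m"]) simp
  qed
  have eq: "g' i = g i" if "0 < i" for i
  proof (rule determined_by_windows[OF _ _ that])
    fix n
    define N where "N = h (M + n) + Q (M + n)"
    obtain b where b: "\<And>t u. t + u = N \<Longrightarrow> 0 < u \<Longrightarrow> gap t = g (b + u)"
      using gap_reflection[of N] by blast
    show "\<exists>b. \<forall>i. 0 < i \<and> i \<le> n \<longrightarrow> g' i = g (b + i)"
    proof (intro exI[of _ b] allI impI)
      fix i assume i: "0 < i \<and> i \<le> n"
      then have "g' i = gap (N - i)" using g'_eq[of "M + n" i] Q_ge[of n] by (simp add: N_def)
      then show "g' i = g (b + i)" using b[of "N - i" i] i Q_ge[of n] by (simp add: N_def)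
    qed
    show "\<exists>Q>n. level g' Q \<and> (\<exists>t>0. g' (t + Q) \<noteq> g' t)"
      using Q_ge[of n] lev'[of "M + n"] non_per[of "M + n"] by auto
  qed
  have lev: "level g (Q m)" if "M \<le> m" for m
    using lev'[OF that] unfolding level_def by (metis eq)
  have S: "S m = zero_pos g (Q m - 1)" if m: "M \<le> m" for m
  proof -
    \<comment> \<open>Reflection about the hole, wrapped around one block. It is its own inverse
      between the indices from \<open>1\<close> to \<open>Q m - 1\<close> and the places other than
      \<open>h m\<close>.\<close>
    define f where "f i = (if i \<le> h m then h m - i else h m + Q m - i)" for i
    have hm: "h m < Q m" using Qh[OF m] by simp
    have gf: "g i = gap (f i)" if i: "0 < i" "i < Q m" for i
    proof (cases "i \<le> h m")
      case True
      have "\<not> Q m dvd i" using i nat_dvd_not_less by blast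
      then have "(h m + 1 * Q m - i) mod Q m \<noteq> h m"
        by (intro non_hole[OF m]) (use i in simp_all)
      then have "gap (h m + Q m - i) = gap ((h m + Q m - i) mod Q m)"
        by (intro aligned_gap_mod[OF al[OF m]]) simp
      moreover have "h m + Q m - i = (h m - i) + Q m" using True by simp
      then have "(h m + Q m - i) mod Q m = h m - i"
        using hm by (metis mod_add_self2 mod_less less_imp_diff_less)
      ultimately show ?thesis using eq[OF i(1)] g'_eq[OF m i] True by (simp add: f_def)
    qed (use eq[OF i(1)] g'_eq[OF m i] in \<open>simp add: f_def\<close>)
    have "S m = (\<Sum>i\<in>{1..Q m - 1}. Suc (g i))"
      unfolding S_def
      by (rule sum.reindex_bij_witness[of _ f f]) (use hm gf in \<open>auto simp: f_def\<close>)
    then show ?thesis by (simp add: zero_pos_def)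
  qed
  have cM: "c m = c M" if "M \<le> m" for m using chain[of M m] that by auto
  show ?thesis
  proof (rule exI[of _ M], rule exI[of _ Q], rule exI[of _ "c M"], intro allI impI conjI)
    fix m n assume mn: "M \<le> m" "m \<le> n"
    show "Q n * P m = Q m * P n" using chain[OF mn] by auto
    fix i assume i: "0 < i \<and> i * P m < P n"
    then have "0 < i * Q m" using Qh[OF mn(1)] by simp
    then show "int (g (i * Q m)) = int (g (P n - i * P m)) + c M"
      using refl[OF mn, of i] cM[OF mn(1)] eq[of "i * Q m"] i by simp
  next
    fix m assume m: "M \<le> m"
    show "level g (Q m)" by (rule lev[OF m])
    show "c M = int (zero_pos g (P m - 1)) - int (zero_pos g (Q m - 1))"
      using cM[OF m] S[OF m] c_def[of m] by linarith
  qed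
qed

end

section \<open>Words and their gap sequences\<close>

fun word_of_gaps :: "nat list \<Rightarrow> fword" where
  "word_of_gaps [] = [False]"
| "word_of_gaps (n # ns) = False # ones n @ word_of_gaps ns"

lemma word_of_gaps_append: "word_of_gaps (xs @ n # ys) = word_of_gaps xs @ ones n @ word_of_gaps ys"
  by (induction xs) auto

lemma word_of_gaps_neq_Nil [simp]: "word_of_gaps xs \<noteq> []"
  by (cases xs) auto

lemma word_of_gaps_Cons_False: "\<exists>w. word_of_gaps xs = False # w"
  by (cases xs) auto

lemma ones_shift_False_eq_iff: "ones m @- False ## s = ones n @- False ## t \<Longrightarrow> m = n \<and> s = t"
proof (induction m arbitrary: n)
  case 0
  then show ?case by (cases n) (auto simp: ones_def)
next
  case (Suc m)
  then show ?case by (cases n) (auto simp: ones_def)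
qed

lemma word_of_gaps_shift_eq:
  "word_of_gaps xs @- s = word_of_gaps ys @- t \<Longrightarrow> length xs = length ys \<Longrightarrow> xs = ys"
proof (induction xs arbitrary: ys)
  case (Cons x xs)
  then obtain y zs where ys: "ys = y # zs" by (cases ys) auto
  obtain w w' where w: "word_of_gaps xs = False # w" "word_of_gaps zs = False # w'"
    using word_of_gaps_Cons_False by metis
  have "ones x @- False ## (w @- s) = ones y @- False ## (w' @- t)"
    using Cons.prems by (simp add: ys w)
  then have "x = y" "w @- s = w' @- t" by (auto dest: ones_shift_False_eq_iff)
  then have "word_of_gaps xs @- s = word_of_gaps zs @- t" by (simp add: w)
  then show ?case using Cons ys \<open>x = y\<close> by auto
qed simp

text \<open>Padding with ones turns words into streams, where \<open>word_of_gaps_shift_eq\<close>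
  cancels a common number of gaps; a surplus gap would leave a zero in the tail of ones.\<close>

lemma word_of_gaps_shift_longer:
  assumes "word_of_gaps xs @- sconst True = word_of_gaps ys @- sconst True"
  shows "length xs = length ys"
proof -
  have neq: "word_of_gaps xs @- sconst True \<noteq> word_of_gaps (xs @ n # ys) @- sconst True" for xs n ys
  proof
    assume "word_of_gaps xs @- sconst True = word_of_gaps (xs @ n # ys) @- sconst True"
    then have e: "sconst True = ones n @- word_of_gaps ys @- sconst True"
      by (simp add: word_of_gaps_append)
    obtain w where "word_of_gaps ys = False # w" using word_of_gaps_Cons_False by blast
    then have "False \<in> sset (sconst True)" by (subst e) simp
    then show False by simp
  qed
  show ?thesis
  proof (rule ccontr)
    assume "length xs \<noteq> length ys"
    moreover have False if l: "length xs < length ys" and e: "word_of_gaps xs @- sconst True = word_of_gaps ys @- sconst True"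
      for xs ys
    proof -
      have split: "ys = take (length xs) ys @ ys ! length xs # drop (Suc (length xs)) ys"
        using l by (simp add: Cons_nth_drop_Suc)
      then have "word_of_gaps ys = word_of_gaps (take (length xs) ys) @ ones (ys ! length xs) @
          word_of_gaps (drop (Suc (length xs)) ys)" by (metis word_of_gaps_append)
      then have "word_of_gaps xs @- sconst True = word_of_gaps (take (length xs) ys) @-
         (ones (ys ! length xs) @- word_of_gaps (drop (Suc (length xs)) ys) @- sconst True)"
        using e by simp
      then have "xs = take (length xs) ys" by (rule word_of_gaps_shift_eq) (use l in simp)
      then show False using neq[of xs "ys ! length xs" "drop (Suc (length xs)) ys"] e split by metis
    qed
    ultimately show False using assms by (metis nat_neq_iff)
  qed
qed

lemma word_of_gaps_eq_iff [simp]: "word_of_gaps xs = word_of_gaps ys \<longleftrightarrow> xs = ys"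
  using word_of_gaps_shift_eq word_of_gaps_shift_longer by metis

lemma word_of_gaps_in_F: "word_of_gaps xs \<in> words_F"
proof -
  have "last (word_of_gaps xs) = False" by (induction xs) auto
  moreover have "hd (word_of_gaps xs) = False" by (cases xs) auto
  ultimately show ?thesis by (simp add: words_F_def)
qed

lemma words_F_eq: "words_F = range word_of_gaps"
proof
  show "range word_of_gaps \<subseteq> words_F" using word_of_gaps_in_F by blast
  have "\<exists>xs. w = word_of_gaps xs" if "w \<in> words_F" for w
    using that
  proof (induction "length w" arbitrary: w rule: less_induct)
    case less
    obtain u where w: "w = False # u" using less.prems by (cases w) (auto simp: words_F_def)
    show ?case
    proof (cases "u = []")
      case True
      then show ?thesis using w by (intro exI[of _ "[]"]) simp
    next
      case False
      define n where "n = length (takeWhile id u)"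
      define v where "v = dropWhile id u"
      have t: "takeWhile id u = ones n"
        unfolding n_def ones_def by (rule replicate_eqI) (auto dest: set_takeWhileD)
      have u: "u = ones n @ v" using takeWhile_dropWhile_id[of id u] by (simp add: t v_def)
      have lu: "last u = False" using less.prems False w by (simp add: words_F_def)
      have "v \<noteq> []"
      proof
        assume "v = []"
        then have "\<forall>x\<in>set u. x" by (simp add: v_def)
        then show False using lu False last_in_set by blast
      qed
      then have "hd v = False" using hd_dropWhile[of id u] by (simp add: v_def)
      moreover have "last u = last v" using \<open>v \<noteq> []\<close> by (subst u) simp
      ultimately have "v \<in> words_F" using lu \<open>v \<noteq> []\<close> by (simp add: words_F_def)
      moreover have "length v \<le> length u" unfolding v_def by (rule length_dropWhile_le)
      then have "length v < length w" by (simp add: w)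
      ultimately obtain ys where "v = word_of_gaps ys" using less.hyps by blast
      then have "w = word_of_gaps (n # ys)" using u by (simp add: w)
      then show ?thesis by blast
    qed
  qed
  then show "words_F \<subseteq> range word_of_gaps" by blast
qed

lemma spaced_word_Suc:
  "0 < r \<Longrightarrow> spaced_word v (Suc r) a = spaced_word v r a @ ones (a r) @ v"
  by (simp add: spaced_word_def)

lemma spaced_word_1 [simp]: "spaced_word v (Suc 0) a = v"
  by (simp add: spaced_word_def)

text \<open>This translates being built from a word into periodicity of gaps off the multiples of
  \<open>P\<close>. The \<open>- 1\<close> is due to list positions starting at
  \<open>0\<close>.\<close>

lemma spaced_word_of_gaps:
  assumes "0 < r" and P: "P = Suc (length xs)"
  shows "spaced_word (word_of_gaps xs) r a =
    word_of_gaps (map (\<lambda>t. if P dvd t then a (t div P) else xs ! (t mod P - 1)) [1..<r * P])"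
    (is "_ = word_of_gaps (map ?f _)")
  using assms(1)
proof (induction r rule: nat_induct_non_zero)
  case 1
  have "xs = map ?f [1..<P]"
  proof (rule nth_equalityI)
    fix i assume i: "i < length xs"
    then have "[1..<P] ! i = Suc i" "Suc i mod P = Suc i" "\<not> P dvd Suc i"
      using P nat_dvd_not_less[of "Suc i" P] by (simp_all del: upt_Suc)
    then show "xs ! i = map ?f [1..<P] ! i" using i P by (simp del: upt_Suc)
  qed (simp add: P del: upt_Suc)
  then show ?case by simp
next
  case (Suc r)
  have "1 \<le> r * P" using Suc.hyps P by simp
  moreover have "Suc r * P = r * P + P" by simp
  ultimately have "[1..<Suc r * P] = [1..<r * P] @ [r * P..<r * P + P]"
    by (metis upt_add_eq_append)
  also have "[r * P..<r * P + P] = r * P # [Suc (r * P)..<r * P + P]"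
    using P by (subst upt_conv_Cons) auto
  finally have split: "[1..<Suc r * P] = [1..<r * P] @ r * P # [Suc (r * P)..<r * P + P]" .
  have "xs = map ?f [Suc (r * P)..<r * P + P]"
  proof (rule nth_equalityI)
    show len: "length xs = length (map ?f [Suc (r * P)..<r * P + P])"
      unfolding length_map length_upt P by simp
    fix i assume i: "i < length xs"
    then have i': "Suc i < P" by (simp add: P)
    have e: "[Suc (r * P)..<r * P + P] ! i = r * P + Suc i"
      using i' by (subst nth_upt) auto
    have "(r * P + Suc i) mod P = Suc i" using i' by simp
    moreover then have "\<not> P dvd r * P + Suc i" by (simp add: dvd_eq_mod_eq_0)
    ultimately have "?f (r * P + Suc i) = xs ! i" by simp
    then show "xs ! i = map ?f [Suc (r * P)..<r * P + P] ! i"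
      using e i len by (simp only: nth_map length_map)
  qed
  moreover have "0 < P" by (simp add: P)
  then have "?f (r * P) = a r" by simp
  ultimately have "word_of_gaps (map ?f [1..<Suc r * P]) =
      word_of_gaps (map ?f [1..<r * P]) @ ones (a r) @ word_of_gaps xs"
    unfolding split by (simp add: word_of_gaps_append del: upt_Suc)
  then show ?case using Suc spaced_word_Suc by simp
qed

section \<open>Prefixes of the infinite word and the building relations between them\<close>

definition prefix_word :: "(nat \<Rightarrow> nat) \<Rightarrow> nat \<Rightarrow> fword" where
  "prefix_word g P = word_of_gaps (map g [1..<P])"

text \<open>The number of blocks and the spacers can be read off the gap list, so the existential
  quantifiers over \<open>r\<close> and \<open>a\<close> in the building relations have at most one
  solution on \<open>0 < i < r\<close>. All three relations thus become conditions on
  \<open>g\<close> at multiples of \<open>P\<close>.\<close>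

lemma spaced_prefix_word_eq_iff:
  assumes P: "level g P" and "0 < r" "0 < Q"
  shows "prefix_word g Q = spaced_word (prefix_word g P) r a \<longleftrightarrow>
    Q = r * P \<and> (\<forall>i. 0 < i \<and> i < r \<longrightarrow> a i = g (i * P))"
proof -
  have P0: "0 < P" using level_pos[OF P] .
  let ?f = "\<lambda>t. if P dvd t then a (t div P) else map g [1..<P] ! (t mod P - 1)"
  have "prefix_word g Q = spaced_word (prefix_word g P) r a \<longleftrightarrow> map g [1..<Q] = map ?f [1..<r * P]"
    unfolding prefix_word_def using P0 by (subst spaced_word_of_gaps[OF assms(2)]) auto
  also have "\<dots> \<longleftrightarrow> Q = r * P \<and> (\<forall>t. 0 < t \<and> t < r * P \<longrightarrow> g t = ?f t)"
  proof
    assume e: "map g [1..<Q] = map ?f [1..<r * P]"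
    then have "length (map g [1..<Q]) = length (map ?f [1..<r * P])" by simp
    then have "Q - 1 = r * P - 1" by simp
    moreover have "0 < r * P" using assms(2) P0 by simp
    ultimately have Q: "Q = r * P" using assms(3) by linarith
    then show "Q = r * P \<and> (\<forall>t. 0 < t \<and> t < r * P \<longrightarrow> g t = ?f t)" using e by auto
  qed auto
  also have "\<dots> \<longleftrightarrow> Q = r * P \<and> (\<forall>i. 0 < i \<and> i < r \<longrightarrow> a i = g (i * P))"
  proof -
    have non: "g t = map g [1..<P] ! (t mod P - 1)" if "0 < t" "\<not> P dvd t" for t
    proof -
      have "0 < t mod P" "t mod P < P" using that P0 by (auto simp: mod_greater_zero_iff_not_dvd)
      then show ?thesis using levelD[OF P, of t "t mod P"] that by simp
    qed
    have "(\<forall>t. 0 < t \<and> t < r * P \<longrightarrow> g t = ?f t) \<longleftrightarrow> (\<forall>i. 0 < i \<and> i < r \<longrightarrow> a i = g (i * P))"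
    proof (intro iffI allI impI)
      fix i assume *: "\<forall>t. 0 < t \<and> t < r * P \<longrightarrow> g t = ?f t" and "0 < i \<and> i < r"
      then show "a i = g (i * P)" using *[rule_format, of "i * P"] P0 by simp
    next
      fix t assume *: "\<forall>i. 0 < i \<and> i < r \<longrightarrow> a i = g (i * P)" and t: "0 < t \<and> t < r * P"
      show "g t = ?f t"
      proof (cases "P dvd t")
        case True
        then obtain i where "t = i * P" by (auto simp: dvd_def mult.commute)
        then show ?thesis using * t P0 by auto
      qed (use non t in simp)
    qed
    then show ?thesis by blast
  qed
  finally show ?thesis .
qed

lemma prefix_word_eq_iff: "0 < P \<Longrightarrow> 0 < Q \<Longrightarrow> prefix_word g P = prefix_word g Q \<longleftrightarrow> P = Q"
  by (auto simp: prefix_word_def dest!: arg_cong[where f = length])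

lemma built_from_prefix_word:
  assumes P: "level g P" and Q: "level g Q"
  shows "prefix_word g P \<preceq> prefix_word g Q \<longleftrightarrow> P dvd Q"
proof
  assume "prefix_word g P \<preceq> prefix_word g Q"
  then obtain r a where "1 \<le> r" "prefix_word g Q = spaced_word (prefix_word g P) r a"
    unfolding built_from_def by blast
  then have "Q = r * P" using spaced_prefix_word_eq_iff[OF P _ level_pos[OF Q], of r a] by simp
  then show "P dvd Q" by simp
next
  assume "P dvd Q"
  then obtain r where r: "Q = r * P" by (auto simp: dvd_def mult.commute)
  then have "0 < r" using level_pos[OF Q] by simp
  then show "prefix_word g P \<preceq> prefix_word g Q"
    using spaced_prefix_word_eq_iff[OF P _ level_pos[OF Q], of r "\<lambda>i. g (i * P)"] r
    unfolding built_from_def by (metis One_nat_def Suc_leI)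
qed

lemma simply_built_from_prefix_word:
  assumes P: "level g P" and Q: "level g Q"
  shows "prefix_word g P \<preceq>\<^sub>s prefix_word g Q \<longleftrightarrow> P dvd Q \<and> simple g P Q"
proof -
  have *: "simple g P (r * P) \<longleftrightarrow> (\<forall>i j. 0 < i \<and> i < r \<and> 0 < j \<and> j < r \<longrightarrow> g (i * P) = g (j * P))"
    if "level g (r * P)" for r
    using scaled_simple_iff[OF P that, of 1 r] nat_dvd_not_less[of _ r]
    by (metis (no_types, lifting) dvd_refl mult_1 one_dvd)
  show ?thesis
  proof
    assume "prefix_word g P \<preceq>\<^sub>s prefix_word g Q"
    then obtain r a where r: "r \<ge> 1" "prefix_word g Q = spaced_word (prefix_word g P) r a"
      and a: "\<And>i j. 0 < i \<and> i < r \<and> 0 < j \<and> j < r \<Longrightarrow> a i = a j"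
      unfolding simply_built_from_def by blast
    have "Q = r * P \<and> (\<forall>i. 0 < i \<and> i < r \<longrightarrow> a i = g (i * P))"
    by (rule iffD1[OF spaced_prefix_word_eq_iff[OF P _ level_pos[OF Q]] r(2)]) (use r(1) in simp)
  then have Qr: "Q = r * P" and ag: "\<And>i. 0 < i \<Longrightarrow> i < r \<Longrightarrow> a i = g (i * P)"
      by blast+
    have "simple g P (r * P)" unfolding *[OF Q[unfolded Qr]] using a ag by metis
    then show "P dvd Q \<and> simple g P Q" using Qr by simp
  next
    assume "P dvd Q \<and> simple g P Q"
    then obtain r where r: "Q = r * P" and s: "simple g P (r * P)" by (auto simp: dvd_def mult.commute)
    then have r0: "0 < r" using level_pos[OF Q] by simp
    have "prefix_word g Q = spaced_word (prefix_word g P) r (\<lambda>i. g (i * P))"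
      using spaced_prefix_word_eq_iff[OF P r0 level_pos[OF Q]] r by simp
    moreover have "\<forall>i j. 0 < i \<and> i < r \<and> 0 < j \<and> j < r \<longrightarrow> g (i * P) = g (j * P)"
      using s *[OF Q[unfolded r]] by blast
    ultimately show "prefix_word g P \<preceq>\<^sub>s prefix_word g Q"
      unfolding simply_built_from_def using r0 by (metis (no_types, lifting) One_nat_def Suc_leI)
  qed
qed

definition symmetric_over :: "(nat \<Rightarrow> nat) \<Rightarrow> nat \<Rightarrow> nat \<Rightarrow> bool" where
  "symmetric_over g p q \<longleftrightarrow> p dvd q \<and> (\<forall>i. 0 < i \<and> i * p < q \<longrightarrow> g (i * p) = g (q - i * p))"

lemma symmetrically_built_from_prefix_word:
  assumes P: "level g P" and Q: "level g Q"
  shows "symmetrically_built_from (prefix_word g P) (prefix_word g Q) \<longleftrightarrow> symmetric_over g P Q"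
  unfolding symmetric_over_def
proof
  have P0: "0 < P" using level_pos[OF P] .
  assume "symmetrically_built_from (prefix_word g P) (prefix_word g Q)"
  then obtain r a where r: "r \<ge> 1" "prefix_word g Q = spaced_word (prefix_word g P) r a"
    and a: "\<And>i. 0 < i \<and> i < r \<Longrightarrow> a i = a (r - i)"
    unfolding symmetrically_built_from_def by blast
  have "Q = r * P \<and> (\<forall>i. 0 < i \<and> i < r \<longrightarrow> a i = g (i * P))"
    by (rule iffD1[OF spaced_prefix_word_eq_iff[OF P _ level_pos[OF Q]] r(2)]) (use r(1) in simp)
  then have Qr: "Q = r * P" and ag: "\<And>i. 0 < i \<Longrightarrow> i < r \<Longrightarrow> a i = g (i * P)"
    by blast+
  show "P dvd Q \<and> (\<forall>i. 0 < i \<and> i * P < Q \<longrightarrow> g (i * P) = g (Q - i * P))"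
  proof (intro conjI allI impI)
    show "P dvd Q" using Qr by simp
    fix i assume i: "0 < i \<and> i * P < Q"
    then have "i < r" using Qr by simp
    then show "g (i * P) = g (Q - i * P)"
      using a[of i] ag[of i] ag[of "r - i"] i Qr by (simp add: diff_mult_distrib)
  qed
next
  have P0: "0 < P" using level_pos[OF P] .
  assume *: "P dvd Q \<and> (\<forall>i. 0 < i \<and> i * P < Q \<longrightarrow> g (i * P) = g (Q - i * P))"
  then obtain r where r: "Q = r * P" by (auto simp: dvd_def mult.commute)
  then have r0: "0 < r" using level_pos[OF Q] by simp
  have "prefix_word g Q = spaced_word (prefix_word g P) r (\<lambda>i. g (i * P))"
    using spaced_prefix_word_eq_iff[OF P r0 level_pos[OF Q]] r by simp
  moreover have "g (i * P) = g ((r - i) * P)" if "0 < i" "i < r" for i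
    using * that P0 r by (simp add: diff_mult_distrib)
  ultimately show "symmetrically_built_from (prefix_word g P) (prefix_word g Q)"
    unfolding symmetrically_built_from_def using r0
    by (metis One_nat_def Suc_leI)
qed

lemma prefix_word_Suc:
  "prefix_word g (Suc (Suc r)) = prefix_word g (Suc r) @ ones (g (Suc r)) @ [False]"
  using word_of_gaps_append[of "map g [1..<Suc r]" "g (Suc r)" "[]"] by (simp add: prefix_word_def)

lemma length_prefix_word: "length (prefix_word g (Suc r)) = Suc (zero_pos g r)"
proof (induction r)
  case (Suc r)
  then show ?case by (simp add: prefix_word_Suc ones_def)
qed (simp add: prefix_word_def)

lemma nth_prefix_word: "n \<le> zero_pos g r \<Longrightarrow> prefix_word g (Suc r) ! n = gap_word g n"
proof (induction r arbitrary: n)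
  case 0
  then show ?case using gap_word_zero_pos[of g 0] by (simp add: prefix_word_def)
next
  case (Suc r)
  consider "n \<le> zero_pos g r" | "zero_pos g r < n" "n < zero_pos g (Suc r)" | "n = zero_pos g (Suc r)"
    using Suc.prems by linarith
  then show ?case
  proof cases
    case 1
    then show ?thesis using Suc.IH[of n] unfolding prefix_word_Suc
      by (simp add: nth_append length_prefix_word)
  next
    case 2
    then have "prefix_word g (Suc (Suc r)) ! n" unfolding prefix_word_Suc
      by (simp add: nth_append length_prefix_word ones_def)
    then show ?thesis using gap_word_between[OF 2] by simp
  next
    case 3
    then have "\<not> prefix_word g (Suc (Suc r)) ! n" unfolding prefix_word_Suc
      by (simp add: nth_append length_prefix_word ones_def)
    then show ?thesis using 3 gap_word_zero_pos by metis
  qed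
qed

section \<open>Infinite words given by gaps; the sets \<open>words_A\<close> and
  \<open>words_B\<close>\<close>

lemma flat_fromN_prefix:
  assumes "\<And>i. f i \<noteq> []" "0 < r"
  shows "flat (smap f (fromN 1)) = concat (map f [1..<r]) @- flat (smap f (fromN r))"
  using assms(2)
proof (induction r rule: nat_induct_non_zero)
  case (Suc r)
  have "flat (smap f (fromN r)) = f r @- flat (smap f (fromN (Suc r)))"
    using assms(1) by (subst siterate.code) simp
  then show ?case using Suc by simp
qed simp

lemma spaced_stream_prefix:
  assumes "v \<noteq> []" "0 < r"
  shows "\<exists>s. spaced_stream v a = spaced_word v r a @- s"
proof -
  let ?f = "\<lambda>i. v @ ones (a i)"
  have "flat (smap ?f (fromN r)) = ?f r @- flat (smap ?f (fromN (Suc r)))"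
    using assms(1) by (subst siterate.code) simp
  moreover have "flat (smap ?f (fromN 1)) = concat (map ?f [1..<r]) @- flat (smap ?f (fromN r))"
    by (rule flat_fromN_prefix) (use assms in auto)
  ultimately have "spaced_stream v a = spaced_word v r a @- (ones (a r) @- flat (smap ?f (fromN (Suc r))))"
    unfolding spaced_stream_def spaced_word_def by simp
  then show ?thesis by blast
qed

abbreviation stream_of_gaps :: "(nat \<Rightarrow> nat) \<Rightarrow> iword" where
  "stream_of_gaps g \<equiv> spaced_stream [False] g"

lemma stream_of_gaps_prefix:
  assumes "0 < r"
  shows "\<exists>s. stream_of_gaps g = prefix_word g r @- s"
proof -
  have "spaced_word [False] r g = prefix_word g r"
    using spaced_word_of_gaps[OF assms, of 1 "[]" g] by (simp add: prefix_word_def)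
  then show ?thesis using spaced_stream_prefix[OF _ assms, of "[False]" g] by simp
qed

lemma snth_stream_of_gaps: "stream_of_gaps g !! n = gap_word g n"
proof -
  obtain s where "stream_of_gaps g = prefix_word g (Suc n) @- s" using stream_of_gaps_prefix by blast
  then show ?thesis
    using nth_prefix_word[of n g n] zero_pos_ge[of n g] length_prefix_word[of g n] by simp
qed

lemma stream_eqI: "(\<And>n. s !! n = t !! n) \<Longrightarrow> s = t"
  by (coinduction arbitrary: s t) (auto, metis snth.simps(1), metis snth.simps(2))

lemma spaced_stream_eqI:
  assumes "v \<noteq> []" "\<And>r. 0 < r \<Longrightarrow> \<exists>s. V = spaced_word v r a @- s"
  shows "V = spaced_stream v a"
proof (rule stream_eqI)
  fix n
  obtain s where "V = spaced_word v (Suc n) a @- s" using assms(2) by blast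
  moreover obtain t where "spaced_stream v a = spaced_word v (Suc n) a @- t"
    using spaced_stream_prefix[OF assms(1)] by blast
  moreover have "n < length (spaced_word v (Suc n) a)"
  proof (induction n)
    case (Suc n)
    then show ?case using assms(1) by (cases v) (simp_all add: spaced_word_Suc)
  qed (use assms(1) in simp)
  ultimately show "V !! n = spaced_stream v a !! n" by simp
qed

lemma spaced_stream_conv_gaps:
  fixes xs :: "nat list" and a :: "nat \<Rightarrow> nat"
  defines "P \<equiv> Suc (length xs)"
  shows "spaced_stream (word_of_gaps xs) a = stream_of_gaps (\<lambda>t. if P dvd t then a (t div P) else xs ! (t mod P - 1))"
    (is "_ = stream_of_gaps ?f")
proof (rule spaced_stream_eqI[symmetric])
  fix r :: nat assume "0 < r"
  then have "spaced_word (word_of_gaps xs) r a = prefix_word ?f (r * P)"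
    using spaced_word_of_gaps[of r P xs a] by (simp add: P_def prefix_word_def)
  moreover have "0 < r * P" using \<open>0 < r\<close> by (simp add: P_def)
  ultimately show "\<exists>s. stream_of_gaps ?f = spaced_word (word_of_gaps xs) r a @- s"
    using stream_of_gaps_prefix by metis
qed simp

lemma stream_of_gaps_eqD:
  assumes "stream_of_gaps g = stream_of_gaps f" "0 < t"
  shows "g t = f t"
proof -
  obtain s where "stream_of_gaps g = prefix_word g (Suc t) @- s" using stream_of_gaps_prefix by blast
  moreover obtain s' where "stream_of_gaps f = prefix_word f (Suc t) @- s'" using stream_of_gaps_prefix by blast
  ultimately have "map g [1..<Suc t] = map f [1..<Suc t]"
    using assms(1) word_of_gaps_shift_eq unfolding prefix_word_def by (metis length_map)
  then show ?thesis using assms(2) by simp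
qed

lemma words_A_stream_of_gaps: "words_A (stream_of_gaps g) = prefix_word g ` {P. level g P}"
proof (intro set_eqI iffI)
  fix v assume "v \<in> words_A (stream_of_gaps g)"
  then obtain xs a where v: "v = word_of_gaps xs" and a: "stream_of_gaps g = spaced_stream v a"
    unfolding words_A_def words_F_eq by blast
  define P where "P = Suc (length xs)"
  have eq: "g t = (if P dvd t then a (t div P) else xs ! (t mod P - 1))" if "0 < t" for t
    using stream_of_gaps_eqD[OF a[unfolded v spaced_stream_conv_gaps] that] by (simp add: P_def)
  have "level g P"
    unfolding level_def by (auto simp: P_def[symmetric] eq dvd_eq_mod_eq_0) (simp add: P_def)
  moreover have "xs = map g [1..<P]"
  proof (rule nth_equalityI)
    fix i assume i: "i < length xs"
    then have "[1..<P] ! i = Suc i" "Suc i mod P = Suc i" "\<not> P dvd Suc i"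
      using P_def nat_dvd_not_less[of "Suc i" P] by (simp_all del: upt_Suc)
    then show "xs ! i = map g [1..<P] ! i" using i eq[of "Suc i"] by (simp add: P_def del: upt_Suc)
  qed (simp add: P_def del: upt_Suc)
  ultimately show "v \<in> prefix_word g ` {P. level g P}"
    unfolding prefix_word_def v by blast
next
  fix v assume "v \<in> prefix_word g ` {P. level g P}"
  then obtain P where P: "level g P" and v: "v = prefix_word g P" by blast
  have "stream_of_gaps g = spaced_stream v (\<lambda>i. g (i * P))"
  proof (rule spaced_stream_eqI)
    show "v \<noteq> []" by (simp add: v prefix_word_def)
    fix r :: nat assume r: "0 < r"
    then have rP: "0 < r * P" using level_pos[OF P] by simp
    then have "prefix_word g (r * P) = spaced_word v r (\<lambda>i. g (i * P))"
      using spaced_prefix_word_eq_iff[OF P r rP, of "\<lambda>i. g (i * P)"] v by simp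
    then show "\<exists>s. stream_of_gaps g = spaced_word v r (\<lambda>i. g (i * P)) @- s"
      using stream_of_gaps_prefix[OF rP] by metis
  qed
  then show "v \<in> words_A (stream_of_gaps g)"
    using word_of_gaps_in_F by (auto simp: words_A_def v prefix_word_def)
qed

lemma words_B_stream_of_gaps: "words_B (stream_of_gaps g) = prefix_word g ` {P. fundamental g P}"
proof -
  have strict: "prefix_word g p \<prec> prefix_word g q \<longleftrightarrow> p dvd q \<and> p \<noteq> q" if "level g p" "level g q" for p q
    using built_from_prefix_word[OF that] prefix_word_eq_iff level_pos[OF that(1)] level_pos[OF that(2)]
    by (auto simp: strictly_built_from_def)
  have "(\<forall>u\<in>words_A (stream_of_gaps g). \<forall>u'\<in>words_A (stream_of_gaps g).
      u \<prec> prefix_word g P \<and> prefix_word g P \<prec> u' \<longrightarrow> \<not> u \<preceq>\<^sub>s u') \<longleftrightarrow> fundamental g P"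
    if P: "level g P" for P
    unfolding words_A_stream_of_gaps fundamental_def
    using P strict[OF _ P] strict[OF P] simply_built_from_prefix_word dvd_trans
    by (simp add: ball_simps) (use dvd_trans[of _ P] in blast)
  then show ?thesis
    unfolding words_B_def words_A_stream_of_gaps by (auto simp: fundamental_def)
qed

lemma cycle_eqI:
  assumes "0 < k" "\<And>n. V !! (n + k) = V !! n"
  shows "V = cycle (stake k V)"
proof -
  define w where "w = stake k V"
  have w: "w \<noteq> []" "length w = k" using assms(1) by (simp_all add: w_def)
  have "V !! n = cycle w !! n" for n
  proof (induction n rule: less_induct)
    case (less n)
    have c: "cycle w !! n = (if n < k then w ! n else cycle w !! (n - k))"
      using cycle_decomp[OF w(1)] w(2) by (metis shift_snth)
    show ?case
    proof (cases "n < k")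
      case True
      then show ?thesis using c by (simp add: w_def stake_nth)
    next
      case False
      then have "V !! n = V !! (n - k)" using assms(2)[of "n - k"] by simp
      then show ?thesis using less[of "n - k"] False c assms(1) by simp
    qed
  qed
  then show ?thesis unfolding w_def by (rule stream_eqI)
qed

lemma gap_word_periodic:
  assumes "\<And>t. 0 < t \<Longrightarrow> g (t + P) = g t"
  shows "gap_word g (n + zero_pos g P) = gap_word g n"
proof -
  have add: "zero_pos g (t + P) = zero_pos g t + zero_pos g P" for t
  proof (induction t)
    case (Suc t)
    then show ?case using assms[of "Suc t"] by simp
  qed simp
  have "n + zero_pos g P \<in> range (zero_pos g) \<longleftrightarrow> n \<in> range (zero_pos g)"
  proof
    assume "n + zero_pos g P \<in> range (zero_pos g)"
    then obtain w where w: "n + zero_pos g P = zero_pos g w" by blast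
    then have "zero_pos g P \<le> zero_pos g w" by linarith
    then have "P \<le> w" by simp
    then have "n = zero_pos g (w - P)" using add[of "w - P"] w by simp
    then show "n \<in> range (zero_pos g)" by blast
  next
    assume "n \<in> range (zero_pos g)"
    then obtain t where "n = zero_pos g t" by blast
    then have "n + zero_pos g P = zero_pos g (t + P)" by (simp add: add)
    then show "n + zero_pos g P \<in> range (zero_pos g)" by simp
  qed
  then show ?thesis by (simp add: gap_word_def)
qed

text \<open>Any element of \<open>words_A V\<close> provides the gap sequence. A period
  \<open>P\<close> of the gaps would give the word the period \<open>zero_pos g P\<close>, making it
  a repetition of one finite word.\<close>

lemma rank_one_gaps_exists:
  assumes "rank_one V" "\<not> degenerate V"
  obtains g where "V = stream_of_gaps g" "rank_one_gaps g"
proof -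
  have "words_A V \<noteq> {}" using assms(1) unfolding rank_one_def by auto
  then obtain g where V: "V = stream_of_gaps g"
    unfolding words_A_def words_F_eq using spaced_stream_conv_gaps by blast
  have "rank_one_gaps g"
  proof
    show "infinite {P. level g P}"
      using assms(1) unfolding rank_one_def V words_A_stream_of_gaps by blast
    fix P :: nat assume P: "0 < P"
    show "\<exists>t>0. g (t + P) \<noteq> g t"
    proof (rule ccontr)
      assume "\<not> ?thesis"
      then have "gap_word g (n + zero_pos g P) = gap_word g n" for n
        by (intro gap_word_periodic) blast
      then have "V !! (n + zero_pos g P) = V !! n" for n
        by (simp add: V snth_stream_of_gaps)
      moreover have z: "0 < zero_pos g P" using P zero_pos_ge[of P g] by simp
      ultimately have "V = cycle (stake (zero_pos g P) V)" using cycle_eqI by blast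
      then show False using assms(2) z unfolding degenerate_def by (metis stake_invert_Nil less_irrefl)
    qed
  qed
  then show thesis using V that by blast
qed

section \<open>Isomorphisms as sliding block codes\<close>

lemma subword_stream_of_gaps:
  "subword w (stream_of_gaps g) \<longleftrightarrow> (\<exists>k. \<forall>j<length w. w ! j = gap_word g (k + j))"
  unfolding subword_def by (auto simp: list_eq_iff_nth_eq stake_nth sdrop_snth snth_stream_of_gaps)

lemma in_system_space_iff:
  "x \<in> system_space (stream_of_gaps g) \<longleftrightarrow> (\<forall>i n. \<exists>k. \<forall>j<n. x (i + int j) = gap_word g (k + j))"
  unfolding system_space_def subword_stream_of_gaps by simp

lemma in_system_spaceI_centered:
  assumes "\<And>n. \<exists>k. \<forall>j<2 * n + 1. x (int j - int n) = gap_word g (k + j)"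
  shows "x \<in> system_space (stream_of_gaps g)"
  unfolding in_system_space_iff
proof (intro allI)
  fix i n
  define m where "m = nat \<bar>i\<bar> + n"
  obtain k where k: "\<And>j. j < 2 * m + 1 \<Longrightarrow> x (int j - int m) = gap_word g (k + j)" using assms by blast
  define d where "d = nat (i + int m)"
  have d: "int d = i + int m" by (simp add: d_def m_def)
  have "x (i + int j) = gap_word g ((k + d) + j)" if "j < n" for j
  proof -
    have "d + j < 2 * m + 1" using that d by (simp add: m_def)
    then show ?thesis using k[of "d + j"] d by (simp add: algebra_simps)
  qed
  then show "\<exists>k. \<forall>j<n. x (i + int j) = gap_word g (k + j)" by blast
qed

lemma system_space_shift:
  assumes "x \<in> system_space V"
  shows "(\<lambda>i. x (i + k)) \<in> system_space V"
proof -
  have "subword (map (\<lambda>l. x ((i + k) + int l)) [0..<n]) V" for i n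
    using assms unfolding system_space_def by blast
  then show ?thesis by (simp add: system_space_def algebra_simps)
qed

section \<open>Cylinder sets and compactness\<close>

lemma open_cylinder:
  fixes Q :: "(int \<Rightarrow> bool) \<Rightarrow> bool"
  assumes F: "finite F" and dep: "\<And>x z. (\<And>i. i \<in> F \<Longrightarrow> x i = z i) \<Longrightarrow> Q x = Q z"
  shows "open {x. Q x}"
proof (subst open_subopen, intro ballI)
  fix x assume "x \<in> {x. Q x}"
  then have Q: "Q x" by simp
  have "open {z. \<forall>i\<in>F. z i \<in> {x i}}"
    by (rule product_topology_basis'[OF F]) (rule open_discrete)
  moreover have "{z. \<forall>i\<in>F. z i \<in> {x i}} \<subseteq> {x. Q x}" using dep[of x] Q by auto
  ultimately show "\<exists>T. open T \<and> x \<in> T \<and> T \<subseteq> {x. Q x}" by blast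
qed

lemma closed_cylinder:
  fixes Q :: "(int \<Rightarrow> bool) \<Rightarrow> bool"
  assumes F: "finite F" and dep: "\<And>x z. (\<And>i. i \<in> F \<Longrightarrow> x i = z i) \<Longrightarrow> Q x = Q z"
  shows "closed {x. Q x}"
proof -
  have "open {x. \<not> Q x}" by (rule open_cylinder[OF F]) (use dep in blast)
  then show ?thesis by (simp add: closed_def Compl_eq)
qed

lemma compact_UNIV_int_bool: "compact (UNIV :: (int \<Rightarrow> bool) set)"
proof -
  have "compact_space (euclidean :: bool topology)"
    by (simp add: compact_space_def finite_imp_compact)
  then have "compact_space (product_topology (\<lambda>i::int. euclidean :: bool topology) UNIV)"
    by (simp add: compact_space_product_topology)
  then show ?thesis by (simp add: euclidean_product_topology compact_space_def)
qed

lemma compact_system_space: "compact (system_space V)"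
proof -
  have "closed {x. subword (map (\<lambda>k. x (i + int k)) [0..<n]) V}" for i n
  proof (rule closed_cylinder)
    show "finite ((\<lambda>k. i + int k) ` {..<n})" by simp
    fix x z :: zword assume "\<And>j. j \<in> (\<lambda>k. i + int k) ` {..<n} \<Longrightarrow> x j = z j"
    then have "map (\<lambda>k. x (i + int k)) [0..<n] = map (\<lambda>k. z (i + int k)) [0..<n]" by simp
    then show "subword (map (\<lambda>k. x (i + int k)) [0..<n]) V = subword (map (\<lambda>k. z (i + int k)) [0..<n]) V"
      by (simp only:)
  qed
  then have "closed (\<Inter>i. \<Inter>n. {x. subword (map (\<lambda>k. x (i + int k)) [0..<n]) V})" by (intro closed_INT ballI)
  moreover have "system_space V = (\<Inter>i. \<Inter>n. {x. subword (map (\<lambda>k. x (i + int k)) [0..<n]) V})"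
    unfolding system_space_def by blast
  ultimately show ?thesis using compact_Int_closed[OF compact_UNIV_int_bool] by simp
qed

lemma open_contains_window:
  fixes U :: "(int \<Rightarrow> bool) set"
  assumes "open U" "x \<in> U"
  shows "\<exists>n. \<forall>z. (\<forall>i. \<bar>i\<bar> \<le> int n \<longrightarrow> z i = x i) \<longrightarrow> z \<in> U"
proof -
  have "openin (product_topology (\<lambda>i. euclidean) UNIV) U" using assms(1) by (simp add: open_fun_def)
  from product_topology_open_contains_basis[OF this assms(2)]
  obtain X where X: "x \<in> Pi\<^sub>E UNIV X" "finite {i. X i \<noteq> UNIV}" "Pi\<^sub>E UNIV X \<subseteq> U"
    by auto
  define n where "n = (\<Sum>i\<in>{i. X i \<noteq> UNIV}. nat \<bar>i\<bar>)"
  show ?thesis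
  proof (intro exI[of _ n] allI impI)
    fix z assume z: "\<forall>i. \<bar>i\<bar> \<le> int n \<longrightarrow> z i = x i"
    have "z i \<in> X i" for i
    proof (cases "X i = UNIV")
      case False
      then have "nat \<bar>i\<bar> \<le> n" unfolding n_def using X(2) by (intro member_le_sum) auto
      then have "z i = x i" using z by (auto simp: nat_le_iff)
      then show ?thesis using X(1) by (auto simp: PiE_iff)
    qed simp
    then show "z \<in> U" using X(3) by (auto simp: PiE_iff)
  qed
qed

text \<open>The local-rule half of the Curtis-Hedlund-Lyndon theorem. \<open>W n\<close> is defined
  for arbitrary \<open>x\<close>, with only the test points taken from \<open>S\<close>, so it
  depends on finitely many coordinates and is open in the whole space; compactness selects one
  \<open>n\<close> from the increasing cover.\<close>

lemma uniform_window:
  fixes S :: "(int \<Rightarrow> bool) set" and f :: "(int \<Rightarrow> bool) \<Rightarrow> bool"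
  assumes "compact S" "continuous_on S f"
  shows "\<exists>n. \<forall>x\<in>S. \<forall>z\<in>S. (\<forall>i. \<bar>i\<bar> \<le> int n \<longrightarrow> x i = z i) \<longrightarrow> f x = f z"
proof -
  define W where "W n = {x. \<forall>z\<in>S. \<forall>z'\<in>S.
      (\<forall>i. \<bar>i\<bar> \<le> int n \<longrightarrow> z i = x i \<and> z' i = x i) \<longrightarrow> f z = f z'}" for n
  have op: "open (W n)" for n
    unfolding W_def
  proof (rule open_cylinder)
    show "finite {- int n..int n}" by simp
    fix x z :: "int \<Rightarrow> bool" assume "\<And>i. i \<in> {- int n..int n} \<Longrightarrow> x i = z i"
    then have "\<bar>i\<bar> \<le> int n \<Longrightarrow> x i = z i" for i by (auto simp: abs_le_iff)
    then have "(\<forall>i. \<bar>i\<bar> \<le> int n \<longrightarrow> u i = x i \<and> v i = x i) \<longleftrightarrow> (\<forall>i. \<bar>i\<bar> \<le> int n \<longrightarrow> u i = z i \<and> v i = z i)"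
      for u v by auto
    then show "(\<forall>u\<in>S. \<forall>v\<in>S. (\<forall>i. \<bar>i\<bar> \<le> int n \<longrightarrow> u i = x i \<and> v i = x i) \<longrightarrow> f u = f v) =
      (\<forall>u\<in>S. \<forall>v\<in>S. (\<forall>i. \<bar>i\<bar> \<le> int n \<longrightarrow> u i = z i \<and> v i = z i) \<longrightarrow> f u = f v)" by simp
  qed
  have mono: "W m \<subseteq> W n" if "m \<le> n" for m n
  proof
    fix x assume x: "x \<in> W m"
    have "\<bar>i\<bar> \<le> int n" if "\<bar>i\<bar> \<le> int m" for i using that \<open>m \<le> n\<close> by linarith
    then show "x \<in> W n" using x unfolding W_def by blast
  qed
  have cover: "S \<subseteq> (\<Union>n. W n)"
  proof
    fix x assume x: "x \<in> S"
    have "openin (top_of_set S) (S \<inter> f -` {f x})"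
      using assms(2) continuous_on_open_gen[of f S UNIV] by (auto intro: continuous_openin_preimage open_discrete)
    then obtain U where U: "open U" "S \<inter> f -` {f x} = S \<inter> U" by (auto simp: openin_open)
    then have "x \<in> U" using x by auto
    then obtain n where n: "\<And>z. (\<forall>i. \<bar>i\<bar> \<le> int n \<longrightarrow> z i = x i) \<Longrightarrow> z \<in> U"
      using open_contains_window[OF U(1)] by blast
    have "f z = f x" if "z \<in> S" "\<forall>i. \<bar>i\<bar> \<le> int n \<longrightarrow> z i = x i" for z
      using n[OF that(2)] that(1) U(2) by blast
    then have "x \<in> W n" unfolding W_def by simp
    then show "x \<in> (\<Union>n. W n)" by (intro UN_I[of n] UNIV_I)
  qed
  obtain C where C: "C \<subseteq> UNIV" "finite C" "S \<subseteq> (\<Union>n\<in>C. W n)"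
    by (rule compactE_image[OF assms(1) op cover])
  define n where "n = Max (insert 0 C)"
  have "W m \<subseteq> W n" if "m \<in> C" for m using C(2) that by (intro mono) (simp add: n_def)
  then have sub: "S \<subseteq> W n" using C(3) by blast
  show ?thesis
  proof (intro exI[of _ n] ballI impI)
    fix x z assume "x \<in> S" "z \<in> S" and eq: "\<forall>i. \<bar>i\<bar> \<le> int n \<longrightarrow> x i = z i"
    then have "x \<in> W n" using sub by blast
    moreover have "\<forall>i. \<bar>i\<bar> \<le> int n \<longrightarrow> x i = x i \<and> z i = x i" using eq by metis
    ultimately show "f x = f z" unfolding W_def using \<open>x \<in> S\<close> \<open>z \<in> S\<close> by blast
  qed
qed

section \<open>Points of the system and the image word of an isomorphism\<close>

context rank_one_gaps
begin

abbreviation system :: "zword set" where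
  "system \<equiv> system_space (stream_of_gaps g)"

lemma prefix_recurs: "\<exists>k\<ge>K. \<forall>j<n. gap_word g (k + j) = gap_word g j"
proof -
  obtain p where p: "level g p" "n < p" using large_level by blast
  have "K \<le> K * p" using level_pos[OF p(1)] by simp
  then have "K \<le> zero_pos g (K * p)" using zero_pos_ge[of "K * p" g] by linarith
  moreover have "gap_word g (zero_pos g (K * p) + j) = gap_word g j" if "j < n" for j
    using gap_word_block[OF p(1)] zero_pos_ge[of "p - 1" g] p(2) that by simp
  ultimately show ?thesis by blast
qed

lemma window_recurs: "\<exists>k\<ge>K. \<forall>j<n. gap_word g (k + j) = gap_word g (i + j)"
proof -
  obtain k where "k \<ge> K" "\<And>j. j < i + n \<Longrightarrow> gap_word g (k + j) = gap_word g j"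
    using prefix_recurs by blast
  then have "k + i \<ge> K" "\<forall>j<n. gap_word g (k + i + j) = gap_word g (i + j)"
    by (auto simp: add.assoc)
  then show ?thesis by blast
qed

text \<open>The word \<open>V\<close> is one-sided, so a point showing a given prefix has to be
  completed to the left. Late recurrences of the prefix leave enough room there for every finite
  window, and compactness yields a point satisfying all the conditions \<open>C n\<close>.\<close>

lemma prefix_extends:
  fixes i :: int
  shows "\<exists>x\<in>system. \<forall>j<N. x (i + int j) = gap_word g j"
proof -
  define C where "C n = {x :: zword. (\<forall>j<N. x (i + int j) = gap_word g j) \<and>
      (\<exists>k. \<forall>j<2 * n + 1. x (int j - int n) = gap_word g (k + j))}" for n
  have cl: "closed (C n)" for n
    unfolding C_def
  proof (rule closed_cylinder)
    show "finite ((\<lambda>j. i + int j) ` {..<N} \<union> (\<lambda>j. int j - int n) ` {..<2 * n + 1})" by simp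
    fix x z :: zword
    assume "\<And>l. l \<in> (\<lambda>j. i + int j) ` {..<N} \<union> (\<lambda>j. int j - int n) ` {..<2 * n + 1} \<Longrightarrow> x l = z l"
    then have "\<And>j. j < N \<Longrightarrow> x (i + int j) = z (i + int j)"
      "\<And>j. j < 2 * n + 1 \<Longrightarrow> x (int j - int n) = z (int j - int n)" by auto
    then show "((\<forall>j<N. x (i + int j) = gap_word g j) \<and> (\<exists>k. \<forall>j<2 * n + 1. x (int j - int n) = gap_word g (k + j))) =
      ((\<forall>j<N. z (i + int j) = gap_word g j) \<and> (\<exists>k. \<forall>j<2 * n + 1. z (int j - int n) = gap_word g (k + j)))"
      by auto
  qed
  have ne: "C n \<noteq> {}" for n
  proof -
    obtain k where k: "k \<ge> n + nat \<bar>i\<bar>" "\<And>j. j < N \<Longrightarrow> gap_word g (k + j) = gap_word g j"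
      using prefix_recurs by blast
    \<comment> \<open>A late occurrence of the prefix is moved to \<open>i\<close>. On coordinates
      from \<open>- n\<close> on, the argument of \<open>nat\<close> is nonnegative because
      \<open>k \<ge> n + nat \<bar>i\<bar>\<close>; further left the values are irrelevant for
      \<open>C n\<close>.\<close>
    define x where "x l = gap_word g (nat (int k + l - i))" for l
    define d where "d = nat (int k - int n - i)"
    have d: "int d = int k - int n - i" using k(1) by (simp add: d_def)
    have "x (i + int j) = gap_word g j" if "j < N" for j
      using k(2)[OF that] by (simp add: x_def nat_add_distrib flip: of_nat_add)
    moreover have "x (int j - int n) = gap_word g (d + j)" for j
    proof -
      have "int k + (int j - int n) - i = int (d + j)" using d by simp
      then show ?thesis unfolding x_def by (simp only: nat_int)
    qed
    ultimately have "x \<in> C n" unfolding C_def by blast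
    then show ?thesis by blast
  qed
  have mono: "C n \<subseteq> C m" if "m \<le> n" for m n
  proof
    fix x assume x: "x \<in> C n"
    then obtain k where k: "\<And>j. j < 2 * n + 1 \<Longrightarrow> x (int j - int n) = gap_word g (k + j)"
      unfolding C_def by blast
    have "x (int j - int m) = gap_word g (k + (n - m) + j)" if "j < 2 * m + 1" for j
      using k[of "j + (n - m)"] that \<open>m \<le> n\<close> by (simp add: of_nat_diff algebra_simps)
    then show "x \<in> C m" using x unfolding C_def by blast
  qed
  have "UNIV \<inter> \<Inter>(range C) \<noteq> {}"
  proof (rule compact_imp_fip[OF compact_UNIV_int_bool])
    fix F assume "finite F" "F \<subseteq> range C"
    then obtain A where A: "finite A" "F = C ` A" by (meson finite_subset_image)
    have "C (Max (insert 0 A)) \<subseteq> C a" if "a \<in> A" for a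
      using A(1) that by (intro mono) simp
    then have "C (Max (insert 0 A)) \<subseteq> \<Inter>F" using A(2) by blast
    then show "UNIV \<inter> \<Inter>F \<noteq> {}" using ne by blast
  qed (use cl in auto)
  then obtain x where x: "\<And>n. x \<in> C n" by blast
  have "x \<in> system" by (rule in_system_spaceI_centered) (use x in \<open>auto simp: C_def\<close>)
  then show ?thesis using x[of 0] unfolding C_def by blast
qed

lemma ex_one: "\<exists>n. gap_word g n"
proof -
  obtain t where t: "0 < t" "g (t + 1) \<noteq> g t" using not_periodic[of 1] by auto
  then obtain s where s: "0 < s" "0 < g s" by (metis gr0I add_gr_0)
  have "gap_word g (zero_pos g (s - 1) + 1)"
    by (rule gap_word_between[of _ "s - 1"]) (use s in \<open>cases s; simp\<close>)+
  then show ?thesis by blast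
qed

lemma system_not_fixed: "\<exists>x\<in>system. zshift x \<noteq> x"
proof -
  obtain n where n: "gap_word g n" using ex_one by blast
  obtain x where x: "x \<in> system" "\<And>j. j < Suc n \<Longrightarrow> x (0 + int j) = gap_word g j"
    using prefix_extends[of "Suc n" 0] by blast
  have "zshift x \<noteq> x"
  proof
    assume "zshift x = x"
    then have step: "x (i + 1) = x i" for i unfolding zshift_def by metis
    have "x (int j) = x 0" for j
    proof (induction j)
      case (Suc j)
      then show ?case using step[of "int j"] by (simp add: add.commute)
    qed simp
    then show False using x(2)[of 0] x(2)[of n] n gap_word_zero_pos[of g 0] by simp
  qed
  then show ?thesis using x by blast
qed

text \<open>\<open>y n\<close> is the value at \<open>0\<close> of the image of any point whose
  window of radius \<open>R\<close> reads \<open>V\<close> from \<open>n\<close>; the uniform radius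
  makes it independent of the point. Since shifting a point moves its image the other way, a prefix
  of \<open>y\<close> is read off a single \<open>f x\<close> from \<open>0\<close> to the left, and
  \<open>f x\<close> again has all its windows in \<open>V\<close>.\<close>

lemma reversed_factor_of_isomorphism:
  assumes "topologically_isomorphic system zshift system (inv zshift)"
  shows "\<exists>y R. reversed_factor g y R"
proof -
  obtain f f' where hom: "homeomorphism system system f f'"
    and comm: "\<And>x. x \<in> system \<Longrightarrow> f (zshift x) = inv zshift (f x)"
    using assms unfolding topologically_isomorphic_def by blast
  have f_in: "f x \<in> system" if "x \<in> system" for x
    using hom that unfolding homeomorphism_def by blast
  have f_inj: "x = z" if "x \<in> system" "z \<in> system" "f x = f z" for x z
    using hom that unfolding homeomorphism_def by metis
  have shift: "f (\<lambda>i. x (i + int k)) l = f x (l - int k)" if "x \<in> system" for x k l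
  proof (induction k arbitrary: l)
    case (Suc k)
    have "(\<lambda>i. x (i + int (Suc k))) = zshift (\<lambda>i. x (i + int k))"
      by (simp add: zshift_def algebra_simps)
    then show ?case using comm[OF system_space_shift[OF that, of "int k"]] Suc[of "l - 1"]
      by (simp add: inv_zshift algebra_simps)
  qed simp
  have "continuous_on system (\<lambda>x. f x 0)"
    using hom unfolding homeomorphism_def by (blast intro: continuous_on_product_then_coordinatewise)
  from uniform_window[OF compact_system_space this]
  obtain R where R: "\<forall>x\<in>system. \<forall>z\<in>system. (\<forall>i. \<bar>i\<bar> \<le> int R \<longrightarrow> x i = z i) \<longrightarrow> f x 0 = f z 0" ..
  define W where "W n = {x \<in> system. \<forall>j\<le>2 * R. x (int j - int R) = gap_word g (n + j)}" for n
  define y where "y n \<longleftrightarrow> (\<exists>x\<in>W n. f x 0)" for n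
  have y_eq: "f x 0 = y n" if "x \<in> W n" for x n
  proof -
    have "f z 0 = f x 0" if z: "z \<in> W n" for z
    proof (rule R[rule_format])
      have "\<forall>i. \<bar>i\<bar> \<le> int R \<longrightarrow> z i = x i"
      proof (intro allI impI)
        fix i :: int assume "\<bar>i\<bar> \<le> int R"
        define j where "j = nat (i + int R)"
        have j: "j \<le> 2 * R" "int j - int R = i" using \<open>\<bar>i\<bar> \<le> int R\<close> by (auto simp: j_def)
        have "z (int j - int R) = gap_word g (n + j)" "x (int j - int R) = gap_word g (n + j)"
          using z \<open>x \<in> W n\<close> j(1) by (auto simp: W_def)
        then show "z i = x i" by (simp add: j(2))
      qed
      then show "\<And>i. \<bar>i\<bar> \<le> int R \<Longrightarrow> z i = x i" by blast
    qed (use z \<open>x \<in> W n\<close> in \<open>auto simp: W_def\<close>)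
    then show ?thesis using that unfolding y_def by blast
  qed
  have "reversed_factor g y R"
  proof
    fix n n' assume "\<And>j. j \<le> 2 * R \<Longrightarrow> gap_word g (n + j) = gap_word g (n' + j)"
    then have "W n = W n'" unfolding W_def by auto
    then show "y n = y n'" unfolding y_def by simp
  next
    fix m
    obtain x where x: "x \<in> system" "\<And>j. j < m + 2 * R + 1 \<Longrightarrow> x (- int R + int j) = gap_word g j"
      using prefix_extends[of "m + 2 * R + 1" "- int R"] by blast
    have yk: "y k = f x (- int k)" if "k \<le> m" for k
    proof -
      have "(\<lambda>i. x (i + int k)) \<in> W k"
        unfolding W_def
      proof (intro CollectI conjI allI impI)
        show "(\<lambda>i. x (i + int k)) \<in> system" by (rule system_space_shift[OF x(1)])
        fix j assume "j \<le> 2 * R"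
        then show "x (int j - int R + int k) = gap_word g (k + j)"
          using x(2)[of "k + j"] that by (simp add: algebra_simps)
      qed
      then show ?thesis using y_eq shift[OF x(1), of k 0] by fastforce
    qed
    obtain k where k: "\<And>j. j < m + 1 \<Longrightarrow> f x (- int m + int j) = gap_word g (k + j)"
      using f_in[OF x(1)] unfolding in_system_space_iff by blast
    have "y j = gap_word g (k + m - j)" if "j \<le> m" for j
      using yk[OF that] k[of "m - j"] that by (simp add: of_nat_diff)
    then show "\<exists>k. \<forall>j\<le>m. y j = gap_word g (k + m - j)" by blast
  next
    \<comment> \<open>If \<open>y\<close> were eventually one, every image would consist of ones,
      because each window recurs beyond \<open>n0\<close>. Then a point \<open>x\<close> and its
      shift \<open>zshift x \<noteq> x\<close> would have the same image.\<close>
    show "infinite {n. \<not> y n}"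
    proof
      assume "finite {n. \<not> y n}"
      then obtain n0 where n0: "\<And>n. \<not> y n \<Longrightarrow> n < n0"
        using finite_nat_set_iff_bounded[of "{n. \<not> y n}"] by auto
      have one: "f x 0" if x: "x \<in> system" for x
      proof -
        obtain k where k: "\<And>j. j < 2 * R + 1 \<Longrightarrow> x (- int R + int j) = gap_word g (k + j)"
          using x unfolding in_system_space_iff by blast
        obtain k' where k': "k' \<ge> n0" "\<And>j. j < 2 * R + 1 \<Longrightarrow> gap_word g (k' + j) = gap_word g (k + j)"
          using window_recurs by blast
        have "x \<in> W k'" unfolding W_def using x k k'(2) by (auto simp: less_Suc_eq_le)
        then show ?thesis using y_eq n0[of k'] k'(1) by auto
      qed
      have "f x l" if x: "x \<in> system" for x l
      proof (cases "l \<le> 0")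
        case True
        have "f (\<lambda>i. x (i + int (nat (- l)))) 0" by (rule one[OF system_space_shift[OF x]])
        then show ?thesis using shift[OF x, of "nat (- l)" 0] True by simp
      next
        case False
        define z where "z = (\<lambda>i. x (i + - l))"
        have z: "z \<in> system" unfolding z_def by (rule system_space_shift[OF x])
        have "x = (\<lambda>i. z (i + int (nat l)))" using False by (simp add: z_def)
        then have "f x l = f z 0" using shift[OF z, of "nat l" l] False by simp
        then show ?thesis using one[OF z] by simp
      qed
      then have "f x = (\<lambda>l. True)" if "x \<in> system" for x using that by blast
      moreover have "zshift x \<in> system" if "x \<in> system" for x
        using system_space_shift[OF that, of 1] by (simp add: zshift_def)
      ultimately show False using system_not_fixed f_inj by metis
    qed
  qed
  then show ?thesis by blast
qed

end

section \<open>Reversal of symmetric words\<close>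

lemma symmetric_over_refl: "symmetric_over g p p"
  by (auto simp: symmetric_over_def)

text \<open>Multiples of \<open>q\<close> are mirrored by the outer symmetry. Any other index
  reduces modulo \<open>q\<close> to some \<open>e\<close> inside the first \<open>q\<close>-block
  and is mirrored there; \<open>q - e\<close> is congruent to \<open>q' - i * p\<close> because
  \<open>q dvd q'\<close>.\<close>

lemma symmetric_over_trans:
  assumes s: "symmetric_over g p q" "symmetric_over g q q'" and q: "level g q" and q': "0 < q'"
  shows "symmetric_over g p q'"
  unfolding symmetric_over_def
proof (intro conjI allI impI)
  have d: "p dvd q" "q dvd q'" using s by (auto simp: symmetric_over_def)
  then show "p dvd q'" by (rule dvd_trans)
  fix i assume i: "0 < i \<and> i * p < q'"
  show "g (i * p) = g (q' - i * p)"
  proof (cases "q dvd i * p")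
    case True
    then obtain j where j: "i * p = j * q" by (auto simp: dvd_def mult.commute)
    have "0 < i * p" using i d q' by (auto intro!: Nat.gr0I)
    then have "0 < j" using j by (auto intro!: Nat.gr0I)
    then show ?thesis using s(2) i unfolding symmetric_over_def j by blast
  next
    case False
    define e where "e = (i * p) mod q"
    have q0: "0 < q" by (rule level_pos[OF q])
    have e: "0 < e" "e < q" using False q0 by (auto simp: e_def mod_greater_zero_iff_not_dvd)
    have "p dvd e" unfolding e_def using d(1) by (simp add: dvd_mod_iff)
    then obtain k where k: "e = k * p" by (auto simp: dvd_def mult.commute)
    then have "0 < k" using e by (auto intro!: Nat.gr0I)
    have pos: "0 < i * p" using False by (auto intro!: Nat.gr0I)
    have "g (i * p) = g e"
      by (rule levelD[OF q pos e(1) _ False]) (simp add: e_def)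
    also have "g e = g (q - e)"
      using s(1) e \<open>0 < k\<close> unfolding symmetric_over_def k by blast
    also have "g (q - e) = g (q' - i * p)"
    proof (rule levelD[OF q])
      have "(q' - e) mod q = (q' - i * p) mod q"
        by (rule mod_reflect) (use i e d(2) dvd_imp_le[OF d(2) q'] in \<open>auto simp: e_def\<close>)
      moreover obtain c where "q' = q * c" using d(2) by (auto simp: dvd_def)
      then have "q' - e = (q - e) + (c - 1) * q" using q' e(2) by (cases c) (auto simp: algebra_simps)
      then have "(q' - e) mod q = (q - e) mod q" by simp
      ultimately show "(q - e) mod q = (q' - i * p) mod q" by simp
      show "\<not> q dvd q - e" using e by (intro nat_dvd_not_less) auto
    qed (use i e in auto)
    finally show ?thesis .
  qed
qed

lemma ex_enclosing_interval:
  fixes s :: "nat \<Rightarrow> nat"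
  assumes "strict_mono s" "s 0 = 0"
  shows "\<exists>i. s i \<le> c \<and> c < s (Suc i)"
proof (induction c)
  case 0
  then show ?case using assms strict_monoD[OF assms(1), of 0 1] by (intro exI[of _ 0]) simp
next
  case (Suc c)
  then obtain i where i: "s i \<le> c" "c < s (Suc i)" by blast
  show ?case
  proof (cases "Suc c < s (Suc i)")
    case True
    then show ?thesis using i by (intro exI[of _ i]) simp
  next
    case False
    then show ?thesis using i strict_monoD[OF assms(1), of "Suc i" "Suc (Suc i)"]
      by (intro exI[of _ "Suc i"]) simp
  qed
qed

text \<open>Only the gap after \<open>a\<close> must be known to end inside the window: the zero
  ending it appears at the same offset after \<open>b\<close> and bounds the other gap, which brings
  that one into the window too.\<close>

lemma same_gap:
  assumes w: "\<And>j. j \<le> l \<Longrightarrow> gap_word g (zero_pos g a + j) = gap_word g (zero_pos g b + j)"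
    and u: "g (Suc a) < l"
  shows "g (Suc b) = g (Suc a)"
proof -
  have "\<not> gap_word g (zero_pos g a + Suc (g (Suc a)))"
    using gap_word_zero_pos[of g "Suc a"] by simp
  then have n: "\<not> gap_word g (zero_pos g b + Suc (g (Suc a)))" using w[of "Suc (g (Suc a))"] u by simp
  have le: "g (Suc b) \<le> g (Suc a)"
    using n gap_word_between[of g b "zero_pos g b + Suc (g (Suc a))"] by force
  have "\<not> gap_word g (zero_pos g b + Suc (g (Suc b)))"
    using gap_word_zero_pos[of g "Suc b"] by simp
  then have "\<not> gap_word g (zero_pos g a + Suc (g (Suc b)))" using w[of "Suc (g (Suc b))"] u le by simp
  then have "g (Suc a) \<le> g (Suc b)"
    using gap_word_between[of g a "zero_pos g a + Suc (g (Suc b))"] by force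
  with le show ?thesis by simp
qed

context rank_one_gaps
begin

text \<open>A window need not contain enough zeros for \<open>recognizability\<close>; but a gap longer than all
  gaps inside a block can only occur between blocks.\<close>

lemma block_starts_local:
  assumes p: "level g p"
  shows "\<exists>w. \<forall>n n'. (\<forall>j<w. gap_word g (n + j) = gap_word g (n' + j)) \<longrightarrow>
    n \<in> range (\<lambda>i. zero_pos g (i * p)) \<longrightarrow> n' \<in> range (\<lambda>i. zero_pos g (i * p))"
proof -
  have p0: "0 < p" by (rule level_pos[OF p])
  obtain T where T: "\<And>i i'. 0 < i \<Longrightarrow> 0 < i' \<Longrightarrow> (\<And>s. s < T \<Longrightarrow> g (i + s) = g (i' + s)) \<Longrightarrow> i mod p = i' mod p"
    using recognizability[OF p] by blast
  define G where "G = Suc (\<Sum>i<p. g i)"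
  have G: "p dvd t" if "0 < t" "G \<le> g t" for t
  proof (rule ccontr)
    assume n: "\<not> p dvd t"
    then have "g t = g (t mod p)"
      using levelD[OF p, of t "t mod p"] that by (simp add: mod_greater_zero_iff_not_dvd)
    also have "\<dots> \<le> (\<Sum>i<p. g i)" using p0 by (intro member_le_sum) auto
    finally show False using that by (simp add: G_def)
  qed
  show ?thesis
  \<comment> \<open>Room for \<open>T\<close> gaps shorter than \<open>G\<close> and for inspecting
    one more gap up to length \<open>G\<close>.\<close>
  proof (intro exI[of _ "T * G + G + 1"] allI impI)
    fix n n'
    assume w: "\<forall>j<T * G + G + 1. gap_word g (n + j) = gap_word g (n' + j)"
      and n: "n \<in> range (\<lambda>i. zero_pos g (i * p))"
    obtain i where i: "n = zero_pos g (i * p)" using n by blast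
    define a where "a = i * p"
    have "\<not> gap_word g (n + 0)" using i by simp
    then have "\<not> gap_word g n'" using w by (metis add_0_right add_gr_0 zero_less_one)
    then obtain b where b: "n' = zero_pos g b" by (auto simp: gap_word_def)
    \<comment> \<open>While the gaps stay below \<open>G\<close>, equality propagates from gap to
      gap at a common distance \<open>d\<close> from both starts. A gap of length at least
      \<open>G\<close> occurs on both sides at once, marks a block boundary in both, and settles the
      residues.\<close>
    have step: "a mod p = b mod p \<or> (\<forall>s'<s. g (a + 1 + s') = g (b + 1 + s')) \<and>
        (\<exists>d\<le>s * G. zero_pos g (a + s) = n + d \<and> zero_pos g (b + s) = n' + d)" if "s \<le> T" for s
      using that
    proof (induction s)
      case (Suc s)
      consider "a mod p = b mod p" |
        d where "\<forall>s'<s. g (a + 1 + s') = g (b + 1 + s')" "d \<le> s * G"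
          "zero_pos g (a + s) = n + d" "zero_pos g (b + s) = n' + d"
        using Suc by fastforce
      then show ?case
      proof cases
        case 2
        have "s * G \<le> T * G" using Suc.prems by (intro mult_le_mono1) simp
        then have d: "d \<le> T * G" using 2(2) le_trans by blast
        have win: "gap_word g (zero_pos g (a + s) + j) = gap_word g (zero_pos g (b + s) + j)" if "j \<le> G" for j
          using w[rule_format, of "d + j"] d that 2 by (simp add: add.assoc)
        show ?thesis
        proof (cases "g (Suc (a + s)) < G \<or> g (Suc (b + s)) < G")
          case True
          then have eq: "g (Suc (b + s)) = g (Suc (a + s))" and less: "g (Suc (a + s)) < G"
            using same_gap[of G g "a + s" "b + s", OF win] same_gap[of G g "b + s" "a + s", OF win[symmetric]]
            by auto
          have "\<forall>s'<Suc s. g (a + 1 + s') = g (b + 1 + s')" using 2 eq by (auto simp: less_Suc_eq)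
          moreover have "d + Suc (g (Suc (a + s))) \<le> Suc s * G" using 2 less by simp
          moreover have "zero_pos g (a + Suc s) = n + (d + Suc (g (Suc (a + s))))"
            "zero_pos g (b + Suc s) = n' + (d + Suc (g (Suc (a + s))))" using 2 eq by simp_all
          ultimately show ?thesis by blast
        next
          case False
          then have "p dvd Suc (a + s)" "p dvd Suc (b + s)" using G by simp_all
          then have "(a + Suc s) mod p = (b + Suc s) mod p" by (simp add: dvd_eq_mod_eq_0)
          then have "a mod p = b mod p" by (auto simp: nat_mod_eq_iff)
          then show ?thesis ..
        qed
      qed blast
    qed (use i b in \<open>simp add: a_def\<close>)
    have "a mod p = b mod p"
      using step[of T] T[of "a + 1" "b + 1"] by (auto simp: nat_mod_eq_iff)
    then have "p dvd b" by (simp add: a_def dvd_eq_mod_eq_0)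
    then have "b = (b div p) * p" by simp
    then show "n' \<in> range (\<lambda>i. zero_pos g (i * p))" unfolding b by (metis rangeI)
  qed
qed

lemma block_step:
  assumes "level g p"
  shows "zero_pos g (Suc i * p) = zero_pos g (i * p) + (zero_pos g (p - 1) + 1) + g (Suc i * p)"
  using zero_pos_next_block[OF level_pos[OF assms] assms, of i] by simp

text \<open>Corresponding spacers agree by symmetry, so moving a block one step to the right moves
  its mirror image equally far to the left. The summand \<open>zero_pos g (p - 1)\<close> appears
  because mirroring turns the left end of a block into a right end.\<close>

lemma block_reflection:
  assumes p: "level g p" and q: "level g (r * p)" and s: "symmetric_over g p (r * p)" and i: "i < r"
  shows "zero_pos g (i * p) + zero_pos g ((r - 1 - i) * p) + zero_pos g (p - 1) = zero_pos g (r * p - 1)"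
  using i
proof (induction i)
  case 0
  have "(r - 1) * p + (p - 1) = r * p - 1" using 0 level_pos[OF p] by (cases r) auto
  then show ?case using zero_pos_level_add[OF p, of "p - 1" "r - 1"] level_pos[OF p] by simp
next
  case (Suc i)
  define k where "k = r - 1 - Suc i"
  have k: "r - 1 - i = Suc k" "r = Suc i + Suc k" using Suc.prems by (auto simp: k_def)
  have "Suc i * p < r * p" using Suc.prems level_pos[OF p] by (simp del: mult_Suc)
  then have "g (Suc i * p) = g (r * p - Suc i * p)"
    using s unfolding symmetric_over_def by blast
  moreover have "r * p - Suc i * p = Suc k * p" unfolding k(2) by (simp add: add_mult_distrib)
  ultimately have "g (Suc i * p) = g (Suc k * p)" by simp
  then show ?case
    using Suc.IH Suc.prems block_step[OF p, of i] block_step[OF p, of k] unfolding k(1) k_def[symmetric] by simp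
qed

text \<open>The left-hand side is the letter at \<open>c\<close> after every \<open>p\<close>-block
  has been reversed in place: \<open>c - l\<close> is the start of the block containing
  \<open>c\<close>, and in a spacer the condition is vacuous and yields a one. By symmetry this is
  the reversal of the whole \<open>q\<close>-block, since mirroring permutes the blocks and
  preserves the spacers.\<close>

lemma reflected_block_word:
  assumes p: "level g p" and q: "level g q" and s: "symmetric_over g p q" and c: "c \<le> zero_pos g (q - 1)"
  shows "(\<forall>l\<le>zero_pos g (p - 1). l \<le> c \<and> c - l \<in> range (\<lambda>i. zero_pos g (i * p)) \<longrightarrow>
      gap_word g (zero_pos g (p - 1) - l)) \<longleftrightarrow> gap_word g (zero_pos g (q - 1) - c)"
proof -
  define L where "L = zero_pos g (p - 1)"
  define S where "S i = zero_pos g (i * p)" for i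
  have p0: "0 < p" by (rule level_pos[OF p])
  obtain r where r: "q = r * p" using s by (auto simp: symmetric_over_def dvd_def mult.commute)
  have step: "S (Suc i) = S i + (L + 1) + g (Suc i * p)" for i
    unfolding S_def L_def by (rule block_step[OF p])
  then have "S i < S (Suc i)" for i by (metis add_lessD1 less_add_one add.assoc trans_less_add1 add_Suc_right less_Suc_eq_le le_add1)
  then have mono: "strict_mono S" by (simp add: strict_mono_Suc_iff)
  obtain i where i: "S i \<le> c" "c < S (Suc i)"
    using ex_enclosing_interval[OF mono, of c] by (auto simp: S_def)
  have "zero_pos g (i * p) \<le> zero_pos g (q - 1)" using i(1) c unfolding S_def by linarith
  then have "i * p \<le> q - 1" by simp
  then have "i * p < r * p" using r level_pos[OF q] by linarith
  then have ir: "i < r" by simp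
  have refl: "S i + S (r - 1 - i) + L = zero_pos g (q - 1)"
    using block_reflection[OF p _ _ ir] q s by (simp add: r S_def L_def)
  have only: "j = i \<and> c \<le> S i + L" if "c = S j + l" "l \<le> L" for j l
  proof -
    have "\<not> Suc i \<le> j" using strict_mono_less_eq[OF mono, of "Suc i" j] i that by auto
    moreover have "\<not> Suc j \<le> i"
    proof
      assume "Suc j \<le> i"
      then have "S (Suc j) \<le> S i" using strict_mono_less_eq[OF mono] by simp
      then show False using step[of j] i that by simp
    qed
    ultimately have "j = i" by simp
    then show ?thesis using that by simp
  qed
  have "(\<forall>l\<le>L. l \<le> c \<and> c - l \<in> range S \<longrightarrow> gap_word g (L - l)) \<longleftrightarrow> gap_word g (zero_pos g (q - 1) - c)"
  proof (cases "c \<le> S i + L")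
    case True
    define o' where "o' = c - S i"
    have o': "c = S i + o'" "o' \<le> L" using i True by (auto simp: o'_def)
    have "zero_pos g (q - 1) - c = S (r - 1 - i) + (L - o')" using refl o' by simp
    then have R: "gap_word g (zero_pos g (q - 1) - c) = gap_word g (L - o')"
      using gap_word_block[OF p, of "L - o'" "r - 1 - i"] by (simp add: S_def L_def)
    have "l = o'" if l: "l \<le> L" "l \<le> c" "c - l \<in> range S" for l
    proof -
      obtain j where "c - l = S j" using l(3) by blast
      then have "c = S j + l" using l by simp
      then show ?thesis using only[of j l] l o' by simp
    qed
    moreover have "o' \<le> c" "c - o' \<in> range S" using o' by auto
    ultimately show ?thesis unfolding R using o'(2) by blast
  next
    case False
    have vac: "\<not> (l \<le> c \<and> c - l \<in> range S)" if "l \<le> L" for l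
    proof
      assume l: "l \<le> c \<and> c - l \<in> range S"
      then obtain j where "c - l = S j" by blast
      then have "c = S j + l" using l by simp
      then show False using only[of j l] that False by simp
    qed
    define k where "k = r - 1 - Suc i"
    have "i \<noteq> r - 1"
    proof
      assume "i = r - 1"
      then have "S i + L = zero_pos g (q - 1)" using refl by (simp add: S_def)
      then show False using False c by simp
    qed
    then have k: "r - 1 - i = Suc k" "r = Suc i + Suc k" using ir by (auto simp: k_def)
    have "Suc i * p < q" unfolding r k(2) using p0 by (simp add: add_mult_distrib)
    then have "g (Suc i * p) = g (q - Suc i * p)" using s unfolding symmetric_over_def by blast
    moreover have "q - Suc i * p = Suc k * p" unfolding r k(2) by (simp add: add_mult_distrib)
    ultimately have a: "g (Suc i * p) = g (Suc k * p)" by simp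
    have L: "zero_pos g (k * p + (p - 1)) = S k + L"
      using zero_pos_level_add[OF p, of "p - 1" k] p0 by (simp add: S_def L_def)
    have nxt: "Suc (k * p + (p - 1)) = Suc k * p" using p0 by simp
    have "gap_word g (zero_pos g (q - 1) - c)"
    proof (rule gap_word_between[of g "k * p + (p - 1)"])
      have e: "zero_pos g (q - 1) = S i + S (Suc k) + L" using refl k(1) by simp
      show "zero_pos g (k * p + (p - 1)) < zero_pos g (q - 1) - c"
        unfolding L e using step[of k] step[of i] i a by linarith
      show "zero_pos g (q - 1) - c < zero_pos g (Suc (k * p + (p - 1)))"
        unfolding nxt e S_def[of "Suc k", symmetric] using False step[of k] by linarith
    qed
    then show ?thesis using vac by blast
  qed
  then show ?thesis by (simp add: L_def S_def)
qed

text \<open>A large \<open>q\<close> symmetric over \<open>p\<close> makes the map explicit on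
  windows: if \<open>x\<close> looks like \<open>V\<close> around \<open>c\<close>, then
  \<open>f x\<close> looks like \<open>V\<close> around \<open>zero_pos g (q - 1) - c\<close>.
  Membership in the system and \<open>f (f x) = x\<close> follow from this reflection of
  centres.\<close>

lemma isomorphic_to_inverse:
  assumes p: "level g p" and sym: "\<And>n. \<exists>q>n. level g q \<and> symmetric_over g p q"
  shows "topologically_isomorphic system zshift system (inv zshift)"
proof -
  define L where "L = zero_pos g (p - 1)"
  define S where "S = range (\<lambda>i. zero_pos g (i * p))"
  obtain w where w: "\<And>n n'. (\<And>j. j < w \<Longrightarrow> gap_word g (n + j) = gap_word g (n' + j)) \<Longrightarrow> n \<in> S \<Longrightarrow> n' \<in> S"
    using block_starts_local[OF p] unfolding S_def by blast
  define start where "start x i \<longleftrightarrow> (\<exists>n\<in>S. \<forall>j<w. x (i + int j) = gap_word g (n + j))" for x :: zword and i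
  \<comment> \<open>The letter at \<open>- i\<close> once each block of \<open>x\<close> is reversed
    in place; read backwards in \<open>i\<close>, the blocks appear in their original form. Places
    outside all blocks get a one.\<close>
  define f where "f x i \<longleftrightarrow> (\<forall>l\<le>L. start x (- i - int l) \<longrightarrow> gap_word g (L - l))" for x i
  have start_iff: "start x i \<longleftrightarrow> n \<in> S" if "\<And>j. j < w \<Longrightarrow> x (i + int j) = gap_word g (n + j)" for x i n
    unfolding start_def using that w[of _ n] by auto
  \<comment> \<open>The margin \<open>L + w\<close> lets the rule look back \<open>L\<close> letters
    for a block start and \<open>w\<close> letters ahead to recognize it.\<close>
  have key: "f x (- t) = gap_word g (zero_pos g (q - 1) - nat (c + t))"
    if q: "level g q" "symmetric_over g p q" and N: "int N \<le> c" "c + int N \<le> int (zero_pos g (q - 1))"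
      and x: "\<And>t. \<bar>t\<bar> \<le> int N \<Longrightarrow> x t = gap_word g (nat (c + t))"
      and t: "\<bar>t\<bar> + int L + int w \<le> int N" for x q N c t
  proof -
    define d where "d = nat (c + t)"
    have d: "int d = c + t" "L \<le> d" "d \<le> zero_pos g (q - 1)" using N t by (auto simp: d_def)
    have "start x (t - int l) \<longleftrightarrow> d - l \<in> S" if "l \<le> L" for l
    proof (rule start_iff)
      fix j assume j: "j < w"
      have e: "c + (t - int l + int j) = int (d - l + j)" using d that by (simp add: of_nat_diff)
      have "\<bar>t - int l + int j\<bar> \<le> int N" using t that j by linarith
      then have "x (t - int l + int j) = gap_word g (nat (c + (t - int l + int j)))" by (rule x)
      then show "x (t - int l + int j) = gap_word g (d - l + j)" unfolding e nat_int .
    qed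
    then have "f x (- t) \<longleftrightarrow> (\<forall>l\<le>L. l \<le> d \<and> d - l \<in> S \<longrightarrow> gap_word g (L - l))"
      unfolding f_def using d(2) by auto
    then show ?thesis
      using reflected_block_word[OF p q d(3)] unfolding L_def S_def d_def by simp
  qed
  have window: "\<exists>q c. level g q \<and> symmetric_over g p q \<and> int N \<le> c \<and> c + int N \<le> int (zero_pos g (q - 1)) \<and>
      (\<forall>t. \<bar>t\<bar> \<le> int N \<longrightarrow> x t = gap_word g (nat (c + t)))" if x: "x \<in> system" for x N
  proof -
    obtain k where k: "\<And>j. j < 2 * N + 1 \<Longrightarrow> x (- int N + int j) = gap_word g (k + j)"
      using x unfolding in_system_space_iff by blast
    obtain q where q: "q > k + 2 * N + 1" "level g q" "symmetric_over g p q" using sym by blast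
    have "x t = gap_word g (nat (int (k + N) + t))" if "\<bar>t\<bar> \<le> int N" for t
    proof -
      define j where "j = nat (t + int N)"
      have j: "int j = t + int N" "j < 2 * N + 1" using that by (auto simp: j_def)
      have "int (k + N) + t = int (k + j)" using j by simp
      then have "nat (int (k + N) + t) = k + j" by (simp only: nat_int)
      then show ?thesis using k[OF j(2)] j(1) by simp
    qed
    moreover have "int (k + N) + int N \<le> int (zero_pos g (q - 1))" using q(1) zero_pos_ge[of "q - 1" g] by linarith
    ultimately show ?thesis using q(2,3) by (intro exI[of _ q] exI[of _ "int (k + N)"]) auto
  qed
  have both: "\<exists>q c. level g q \<and> symmetric_over g p q \<and> int N \<le> c \<and> c + int N \<le> int (zero_pos g (q - 1)) \<and>
      (\<forall>t. \<bar>t\<bar> \<le> int N \<longrightarrow> x t = gap_word g (nat (c + t)) \<and>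
        f x t = gap_word g (nat (int (zero_pos g (q - 1)) - c + t)))"
    if x: "x \<in> system" for x N
  proof -
    define M where "M = N + L + w"
    obtain q c where q: "level g q" "symmetric_over g p q"
      and c: "int M \<le> c" "c + int M \<le> int (zero_pos g (q - 1))"
      and xt: "\<And>t. \<bar>t\<bar> \<le> int M \<Longrightarrow> x t = gap_word g (nat (c + t))"
      using window[OF x, of M] by blast
    have "f x t = gap_word g (nat (int (zero_pos g (q - 1)) - c + t))" if "\<bar>t\<bar> \<le> int N" for t
    proof -
      have "f x (- (- t)) = gap_word g (zero_pos g (q - 1) - nat (c + - t))"
        by (rule key[OF q c xt]) (use that in \<open>auto simp: M_def\<close>)
      moreover have "zero_pos g (q - 1) - nat (c + - t) = nat (int (zero_pos g (q - 1)) - c + t)"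
        using c that by (simp add: M_def)
      ultimately show ?thesis by simp
    qed
    moreover have "int N \<le> c" "c + int N \<le> int (zero_pos g (q - 1))" using c by (auto simp: M_def)
    moreover have "x t = gap_word g (nat (c + t))" if "\<bar>t\<bar> \<le> int N" for t
      using xt[of t] that by (simp add: M_def)
    ultimately show ?thesis using q by blast
  qed
  have f_in: "f x \<in> system" if x: "x \<in> system" for x
  proof (rule in_system_spaceI_centered)
    fix n
    obtain q c where c: "int n \<le> c" "c + int n \<le> int (zero_pos g (q - 1))"
      and ft: "\<And>t. \<bar>t\<bar> \<le> int n \<Longrightarrow> f x t = gap_word g (nat (int (zero_pos g (q - 1)) - c + t))"
      using both[OF x, of n] by blast
    define k where "k = nat (int (zero_pos g (q - 1)) - c - int n)"
    have "f x (int j - int n) = gap_word g (k + j)" if "j < 2 * n + 1" for j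
    proof -
      have "int (zero_pos g (q - 1)) - c + (int j - int n) = int (k + j)" using c by (simp add: k_def)
      moreover have "\<bar>int j - int n\<bar> \<le> int n" using that by auto
      ultimately show ?thesis using ft[of "int j - int n"] by (simp only: nat_int)
    qed
    then show "\<exists>k. \<forall>j<2 * n + 1. f x (int j - int n) = gap_word g (k + j)" by blast
  qed
  have inv: "f (f x) = x" if x: "x \<in> system" for x
  proof
    fix t
    define N where "N = nat \<bar>t\<bar> + L + w"
    obtain q c where q: "level g q" "symmetric_over g p q"
      and c: "int N \<le> c" "c + int N \<le> int (zero_pos g (q - 1))"
      and xt: "\<And>t. \<bar>t\<bar> \<le> int N \<Longrightarrow> x t = gap_word g (nat (c + t))"
      and ft: "\<And>t. \<bar>t\<bar> \<le> int N \<Longrightarrow> f x t = gap_word g (nat (int (zero_pos g (q - 1)) - c + t))"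
      using both[OF x, of N] by blast
    have "f (f x) (- (- t)) = gap_word g (zero_pos g (q - 1) - nat (int (zero_pos g (q - 1)) - c + - t))"
      by (rule key[OF q _ _ ft, where N = N]) (use c in \<open>auto simp: N_def\<close>)
    moreover have "zero_pos g (q - 1) - nat (int (zero_pos g (q - 1)) - c + - t) = nat (c + t)"
      using c by (simp add: N_def)
    moreover have "\<bar>t\<bar> \<le> int N" by (simp add: N_def)
    ultimately show "f (f x) t = x t" using xt[of t] by simp
  qed
  have "start (zshift x) i \<longleftrightarrow> start x (i + 1)" for x i
    by (simp add: start_def zshift_def algebra_simps)
  then have comm: "f (zshift x) = inv zshift (f x)" for x
    by (simp add: f_def inv_zshift fun_eq_iff algebra_simps)
  have cont: "continuous_on system f"
  proof (rule continuous_on_subset[OF _ subset_UNIV], rule continuous_on_coordinatewise_then_product)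
    fix i
    have "open ((\<lambda>x. f x i) -` B)" for B
      unfolding vimage_def
    proof (rule open_cylinder)
      show "finite ((\<lambda>(l, j). - i - int l + int j) ` ({..L} \<times> {..<w}))" by simp
      fix x z :: zword
      assume eq: "\<And>k. k \<in> (\<lambda>(l, j). - i - int l + int j) ` ({..L} \<times> {..<w}) \<Longrightarrow> x k = z k"
      have "start x (- i - int l) = start z (- i - int l)" if "l \<le> L" for l
      proof -
        have "x (- i - int l + int j) = z (- i - int l + int j)" if "j < w" for j
          using that \<open>l \<le> L\<close> by (intro eq) (auto intro!: image_eqI[of _ _ "(l, j)"])
        then show ?thesis by (simp add: start_def)
      qed
      then have "f x i = f z i" by (simp add: f_def)
      then show "(f x i \<in> B) = (f z i \<in> B)" by simp
    qed
    then show "continuous_on UNIV (\<lambda>x. f x i)" by (simp add: continuous_on_open_vimage)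
  qed
  have "homeomorphism system system f f"
    by (rule homeomorphismI) (use cont f_in inv in auto)
  then show ?thesis unfolding topologically_isomorphic_def using comm by blast
qed

end

section \<open>The characterization\<close>

theorem theorem1p4:
  fixes V :: iword and v :: "nat \<Rightarrow> fword"
  assumes "rank_one V" and "\<not> degenerate V"
    and "canonical_generating_sequence V v"
  shows "topologically_isomorphic (system_space V) zshift (system_space V) (inv zshift) \<longleftrightarrow>
    finite {n. \<not> symmetrically_built_from (v n) (v (Suc n))}"
proof -
  obtain g where V: "V = stream_of_gaps g" and g: "rank_one_gaps g"
    using rank_one_gaps_exists[OF assms(1,2)] .
  interpret rank_one_gaps g by (rule g)
  have bij_v: "bij_betw v UNIV (prefix_word g ` {P. fundamental g P})"
    and ord_v: "\<And>n m. n \<le> m \<longleftrightarrow> v n \<preceq> v m"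
    using assms(3) unfolding canonical_generating_sequence_def V words_B_stream_of_gaps by blast+
  have "\<exists>P. v n = prefix_word g P \<and> fundamental g P" for n
    using bij_betwE[OF bij_v] by auto
  then obtain P where v: "\<And>n. v n = prefix_word g (P n)" and fP: "\<And>n. fundamental g (P n)" by metis
  have lP: "level g (P n)" for n using fP by (simp add: fundamental_def)
  have P0: "0 < P n" for n by (rule level_pos[OF lP])
  have ord: "n \<le> m \<longleftrightarrow> P n dvd P m" for n m
    using ord_v[of n m] built_from_prefix_word[OF lP lP] by (simp add: v)
  have bij: "bij_betw P UNIV {p. fundamental g p}"
  proof (rule bij_betw_imageI)
    show "inj P" by (rule injI) (use ord in \<open>metis antisym order_refl\<close>)
    show "range P = {p. fundamental g p}"
    proof (intro set_eqI iffI)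
      fix q assume q: "q \<in> {p. fundamental g p}"
      then have "prefix_word g q \<in> range v" using bij_v by (auto simp: bij_betw_def)
      then obtain n where "prefix_word g q = prefix_word g (P n)" using v by auto
      moreover have "0 < q" using q level_pos by (auto simp: fundamental_def)
      ultimately show "q \<in> range P" using prefix_word_eq_iff P0 by blast
    qed (use fP in auto)
  qed
  have strict: "strict_mono P"
    unfolding strict_mono_Suc_iff
  proof
    fix n
    have "P n dvd P (Suc n)" "\<not> P (Suc n) dvd P n" using ord[of n "Suc n"] ord[of "Suc n" n] by auto
    then show "P n < P (Suc n)" using dvd_imp_le[OF _ P0] by (metis dvd_refl le_neq_implies_less)
  qed
  have sym_iff: "symmetrically_built_from (v n) (v (Suc n)) \<longleftrightarrow> symmetric_over g (P n) (P (Suc n))" for n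
    unfolding v by (rule symmetrically_built_from_prefix_word[OF lP lP])
  show ?thesis
  proof
    assume "topologically_isomorphic (system_space V) zshift (system_space V) (inv zshift)"
    then obtain y R where "reversed_factor g y R"
      using reversed_factor_of_isomorphism unfolding V by blast
    then interpret reversed_factor g y R .
    have dvdP: "P m dvd P n" if "m \<le> n" for m n using ord that by blast
    from reversed_chain[OF lP dvdP strict]
    obtain M Q c where Q: "\<forall>m\<ge>M. level g (Q m) \<and>
      c = int (zero_pos g (P m - 1)) - int (zero_pos g (Q m - 1)) \<and>
      (\<forall>n\<ge>m. Q n * P m = Q m * P n \<and>
        (\<forall>i. 0 < i \<and> i * P m < P n \<longrightarrow> int (g (i * Q m)) = int (g (P n - i * P m)) + c))"
      by metis
    have "\<exists>N. \<forall>n\<ge>N. \<forall>i. 0 < i \<and> i * P n < P (Suc n) \<longrightarrow> g (i * P n) = g (P (Suc n) - i * P n)"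
      by (rule symmetric_of_reflected_chain[OF bij ord, where M = M and Q = Q and c = c]) (use Q in blast)+
    then obtain N where N: "\<And>n i. N \<le> n \<Longrightarrow> 0 < i \<Longrightarrow> i * P n < P (Suc n) \<Longrightarrow> g (i * P n) = g (P (Suc n) - i * P n)"
      by metis
    have "n < N" if "\<not> symmetrically_built_from (v n) (v (Suc n))" for n
    proof (rule ccontr)
      assume "\<not> n < N"
      then have "symmetric_over g (P n) (P (Suc n))"
        unfolding symmetric_over_def using N[of n] ord[of n "Suc n"] by simp
      then show False using that sym_iff by blast
    qed
    then show "finite {n. \<not> symmetrically_built_from (v n) (v (Suc n))}"
      by (intro finite_subset[OF _ finite_lessThan[of N]]) auto
  next
    assume "finite {n. \<not> symmetrically_built_from (v n) (v (Suc n))}"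
    then obtain N where N: "\<And>n. \<not> symmetrically_built_from (v n) (v (Suc n)) \<Longrightarrow> n < N"
      using finite_nat_set_iff_bounded[of "{n. \<not> symmetrically_built_from (v n) (v (Suc n))}"] by auto
    \<comment> \<open>All later prefixes are made symmetric over the single base \<open>P N\<close>,
      because the involution handles copies of one fixed block.\<close>
    have sym: "symmetric_over g (P N) (P (N + k))" for k
    proof (induction k)
      case (Suc k)
      have "symmetric_over g (P (N + k)) (P (Suc (N + k)))" using N[of "N + k"] sym_iff by auto
      then show ?case using symmetric_over_trans[OF Suc _ lP P0] by simp
    qed (simp add: symmetric_over_refl)
    have "\<exists>q>n. level g q \<and> symmetric_over g (P N) q" for n
      using strict_mono_imp_increasing[OF strict, of "N + Suc n"] lP sym[of "Suc n"]
      by (intro exI[of _ "P (N + Suc n)"]) auto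
    then show "topologically_isomorphic (system_space V) zshift (system_space V) (inv zshift)"
      unfolding V by (rule isomorphic_to_inverse[OF lP])
  qed
qed

end
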